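(* Let $\mathbb K$ be a field of characteristic $0$, and let $(L,D,T_D,C,T_C,\tau)$ be data satisfying (IAa)–(IAf) of the context, where $S$ is a locally finite root system and $\Lambda$ a torsion-free abelian group. Let $E=C\oplus L\oplus D$, $T=T_C\oplus\mathfrak h\oplus T_D$, and the bilinear form $(\cdot|\cdot)_E$ be constructed as in the context. Then $(E,T)$ is an invariant affine reflection algebra with respect to the form $(\cdot|\cdot)_E$, and its centreless core is $L$. Moreover, with $C_{\min}=\operatorname{Span}_{\mathbb K}\{\sigma_D(l_1,l_2):l_i\in L\}$: (a) The core $E_c$ of $E$ is always contained in $C_{\min}\oplus L$, and $(E,T)$ is tame if and only if $E_c=C\oplus L$, which is in turn equivalent to $C\oplus L$ being perfect. (b) If $D=T_D=\mathcal D$ and $C=T_C=C_{\min}$, then $(E,T)$ is tame. (c) The root system $R$ of $(E,T)$ is always tame. (d) $E_0=T$ if and only if $L$ is an invariant Lie torus, $T_D=D^0$ and $T_C=C^0$.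
   Context: **Root-graded Lie algebras.** A locally finite root system is a subset $S$ of a $\mathbb K$-vector space $Y$ with $0\in S$, $S$ spanning $Y$, $|S\cap V|<\infty$ for finite-dimensional subspaces $V\subset Y$, together with $\alpha^\vee\in Y^*$ for $0\neq\alpha\in S$ such that $\langle\alpha,\alpha^\vee\rangle=2$, $s_\alpha(S)=S$ for $s_\alpha(y)=y-\langle y,\alpha^\vee\rangle\alpha$, and $\langle S,\alpha^\vee\rangle\subset\mathbb Z$. Put $S^\times=S\setminus\{0\}$, $S_{\rm ind}=\{0\}\cup\{\alpha\in S:\alpha/2\notin S\}$, $\mathcal Q(S)=\operatorname{Span}_{\mathbb Z}S$. Let $L=\bigoplus_{q\in\mathcal Q(S),\lambda\in\Lambda}L_q^\lambda$ be a $(\mathcal Q(S)\oplus\Lambda)$-graded Lie algebra over $\mathbb K$, $L_q=\bigoplus_\lambda L_q^\lambda$, $L^\lambda=\bigoplus_qL_q^\lambda$. A non-zero $e\in L_\alpha^\lambda$ ($\alpha\in S^\times$) is invertible, with inverse $f\in L_{-\alpha}^{-\lambda}$, if $h=[f,e]$ satisfies $[h,x]=\langle q,\alpha^\vee\rangle x$ for all $q\in\mathcal Q(S)$, $x\in L_q$. $L$ is predivision-$(S,\Lambda)$-graded if (RG1) $L_q=0$ for $q\notin S$; (RG2) every $L_\alpha^0$, $0\neq\alpha\in S_{\rm ind}$, contains an invertible element; (RG3) $L_0=\sum_{0\ne\alpha\in S}[L_\alpha,L_{-\alpha}]$; and every non-zero $L_\alpha^\lambda$, $\alpha\in S^\times$,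 contains an invertible element. It is a Lie torus if moreover $\dim L_\alpha^\lambda\le1$ for all $\alpha\in S^\times$, $\lambda \in \Lambda$. It is invariant if it has an invariant ($([a,b]|c)=(a|[b,c])$) nondegenerate symmetric bilinear form $(\cdot|\cdot)_L$ that is $\Lambda$-graded ($(L^\lambda|L^\mu)_L=0$ for $\lambda+\mu\neq0$) and whose restriction to $\operatorname{Span}\{[e_\alpha,f_\alpha]:0\ne\alpha\in S_{\rm ind}\}$ is nondegenerate for some choice of invertible $e_\alpha\in L_\alpha^0$ with inverses $f_\alpha$. **Skew centroidal derivations.** The centroid $\operatorname{Cent}(L)$ consists of the $\mathbb K$-linear endomorphisms of $L$ commuting with all $\operatorname{ad}x$; $\operatorname{Cent}(L)^\lambda$ denotes the elements mapping $L^\mu$ to $L^{\lambda+\mu}$ for all $\mu$. For $\theta\in\operatorname{Hom}_{\mathbb Z}(\Lambda,\operatorname{Cent}(L)^\lambda)$ define the derivation $\partial_\theta$ of degree $\lambda$ by $\partial_\theta(x)=\theta(\mu)(x)$ for $x\in L^\mu$. Put $(\operatorname{SCDer}L)^\lambda=\{\partial_\theta:\theta\in\operatorname{Hom}(\Lambda,\operatorname{Cent}(L)^\lambda),\ \theta(\lambda)=0\}$ and $\operatorname{grSCDer}L=\bigoplus_{\lambda\in\Lambda}(\operatorname{SCDer}L)^\lambda$, the $\Lambda$-graded Lie algebra of graded centroidal derivations that are skew-symmetric for $(\cdot|\cdot)_L$. $\mathcal D=\{\partial_\theta:\theta\in\operatorname{Hom}_{\mathbb Z}(\Lambda,\mathbb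 K)\}\subset(\operatorname{SCDer}L)^0$ (identifying $\mathbb K$ with $\mathbb K\,\mathrm{Id}_L$) are the degree derivations; each $\lambda\in\Lambda$ gives $\operatorname{ev}_\lambda\in\mathcal D^*$, $\operatorname{ev}_\lambda(\partial_\theta)=\theta(\lambda)$. **Data.** (IAa) $L=\bigoplus_{\xi\in S,\lambda\in\Lambda}L_\xi^\lambda$ is an invariant predivision-$(S,\Lambda)$-graded Lie algebra with $\Lambda$ torsion-free. One assumes (harmlessly) that $L_\xi\neq0$ for all $\xi\in S$ and that $\Lambda$ is generated by $\{\lambda:L^\lambda\ne0\}$. Put $\Lambda_\xi=\{\lambda:L_\xi^\lambda\ne0\}$. Choose $(e_\xi^\lambda,h_\xi^\lambda,f_\xi^\lambda)\in L_\xi^\lambda\times L_0^0\times L_{-\xi}^{-\lambda}$ for $\xi\in S$, $\lambda\in\Lambda_\xi$, such that for $\xi\neq0$ the element $e_\xi^\lambda$ is invertible with inverse $f_\xi^\lambda$ and $h_\xi^\lambda=[f_\xi^\lambda,e_\xi^\lambda]$, and for $\xi=0$: $(e_0^\lambda|f_0^\lambda)_L\ne0$ but $[f_0^\lambda,e_0^\lambda]=0=h_0^\lambda$. Put $\mathfrak h=\operatorname{Span}_{\mathbb K}\{h_\xi^0:0\neq\xi\in S_{\rm ind}\}$. (IAb) $D=\bigoplus_\lambda D^\lambda$ is a $\Lambda$-graded subalgebra of $\operatorname{grSCDer}L$. (IAc) $T_D\subset D^0\cap\mathcal D$ is a subspace such that $\Lambda\to T_D^*$, $\lambda\mapsto\operatorname{ev}_\lambda|_{T_D}$,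 is injective. (IAd) Let $D^{{\rm gr}*}=\bigoplus_\lambda(D^{-\lambda})^*$ be the graded dual of $D$ (with $(D^{{\rm gr}*})^\lambda=(D^{-\lambda})^*$), on which $D$ acts by the contragredient action $(d\cdot c)(d')=-c([d,d'])$. $C=\bigoplus_\lambda C^\lambda$ is a $\Lambda$-graded $D$-invariant subspace of $D^{{\rm gr}*}$ containing all $\sigma_D(l_1,l_2)$, where $\sigma_D\colon L\times L\to D^{{\rm gr}*}$, $\sigma_D(l_1,l_2)(d)=(d(l_1)|l_2)_L$. (IAe) $T_C\subset C^0$ is a subspace such that $T_C\to T_D^*$, $t_C\mapsto t_C|_{T_D}$, is injective and $\sigma_D(e_\xi^\lambda,f_\xi^\lambda)\in T_C$ for all $\xi\in S$, $\lambda\in\Lambda_\xi$. (IAf) $\tau\colon D\times D\to C$ is a bilinear map with $\tau(d,d)=0$, $\sum_{\circlearrowright}\tau([d_1,d_2],d_3)=\sum_{\circlearrowright}d_1\cdot\tau(d_2,d_3)$ (cyclic sums over $(1,2,3)$), $\tau(d_1,d_2)(d_3)=\tau(d_2,d_3)(d_1)$, and $\tau(T_D,D)=0$. **Construction.** $E=C\oplus L\oplus D$ is a Lie algebra with product $$[c_1\oplus l_1\oplus d_1,\,c_2\oplus l_2\oplus d_2]=\big(\sigma_D(l_1,l_2)+d_1\cdot c_2-d_2\cdot c_1+\tau(d_1,d_2)\big)\oplus\big([l_1,l_2]_L+d_1(l_2)-d_2(l_1)\big)\oplus[d_1,d_2]_D,$$ $T=T_C\oplus\mathfrak h\oplus T_D$,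 and $(c_1\oplus l_1\oplus d_1|c_2\oplus l_2\oplus d_2)_E=c_1(d_2)+c_2(d_1)+(l_1|l_2)_L$. **Invariant affine reflection algebras.** A toral pair $(E,T)$ is a non-zero Lie algebra $E$ with a subspace $T$ such that $E=\bigoplus_{\alpha\in T^*}E_\alpha$, $E_\alpha=\{x:[t,x]=\alpha(t)x\ \forall t\in T\}$; its set of roots ("root system") is $R=\{\alpha:E_\alpha\ne0\}$. It is an invariant affine reflection algebra with respect to a form $(\cdot|\cdot)$ if: (IA1) $(\cdot|\cdot)$ is an invariant nondegenerate symmetric bilinear form on $E$ whose restriction to $T\times T$ is nondegenerate, and for every $\alpha\in R$ there is $t_\alpha\in T$ with $(t_\alpha|t)=\alpha(t)$ for all $t\in T$; (IA2) for every $0\ne\alpha\in R$ there are $e_{\pm\alpha}\in E_{\pm\alpha}$ with $0\ne[e_\alpha,e_{-\alpha}]\in T$; (IA3) $\operatorname{ad}x_\alpha$ is locally nilpotent on $E$ for all $x_\alpha\in E_\alpha$, $\alpha\in R^{\rm an}:=\{\alpha\in R:(t_\alpha|t_\alpha)\ne0\}$. The core $E_c$ is the subalgebra generated by $\{E_\alpha:\alpha\in R^{\rm an}\}$; the centreless core is $E_c/\mathrm Z(E_c)$. $(E,T)$ is tame if the centralizer of $E_c$ in $E$ is contained in $E_c$. $R$ is tame if $R\setminus R^{\rm an}\subset R^{\rm an}+R^{\rm an}$. *)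

theory Defs
  imports
    Complex_Main
    "HOL-Library.Function_Algebras"
    "HOL-Library.Product_Plus"
    "HOL-Library.FuncSet"
    "HOL-Computational_Algebra.Group_Closure"
begin

section \<open>Linear algebra on carriers\<close>

text \<open>Vector spaces carry an explicit scalar multiplication, as in the locale \<^locale>\<open>vector_space\<close>.
  Linear maps and functionals form function types with the pointwise operations; functionals on a
  subspace \<open>V\<close> are represented by functions that vanish outside \<open>V\<close>, which makes the
  representation unique and compatible with pointwise addition.\<close>

definition fun_scale :: "('k \<Rightarrow> 'b \<Rightarrow> 'b) \<Rightarrow> 'k \<Rightarrow> ('a \<Rightarrow> 'b) \<Rightarrow> 'a \<Rightarrow> 'b"
  where "fun_scale s k f = (\<lambda>x. s k (f x))"

definition dual_on :: "('k::field \<Rightarrow> 'a::ab_group_add \<Rightarrow> 'a) \<Rightarrow> 'a set \<Rightarrow> ('a \<Rightarrow> 'k) set"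
  where "dual_on s V = {\<phi>.
    (\<forall>x\<in>V. \<forall>y\<in>V. \<phi> (x + y) = \<phi> x + \<phi> y) \<and>
    (\<forall>k. \<forall>x\<in>V. \<phi> (s k x) = k * \<phi> x) \<and>
    (\<forall>x. x \<notin> V \<longrightarrow> \<phi> x = 0)}"

definition bilinear_on ::
  "('k \<Rightarrow> 'a::ab_group_add \<Rightarrow> 'a) \<Rightarrow> ('k \<Rightarrow> 'b::ab_group_add \<Rightarrow> 'b) \<Rightarrow> 'a set \<Rightarrow> ('a \<Rightarrow> 'a \<Rightarrow> 'b) \<Rightarrow> bool"
  where "bilinear_on s t V B \<longleftrightarrow>
    (\<forall>x\<in>V. \<forall>y\<in>V. \<forall>z\<in>V. B (x + y) z = B x z + B y z \<and> B z (x + y) = B z x + B z y) \<and>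
    (\<forall>k. \<forall>x\<in>V. \<forall>y\<in>V. B (s k x) y = t k (B x y) \<and> B x (s k y) = t k (B x y))"

text \<open>Used for symmetric forms only, so one radical suffices.\<close>

definition nondegenerate_on :: "'a::zero set \<Rightarrow> ('a \<Rightarrow> 'a \<Rightarrow> 'k::zero) \<Rightarrow> bool"
  where "nondegenerate_on V B \<longleftrightarrow> (\<forall>x\<in>V. (\<forall>y\<in>V. B x y = 0) \<longrightarrow> x = 0)"

definition decomposes :: "'i set \<Rightarrow> ('i \<Rightarrow> 'a::comm_monoid_add set) \<Rightarrow> 'a \<Rightarrow> ('i \<Rightarrow> 'a) \<Rightarrow> bool"
  where "decomposes I W x u \<longleftrightarrow>
    (\<forall>i\<in>I. u i \<in> W i) \<and> (\<forall>i. i \<notin> I \<longrightarrow> u i = 0) \<and> finite {i. u i \<noteq> 0} \<and> x = (\<Sum>i | u i \<noteq> 0. u i)"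

definition is_direct_sum ::
  "('k::field \<Rightarrow> 'a::ab_group_add \<Rightarrow> 'a) \<Rightarrow> 'a set \<Rightarrow> 'i set \<Rightarrow> ('i \<Rightarrow> 'a set) \<Rightarrow> bool"
  where "is_direct_sum s V I W \<longleftrightarrow>
    (\<forall>i\<in>I. module.subspace s (W i) \<and> W i \<subseteq> V) \<and> (\<forall>x\<in>V. \<exists>!u. decomposes I W x u)"

definition component :: "'i set \<Rightarrow> ('i \<Rightarrow> 'a::comm_monoid_add set) \<Rightarrow> 'i \<Rightarrow> 'a \<Rightarrow> 'a"
  where "component I W i x = (THE u. decomposes I W x u) i"

section \<open>Lie algebras\<close>

locale lie_algebra = vector_space s
  for s :: "'k::field \<Rightarrow> 'a::ab_group_add \<Rightarrow> 'a" +
  fixes V :: "'a set" and br :: "'a \<Rightarrow> 'a \<Rightarrow> 'a"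
  assumes carrier_subspace: "module.subspace s V"
    and bracket_closed: "\<And>x y. x \<in> V \<Longrightarrow> y \<in> V \<Longrightarrow> br x y \<in> V"
    and bracket_bilinear: "bilinear_on s s V br"
    and bracket_alternating: "\<And>x. x \<in> V \<Longrightarrow> br x x = 0"
    and jacobi: "\<And>x y z. x \<in> V \<Longrightarrow> y \<in> V \<Longrightarrow> z \<in> V \<Longrightarrow>
      br x (br y z) + br y (br z x) + br z (br x y) = 0"

definition lie_subalgebra ::
  "('k::field \<Rightarrow> 'a::ab_group_add \<Rightarrow> 'a) \<Rightarrow> 'a set \<Rightarrow> ('a \<Rightarrow> 'a \<Rightarrow> 'a) \<Rightarrow> 'a set \<Rightarrow> bool"
  where "lie_subalgebra s V br M \<longleftrightarrow>
    M \<subseteq> V \<and> module.subspace s M \<and> (\<forall>x\<in>M. \<forall>y\<in>M. br x y \<in> M)"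

definition lie_centralizer :: "'a::zero set \<Rightarrow> ('a \<Rightarrow> 'a \<Rightarrow> 'a) \<Rightarrow> 'a set \<Rightarrow> 'a set"
  where "lie_centralizer V br M = {x\<in>V. \<forall>m\<in>M. br x m = 0}"

definition lie_centre :: "'a::zero set \<Rightarrow> ('a \<Rightarrow> 'a \<Rightarrow> 'a) \<Rightarrow> 'a set"
  where "lie_centre V br = lie_centralizer V br V"

definition perfect_lie ::
  "('k::field \<Rightarrow> 'a::ab_group_add \<Rightarrow> 'a) \<Rightarrow> 'a set \<Rightarrow> ('a \<Rightarrow> 'a \<Rightarrow> 'a) \<Rightarrow> bool"
  where "perfect_lie s V br \<longleftrightarrow> module.span s {br x y | x y. x \<in> V \<and> y \<in> V} = V"

definition lie_coset :: "'a::ab_group_add set \<Rightarrow> 'a \<Rightarrow> 'a set"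
  where "lie_coset Z x = {x + z | z. z \<in> Z}"

text \<open>\<open>\<phi>\<close> is an isomorphism from the quotient of the Lie algebra \<open>V\<close> by its ideal \<open>Z\<close>, with
  elements the cosets and operations given by representatives, onto the Lie algebra \<open>V'\<close>.\<close>

definition lie_quotient_iso ::
  "('k \<Rightarrow> 'a::ab_group_add \<Rightarrow> 'a) \<Rightarrow> 'a set \<Rightarrow> ('a \<Rightarrow> 'a \<Rightarrow> 'a) \<Rightarrow> 'a set \<Rightarrow>
   ('k \<Rightarrow> 'b::ab_group_add \<Rightarrow> 'b) \<Rightarrow> 'b set \<Rightarrow> ('b \<Rightarrow> 'b \<Rightarrow> 'b) \<Rightarrow> ('a set \<Rightarrow> 'b) \<Rightarrow> bool"
  where "lie_quotient_iso s V br Z s' V' br' \<phi> \<longleftrightarrow>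
    bij_betw \<phi> (lie_coset Z ` V) V' \<and>
    (\<forall>x\<in>V. \<forall>y\<in>V. \<phi> (lie_coset Z (x + y)) = \<phi> (lie_coset Z x) + \<phi> (lie_coset Z y)) \<and>
    (\<forall>k. \<forall>x\<in>V. \<phi> (lie_coset Z (s k x)) = s' k (\<phi> (lie_coset Z x))) \<and>
    (\<forall>x\<in>V. \<forall>y\<in>V. \<phi> (lie_coset Z (br x y)) = br' (\<phi> (lie_coset Z x)) (\<phi> (lie_coset Z y)))"

definition invariant_form ::
  "('k::field \<Rightarrow> 'a::ab_group_add \<Rightarrow> 'a) \<Rightarrow> 'a set \<Rightarrow> ('a \<Rightarrow> 'a \<Rightarrow> 'a) \<Rightarrow> ('a \<Rightarrow> 'a \<Rightarrow> 'k) \<Rightarrow> bool"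
  where "invariant_form s V br B \<longleftrightarrow>
    bilinear_on s (*) V B \<and>
    (\<forall>x\<in>V. \<forall>y\<in>V. B x y = B y x) \<and>
    (\<forall>x\<in>V. \<forall>y\<in>V. \<forall>z\<in>V. B (br x y) z = B x (br y z)) \<and>
    nondegenerate_on V B"

section \<open>Invariant affine reflection algebras\<close>

definition root_space ::
  "('k \<Rightarrow> 'a \<Rightarrow> 'a) \<Rightarrow> 'a set \<Rightarrow> ('a \<Rightarrow> 'a \<Rightarrow> 'a) \<Rightarrow> 'a set \<Rightarrow> ('a \<Rightarrow> 'k) \<Rightarrow> 'a set"
  where "root_space s E br T \<alpha> = {x\<in>E. \<forall>t\<in>T. br t x = s (\<alpha> t) x}"

definition toral_pair ::
  "('k::field \<Rightarrow> 'a::ab_group_add \<Rightarrow> 'a) \<Rightarrow> 'a set \<Rightarrow> ('a \<Rightarrow> 'a \<Rightarrow> 'a) \<Rightarrow> 'a set \<Rightarrow> bool"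
  where "toral_pair s E br T \<longleftrightarrow>
    lie_algebra s E br \<and> E \<noteq> {0} \<and> module.subspace s T \<and> T \<subseteq> E \<and>
    is_direct_sum s E (dual_on s T) (root_space s E br T)"

definition roots ::
  "('k::field \<Rightarrow> 'a::ab_group_add \<Rightarrow> 'a) \<Rightarrow> 'a set \<Rightarrow> ('a \<Rightarrow> 'a \<Rightarrow> 'a) \<Rightarrow> 'a set \<Rightarrow> ('a \<Rightarrow> 'k) set"
  where "roots s E br T = {\<alpha>\<in>dual_on s T. root_space s E br T \<alpha> \<noteq> {0}}"

text \<open>The element \<open>t\<^sub>\<alpha>\<close> of \<open>T\<close> representing \<open>\<alpha>\<close>; unique when the form is nondegenerate on \<open>T\<close>.\<close>

definition root_representative :: "'a set \<Rightarrow> ('a \<Rightarrow> 'a \<Rightarrow> 'k) \<Rightarrow> ('a \<Rightarrow> 'k) \<Rightarrow> 'a"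
  where "root_representative T B \<alpha> = (THE t. t \<in> T \<and> (\<forall>t'\<in>T. B t t' = \<alpha> t'))"

definition anisotropic_roots ::
  "('k::field \<Rightarrow> 'a::ab_group_add \<Rightarrow> 'a) \<Rightarrow> 'a set \<Rightarrow> ('a \<Rightarrow> 'a \<Rightarrow> 'a) \<Rightarrow> 'a set \<Rightarrow> ('a \<Rightarrow> 'a \<Rightarrow> 'k) \<Rightarrow> ('a \<Rightarrow> 'k) set"
  where "anisotropic_roots s E br T B =
    {\<alpha>\<in>roots s E br T. B (root_representative T B \<alpha>) (root_representative T B \<alpha>) \<noteq> 0}"

definition invariant_affine_reflection_algebra ::
  "('k::field \<Rightarrow> 'a::ab_group_add \<Rightarrow> 'a) \<Rightarrow> 'a set \<Rightarrow> ('a \<Rightarrow> 'a \<Rightarrow> 'a) \<Rightarrow> 'a set \<Rightarrow> ('a \<Rightarrow> 'a \<Rightarrow> 'k) \<Rightarrow> bool"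
  where "invariant_affine_reflection_algebra s E br T B \<longleftrightarrow>
    toral_pair s E br T \<and>
    invariant_form s E br B \<and> nondegenerate_on T B \<and>
    (\<forall>\<alpha>\<in>roots s E br T. \<exists>t\<in>T. \<forall>t'\<in>T. B t t' = \<alpha> t') \<and>
    (\<forall>\<alpha>\<in>roots s E br T. \<alpha> \<noteq> 0 \<longrightarrow>
      (\<exists>x\<in>root_space s E br T \<alpha>. \<exists>y\<in>root_space s E br T (- \<alpha>). br x y \<noteq> 0 \<and> br x y \<in> T)) \<and>
    (\<forall>\<alpha>\<in>anisotropic_roots s E br T B. \<forall>x\<in>root_space s E br T \<alpha>. \<forall>y\<in>E. \<exists>n. (br x ^^ n) y = 0)"

definition lie_core ::
  "('k::field \<Rightarrow> 'a::ab_group_add \<Rightarrow> 'a) \<Rightarrow> 'a set \<Rightarrow> ('a \<Rightarrow> 'a \<Rightarrow> 'a) \<Rightarrow> 'a set \<Rightarrow> ('a \<Rightarrow> 'a \<Rightarrow> 'k) \<Rightarrow> 'a set"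
  where "lie_core s E br T B =
    lie_subalgebra s E br hull (\<Union>\<alpha>\<in>anisotropic_roots s E br T B. root_space s E br T \<alpha>)"

definition tame_pair ::
  "('k::field \<Rightarrow> 'a::ab_group_add \<Rightarrow> 'a) \<Rightarrow> 'a set \<Rightarrow> ('a \<Rightarrow> 'a \<Rightarrow> 'a) \<Rightarrow> 'a set \<Rightarrow> ('a \<Rightarrow> 'a \<Rightarrow> 'k) \<Rightarrow> bool"
  where "tame_pair s E br T B \<longleftrightarrow> lie_centralizer E br (lie_core s E br T B) \<subseteq> lie_core s E br T B"

definition tame_roots ::
  "('k::field \<Rightarrow> 'a::ab_group_add \<Rightarrow> 'a) \<Rightarrow> 'a set \<Rightarrow> ('a \<Rightarrow> 'a \<Rightarrow> 'a) \<Rightarrow> 'a set \<Rightarrow> ('a \<Rightarrow> 'a \<Rightarrow> 'k) \<Rightarrow> bool"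
  where "tame_roots s E br T B \<longleftrightarrow>
    (\<forall>\<alpha>\<in>roots s E br T - anisotropic_roots s E br T B.
      \<exists>\<beta>\<in>anisotropic_roots s E br T B. \<exists>\<gamma>\<in>anisotropic_roots s E br T B. \<alpha> = \<beta> + \<gamma>)"

section \<open>Locally finite root systems\<close>

text \<open>\<open>co \<alpha>\<close> is the coroot \<open>\<alpha>\<^sup>\<or>\<close>, so \<open>co \<alpha> y\<close> is \<open>\<langle>y, \<alpha>\<^sup>\<or>\<rangle>\<close>; it is relevant for nonzero \<open>\<alpha>\<close> in \<open>S\<close> only.\<close>

locale locally_finite_root_system = vector_space sY
  for sY :: "'k::field_char_0 \<Rightarrow> 'y::ab_group_add \<Rightarrow> 'y" +
  fixes S :: "'y set" and co :: "'y \<Rightarrow> 'y \<Rightarrow> 'k"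
  assumes zero_in: "0 \<in> S"
    and spanning: "module.span sY S = UNIV"
    and locally_finite: "\<And>B. finite B \<Longrightarrow> finite (S \<inter> module.span sY B)"
    and coroot_linear: "\<And>\<alpha>. \<alpha> \<in> S - {0} \<Longrightarrow> Vector_Spaces.linear sY (*) (co \<alpha>)"
    and coroot_two: "\<And>\<alpha>. \<alpha> \<in> S - {0} \<Longrightarrow> co \<alpha> \<alpha> = 2"
    and reflection: "\<And>\<alpha>. \<alpha> \<in> S - {0} \<Longrightarrow> (\<lambda>y. y - sY (co \<alpha> y) \<alpha>) ` S = S"
    and integral: "\<And>\<alpha> \<beta>. \<alpha> \<in> S - {0} \<Longrightarrow> \<beta> \<in> S \<Longrightarrow> co \<alpha> \<beta> \<in> \<int>"

text \<open>Nonzero indivisible roots, that is \<open>S\<^sub>i\<^sub>n\<^sub>d - {0}\<close>.\<close>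

definition indivisible :: "('k::field_char_0 \<Rightarrow> 'y::ab_group_add \<Rightarrow> 'y) \<Rightarrow> 'y set \<Rightarrow> 'y set"
  where "indivisible sY S = {\<alpha>\<in>S. sY (1/2) \<alpha> \<notin> S} - {0}"

section \<open>Graded Lie algebras\<close>

text \<open>\<open>Lg q \<nu>\<close> is the homogeneous space \<open>L\<^sub>q\<^sup>\<nu>\<close>. The lattice \<open>Q(S)\<close> is \<^term>\<open>group_closure S\<close>; the
  values of \<open>Lg\<close> outside it are irrelevant. The Lie algebra \<open>L\<close> is a whole type.
  In an invertible pair the element \<open>h = [f, e]\<close> satisfies \<open>[h, e] = 2e\<close>; note the order of \<open>f\<close> and \<open>e\<close>.\<close>

definition root_part ::
  "('k::field \<Rightarrow> 'l::ab_group_add \<Rightarrow> 'l) \<Rightarrow> ('y \<Rightarrow> 'g \<Rightarrow> 'l set) \<Rightarrow> 'y \<Rightarrow> 'l set"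
  where "root_part sL Lg q = module.span sL (\<Union>\<nu>. Lg q \<nu>)"

definition degree_part ::
  "'y::ab_group_add set \<Rightarrow> ('k::field \<Rightarrow> 'l::ab_group_add \<Rightarrow> 'l) \<Rightarrow> ('y \<Rightarrow> 'g \<Rightarrow> 'l set) \<Rightarrow> 'g \<Rightarrow> 'l set"
  where "degree_part S sL Lg \<nu> = module.span sL (\<Union>q\<in>group_closure S. Lg q \<nu>)"

definition invertible_with ::
  "'y::ab_group_add set \<Rightarrow> ('y \<Rightarrow> 'y \<Rightarrow> 'k::field) \<Rightarrow> ('k \<Rightarrow> 'l::ab_group_add \<Rightarrow> 'l) \<Rightarrow> ('l \<Rightarrow> 'l \<Rightarrow> 'l) \<Rightarrow>
   ('y \<Rightarrow> 'g::ab_group_add \<Rightarrow> 'l set) \<Rightarrow> 'y \<Rightarrow> 'g \<Rightarrow> 'l \<Rightarrow> 'l \<Rightarrow> bool"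
  where "invertible_with S co sL brL Lg \<alpha> \<nu> e f \<longleftrightarrow>
    e \<in> Lg \<alpha> \<nu> \<and> e \<noteq> 0 \<and> f \<in> Lg (- \<alpha>) (- \<nu>) \<and>
    (\<forall>q\<in>group_closure S. \<forall>x\<in>root_part sL Lg q. brL (brL f e) x = sL (co \<alpha> q) x)"

locale predivision_graded_lie_algebra =
  root_system: locally_finite_root_system sY S co + lie_algebra sL UNIV brL
  for sY :: "'k::field_char_0 \<Rightarrow> 'y::ab_group_add \<Rightarrow> 'y"
    and S :: "'y set" and co :: "'y \<Rightarrow> 'y \<Rightarrow> 'k"
    and sL :: "'k \<Rightarrow> 'l::ab_group_add \<Rightarrow> 'l" and brL :: "'l \<Rightarrow> 'l \<Rightarrow> 'l" +
  fixes Lg :: "'y \<Rightarrow> 'g::ab_group_add \<Rightarrow> 'l set"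
  assumes grading: "is_direct_sum sL UNIV (group_closure S \<times> UNIV) (\<lambda>(q, \<nu>). Lg q \<nu>)"
    and grading_bracket: "\<And>p q \<nu> \<mu> x y. p \<in> group_closure S \<Longrightarrow> q \<in> group_closure S \<Longrightarrow>
      x \<in> Lg p \<nu> \<Longrightarrow> y \<in> Lg q \<mu> \<Longrightarrow> brL x y \<in> Lg (p + q) (\<nu> + \<mu>)"
    and RG1: "\<And>q. q \<in> group_closure S - S \<Longrightarrow> root_part sL Lg q = {0}"
    and RG2: "\<And>\<alpha>. \<alpha> \<in> indivisible sY S \<Longrightarrow> \<exists>e f. invertible_with S co sL brL Lg \<alpha> 0 e f"
    and RG3: "root_part sL Lg 0 =
      module.span sL {brL x y | x y \<alpha>. \<alpha> \<in> S - {0} \<and> x \<in> root_part sL Lg \<alpha> \<and> y \<in> root_part sL Lg (- \<alpha>)}"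
    and predivision: "\<And>\<alpha> \<nu>. \<alpha> \<in> S - {0} \<Longrightarrow> Lg \<alpha> \<nu> \<noteq> {0} \<Longrightarrow>
      \<exists>e f. invertible_with S co sL brL Lg \<alpha> \<nu> e f"

text \<open>Dimension at most one is expressed by a spanning vector, because \<^const>\<open>vector_space.dim\<close>
  is \<open>0\<close> on infinite-dimensional spaces.\<close>

definition lie_torus ::
  "('k::field_char_0 \<Rightarrow> 'y::ab_group_add \<Rightarrow> 'y) \<Rightarrow> 'y set \<Rightarrow> ('y \<Rightarrow> 'y \<Rightarrow> 'k) \<Rightarrow>
   ('k \<Rightarrow> 'l::ab_group_add \<Rightarrow> 'l) \<Rightarrow> ('l \<Rightarrow> 'l \<Rightarrow> 'l) \<Rightarrow> ('y \<Rightarrow> 'g::ab_group_add \<Rightarrow> 'l set) \<Rightarrow> bool"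
  where "lie_torus sY S co sL brL Lg \<longleftrightarrow>
    predivision_graded_lie_algebra sY S co sL brL Lg \<and>
    (\<forall>\<alpha>\<in>S - {0}. \<forall>\<nu>. \<exists>v. Lg \<alpha> \<nu> \<subseteq> module.span sL {v})"

definition graded_invariant_form ::
  "('k::field_char_0 \<Rightarrow> 'y::ab_group_add \<Rightarrow> 'y) \<Rightarrow> 'y set \<Rightarrow> ('y \<Rightarrow> 'y \<Rightarrow> 'k) \<Rightarrow>
   ('k \<Rightarrow> 'l::ab_group_add \<Rightarrow> 'l) \<Rightarrow> ('l \<Rightarrow> 'l \<Rightarrow> 'l) \<Rightarrow> ('y \<Rightarrow> 'g::ab_group_add \<Rightarrow> 'l set) \<Rightarrow>
   ('l \<Rightarrow> 'l \<Rightarrow> 'k) \<Rightarrow> bool"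
  where "graded_invariant_form sY S co sL brL Lg BL \<longleftrightarrow>
    invariant_form sL UNIV brL BL \<and>
    (\<forall>\<nu> \<mu>. \<nu> + \<mu> \<noteq> 0 \<longrightarrow>
      (\<forall>x\<in>degree_part S sL Lg \<nu>. \<forall>y\<in>degree_part S sL Lg \<mu>. BL x y = 0)) \<and>
    (\<exists>e f. (\<forall>\<alpha>\<in>indivisible sY S. invertible_with S co sL brL Lg \<alpha> 0 (e \<alpha>) (f \<alpha>)) \<and>
      nondegenerate_on (module.span sL {brL (e \<alpha>) (f \<alpha>) | \<alpha>. \<alpha> \<in> indivisible sY S}) BL)"

definition invariant_lie_torus ::
  "('k::field_char_0 \<Rightarrow> 'y::ab_group_add \<Rightarrow> 'y) \<Rightarrow> 'y set \<Rightarrow> ('y \<Rightarrow> 'y \<Rightarrow> 'k) \<Rightarrow>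
   ('k \<Rightarrow> 'l::ab_group_add \<Rightarrow> 'l) \<Rightarrow> ('l \<Rightarrow> 'l \<Rightarrow> 'l) \<Rightarrow> ('y \<Rightarrow> 'g::ab_group_add \<Rightarrow> 'l set) \<Rightarrow> bool"
  where "invariant_lie_torus sY S co sL brL Lg \<longleftrightarrow>
    lie_torus sY S co sL brL Lg \<and> (\<exists>BL. graded_invariant_form sY S co sL brL Lg BL)"

section \<open>Skew centroidal derivations\<close>

definition centroid_part ::
  "'y::ab_group_add set \<Rightarrow> ('k::field \<Rightarrow> 'l::ab_group_add \<Rightarrow> 'l) \<Rightarrow> ('l \<Rightarrow> 'l \<Rightarrow> 'l) \<Rightarrow>
   ('y \<Rightarrow> 'g::ab_group_add \<Rightarrow> 'l set) \<Rightarrow> 'g \<Rightarrow> ('l \<Rightarrow> 'l) set"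
  where "centroid_part S sL brL Lg \<nu> = {\<chi>.
    Vector_Spaces.linear sL sL \<chi> \<and> (\<forall>x y. \<chi> (brL x y) = brL x (\<chi> y)) \<and>
    (\<forall>\<mu>. \<chi> ` degree_part S sL Lg \<mu> \<subseteq> degree_part S sL Lg (\<nu> + \<mu>))}"

text \<open>\<open>\<partial>\<^sub>\<theta>\<close>: the sum of \<open>\<theta> \<mu> x\<^sup>\<mu>\<close> over the nonzero homogeneous components \<open>x\<^sup>\<mu>\<close> of \<open>x\<close>.\<close>

definition centroidal_derivation ::
  "'y::ab_group_add set \<Rightarrow> ('k::field \<Rightarrow> 'l::ab_group_add \<Rightarrow> 'l) \<Rightarrow> ('y \<Rightarrow> 'g::ab_group_add \<Rightarrow> 'l set) \<Rightarrow>
   ('g \<Rightarrow> 'l \<Rightarrow> 'l) \<Rightarrow> 'l \<Rightarrow> 'l"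
  where "centroidal_derivation S sL Lg \<theta> x =
    (\<Sum>\<mu> | component UNIV (degree_part S sL Lg) \<mu> x \<noteq> 0.
      \<theta> \<mu> (component UNIV (degree_part S sL Lg) \<mu> x))"

definition SCDer ::
  "'y::ab_group_add set \<Rightarrow> ('k::field \<Rightarrow> 'l::ab_group_add \<Rightarrow> 'l) \<Rightarrow> ('l \<Rightarrow> 'l \<Rightarrow> 'l) \<Rightarrow>
   ('y \<Rightarrow> 'g::ab_group_add \<Rightarrow> 'l set) \<Rightarrow> 'g \<Rightarrow> ('l \<Rightarrow> 'l) set"
  where "SCDer S sL brL Lg \<nu> = {centroidal_derivation S sL Lg \<theta> | \<theta>.
    additive \<theta> \<and> range \<theta> \<subseteq> centroid_part S sL brL Lg \<nu> \<and> \<theta> \<nu> = 0}"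

definition degree_derivation ::
  "'y::ab_group_add set \<Rightarrow> ('k::field \<Rightarrow> 'l::ab_group_add \<Rightarrow> 'l) \<Rightarrow> ('y \<Rightarrow> 'g::ab_group_add \<Rightarrow> 'l set) \<Rightarrow>
   ('g \<Rightarrow> 'k) \<Rightarrow> 'l \<Rightarrow> 'l"
  where "degree_derivation S sL Lg \<theta> = centroidal_derivation S sL Lg (\<lambda>\<mu>. sL (\<theta> \<mu>))"

definition degree_derivations ::
  "'y::ab_group_add set \<Rightarrow> ('k::field \<Rightarrow> 'l::ab_group_add \<Rightarrow> 'l) \<Rightarrow> ('y \<Rightarrow> 'g::ab_group_add \<Rightarrow> 'l set) \<Rightarrow>
   ('l \<Rightarrow> 'l) set"
  where "degree_derivations S sL Lg = {degree_derivation S sL Lg \<theta> | \<theta>. additive \<theta>}"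

text \<open>\<open>\<theta>\<close> is determined by its degree derivation as soon as the degrees \<open>\<nu>\<close> with \<open>L\<^sup>\<nu> \<noteq> 0\<close> generate the
  grading group.\<close>

definition ev ::
  "'y::ab_group_add set \<Rightarrow> ('k::field \<Rightarrow> 'l::ab_group_add \<Rightarrow> 'l) \<Rightarrow> ('y \<Rightarrow> 'g::ab_group_add \<Rightarrow> 'l set) \<Rightarrow>
   'g \<Rightarrow> ('l \<Rightarrow> 'l) \<Rightarrow> 'k"
  where "ev S sL Lg \<nu> d = (THE \<theta>. additive \<theta> \<and> d = degree_derivation S sL Lg \<theta>) \<nu>"

definition commutator :: "('l \<Rightarrow> 'l::ab_group_add) \<Rightarrow> ('l \<Rightarrow> 'l) \<Rightarrow> 'l \<Rightarrow> 'l"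
  where "commutator d d' = (\<lambda>x. d (d' x) - d' (d x))"

section \<open>The graded dual\<close>

text \<open>\<open>Dg \<nu>\<close> is the homogeneous space \<open>D\<^sup>\<nu>\<close>. The summand \<open>(D\<^sup>-\<^sup>\<nu>)\<^sup>*\<close> of the graded dual consists of
  the functionals on \<open>D\<close> that vanish on the remaining homogeneous spaces, so the graded dual consists
  of the functionals that vanish on all but finitely many of them.\<close>

definition graded_dual ::
  "('k::field \<Rightarrow> 'l::ab_group_add \<Rightarrow> 'l) \<Rightarrow> ('l \<Rightarrow> 'l) set \<Rightarrow> ('g \<Rightarrow> ('l \<Rightarrow> 'l) set) \<Rightarrow> (('l \<Rightarrow> 'l) \<Rightarrow> 'k) set"
  where "graded_dual sL D Dg =
    {c\<in>dual_on (fun_scale sL) D. finite {\<nu>. \<exists>d\<in>Dg \<nu>. c d \<noteq> 0}}"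

definition graded_dual_part ::
  "('k::field \<Rightarrow> 'l::ab_group_add \<Rightarrow> 'l) \<Rightarrow> ('l \<Rightarrow> 'l) set \<Rightarrow> ('g::ab_group_add \<Rightarrow> ('l \<Rightarrow> 'l) set) \<Rightarrow> 'g \<Rightarrow>
   (('l \<Rightarrow> 'l) \<Rightarrow> 'k) set"
  where "graded_dual_part sL D Dg \<nu> =
    {c\<in>dual_on (fun_scale sL) D. \<forall>\<mu>. \<mu> \<noteq> - \<nu> \<longrightarrow> (\<forall>d\<in>Dg \<mu>. c d = 0)}"

definition contragredient ::
  "('l \<Rightarrow> 'l::ab_group_add) set \<Rightarrow> ('l \<Rightarrow> 'l) \<Rightarrow> (('l \<Rightarrow> 'l) \<Rightarrow> 'k::field) \<Rightarrow> ('l \<Rightarrow> 'l) \<Rightarrow> 'k"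
  where "contragredient D d c = (\<lambda>d'. if d' \<in> D then - c (commutator d d') else 0)"

definition sigma ::
  "('l \<Rightarrow> 'l) set \<Rightarrow> ('l \<Rightarrow> 'l \<Rightarrow> 'k::zero) \<Rightarrow> 'l \<Rightarrow> 'l \<Rightarrow> ('l \<Rightarrow> 'l) \<Rightarrow> 'k"
  where "sigma D BL l1 l2 = (\<lambda>d. if d \<in> D then BL (d l1) l2 else 0)"

definition C_min ::
  "('l \<Rightarrow> 'l) set \<Rightarrow> ('l \<Rightarrow> 'l \<Rightarrow> 'k::field) \<Rightarrow> (('l \<Rightarrow> 'l) \<Rightarrow> 'k) set"
  where "C_min D BL = module.span (fun_scale (*)) {sigma D BL l1 l2 | l1 l2. True}"

text \<open>A graded subspace is given by its underlying set; its homogeneous spaces are the intersections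
  with those of the ambient graded space.\<close>

definition D_part ::
  "'y::ab_group_add set \<Rightarrow> ('k::field \<Rightarrow> 'l::ab_group_add \<Rightarrow> 'l) \<Rightarrow> ('l \<Rightarrow> 'l \<Rightarrow> 'l) \<Rightarrow>
   ('y \<Rightarrow> 'g::ab_group_add \<Rightarrow> 'l set) \<Rightarrow> ('l \<Rightarrow> 'l) set \<Rightarrow> 'g \<Rightarrow> ('l \<Rightarrow> 'l) set"
  where "D_part S sL brL Lg D \<nu> = D \<inter> SCDer S sL brL Lg \<nu>"

definition C_part ::
  "'y::ab_group_add set \<Rightarrow> ('k::field \<Rightarrow> 'l::ab_group_add \<Rightarrow> 'l) \<Rightarrow> ('l \<Rightarrow> 'l \<Rightarrow> 'l) \<Rightarrow>
   ('y \<Rightarrow> 'g::ab_group_add \<Rightarrow> 'l set) \<Rightarrow> ('l \<Rightarrow> 'l) set \<Rightarrow> (('l \<Rightarrow> 'l) \<Rightarrow> 'k) set \<Rightarrow> 'g \<Rightarrow> (('l \<Rightarrow> 'l) \<Rightarrow> 'k) set"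
  where "C_part S sL brL Lg D C \<nu> = C \<inter> graded_dual_part sL D (D_part S sL brL Lg D) \<nu>"

section \<open>The data\<close>

definition cartan ::
  "('k::field_char_0 \<Rightarrow> 'y::ab_group_add \<Rightarrow> 'y) \<Rightarrow> 'y set \<Rightarrow> ('k \<Rightarrow> 'l::ab_group_add \<Rightarrow> 'l) \<Rightarrow>
   ('y \<Rightarrow> 'g::zero \<Rightarrow> 'l) \<Rightarrow> 'l set"
  where "cartan sY S sL h = module.span sL {h \<xi> 0 | \<xi>. \<xi> \<in> indivisible sY S}"

locale affine_extension_data = predivision_graded_lie_algebra sY S co sL brL Lg
  for sY :: "'k::field_char_0 \<Rightarrow> 'y::ab_group_add \<Rightarrow> 'y"
    and S :: "'y set" and co :: "'y \<Rightarrow> 'y \<Rightarrow> 'k"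
    and sL :: "'k \<Rightarrow> 'l::ab_group_add \<Rightarrow> 'l" and brL :: "'l \<Rightarrow> 'l \<Rightarrow> 'l"
    and Lg :: "'y \<Rightarrow> 'g::ab_group_add \<Rightarrow> 'l set" +
  fixes BL :: "'l \<Rightarrow> 'l \<Rightarrow> 'k"
    and e h f :: "'y \<Rightarrow> 'g \<Rightarrow> 'l"
    and D TD :: "('l \<Rightarrow> 'l) set"
    and C TC :: "(('l \<Rightarrow> 'l) \<Rightarrow> 'k) set"
    and \<tau> :: "('l \<Rightarrow> 'l) \<Rightarrow> ('l \<Rightarrow> 'l) \<Rightarrow> (('l \<Rightarrow> 'l) \<Rightarrow> 'k)"
  assumes torsion_free: "\<And>n (\<nu>::'g). 0 < n \<Longrightarrow> (\<Sum>i<n::nat. \<nu>) = 0 \<Longrightarrow> \<nu> = 0"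
    and L_invariant: "graded_invariant_form sY S co sL brL Lg BL"
    and full_support: "\<And>\<xi>. \<xi> \<in> S \<Longrightarrow> root_part sL Lg \<xi> \<noteq> {0}"
    and degrees_generate: "group_closure {\<nu>. degree_part S sL Lg \<nu> \<noteq> {0}} = UNIV"
    and choice_nonzero: "\<And>\<xi> \<nu>. \<xi> \<in> S - {0} \<Longrightarrow> Lg \<xi> \<nu> \<noteq> {0} \<Longrightarrow>
      invertible_with S co sL brL Lg \<xi> \<nu> (e \<xi> \<nu>) (f \<xi> \<nu>) \<and> h \<xi> \<nu> = brL (f \<xi> \<nu>) (e \<xi> \<nu>)"
    and choice_zero: "\<And>\<nu>. Lg 0 \<nu> \<noteq> {0} \<Longrightarrow>
      e 0 \<nu> \<in> Lg 0 \<nu> \<and> f 0 \<nu> \<in> Lg 0 (- \<nu>) \<and> BL (e 0 \<nu>) (f 0 \<nu>) \<noteq> 0 \<and>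
      brL (f 0 \<nu>) (e 0 \<nu>) = 0 \<and> h 0 \<nu> = 0"
    and D_subspace: "module.subspace (fun_scale sL) D"
    and D_graded: "is_direct_sum (fun_scale sL) D UNIV (D_part S sL brL Lg D)"
    and D_closed: "\<And>d d'. d \<in> D \<Longrightarrow> d' \<in> D \<Longrightarrow> commutator d d' \<in> D"
    and TD_subspace: "module.subspace (fun_scale sL) TD"
    and TD_degree: "TD \<subseteq> D_part S sL brL Lg D 0 \<inter> degree_derivations S sL Lg"
    and TD_injective: "inj (\<lambda>\<nu>. restrict (ev S sL Lg \<nu>) TD)"
    and C_subspace: "module.subspace (fun_scale (*)) C"
    and C_graded_dual: "C \<subseteq> graded_dual sL D (D_part S sL brL Lg D)"
    and C_graded: "is_direct_sum (fun_scale (*)) C UNIV (C_part S sL brL Lg D C)"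
    and C_invariant: "\<And>d c. d \<in> D \<Longrightarrow> c \<in> C \<Longrightarrow> contragredient D d c \<in> C"
    and C_sigma: "\<And>l1 l2. sigma D BL l1 l2 \<in> C"
    and TC_subspace: "module.subspace (fun_scale (*)) TC"
    and TC_degree: "TC \<subseteq> C_part S sL brL Lg D C 0"
    and TC_injective: "inj_on (\<lambda>t. restrict t TD) TC"
    and TC_sigma: "\<And>\<xi> \<nu>. \<xi> \<in> S \<Longrightarrow> Lg \<xi> \<nu> \<noteq> {0} \<Longrightarrow> sigma D BL (e \<xi> \<nu>) (f \<xi> \<nu>) \<in> TC"
    and tau_range: "\<And>d d'. d \<in> D \<Longrightarrow> d' \<in> D \<Longrightarrow> \<tau> d d' \<in> C"
    and tau_bilinear: "bilinear_on (fun_scale sL) (fun_scale (*)) D \<tau>"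
    and tau_alternating: "\<And>d. d \<in> D \<Longrightarrow> \<tau> d d = 0"
    and tau_cocycle: "\<And>d1 d2 d3. d1 \<in> D \<Longrightarrow> d2 \<in> D \<Longrightarrow> d3 \<in> D \<Longrightarrow>
      \<tau> (commutator d1 d2) d3 + \<tau> (commutator d2 d3) d1 + \<tau> (commutator d3 d1) d2 =
      contragredient D d1 (\<tau> d2 d3) + contragredient D d2 (\<tau> d3 d1) + contragredient D d3 (\<tau> d1 d2)"
    and tau_cyclic: "\<And>d1 d2 d3. d1 \<in> D \<Longrightarrow> d2 \<in> D \<Longrightarrow> d3 \<in> D \<Longrightarrow> \<tau> d1 d2 d3 = \<tau> d2 d3 d1"
    and tau_toral: "\<And>t d. t \<in> TD \<Longrightarrow> d \<in> D \<Longrightarrow> \<tau> t d = 0"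

section \<open>The construction\<close>

text \<open>\<open>C \<oplus> L \<oplus> D\<close> is the subspace \<open>C \<times> UNIV \<times> D\<close> of a product type.\<close>

definition E_scale ::
  "('k::field \<Rightarrow> 'l \<Rightarrow> 'l) \<Rightarrow> 'k \<Rightarrow>
   (('l \<Rightarrow> 'l) \<Rightarrow> 'k) \<times> 'l \<times> ('l \<Rightarrow> 'l) \<Rightarrow> (('l \<Rightarrow> 'l) \<Rightarrow> 'k) \<times> 'l \<times> ('l \<Rightarrow> 'l)"
  where "E_scale sL k = (\<lambda>(c, l, d). (fun_scale (*) k c, sL k l, fun_scale sL k d))"

definition E_bracket ::
  "('l \<Rightarrow> 'l \<Rightarrow> 'l) \<Rightarrow> ('l \<Rightarrow> 'l \<Rightarrow> 'k::field) \<Rightarrow> ('l \<Rightarrow> 'l::ab_group_add) set \<Rightarrow>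
   (('l \<Rightarrow> 'l) \<Rightarrow> ('l \<Rightarrow> 'l) \<Rightarrow> (('l \<Rightarrow> 'l) \<Rightarrow> 'k)) \<Rightarrow>
   (('l \<Rightarrow> 'l) \<Rightarrow> 'k) \<times> 'l \<times> ('l \<Rightarrow> 'l) \<Rightarrow> (('l \<Rightarrow> 'l) \<Rightarrow> 'k) \<times> 'l \<times> ('l \<Rightarrow> 'l) \<Rightarrow>
   (('l \<Rightarrow> 'l) \<Rightarrow> 'k) \<times> 'l \<times> ('l \<Rightarrow> 'l)"
  where "E_bracket brL BL D \<tau> = (\<lambda>(c1, l1, d1) (c2, l2, d2).
    (sigma D BL l1 l2 + contragredient D d1 c2 - contragredient D d2 c1 + \<tau> d1 d2,
     brL l1 l2 + d1 l2 - d2 l1,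
     commutator d1 d2))"

definition E_form ::
  "('l \<Rightarrow> 'l \<Rightarrow> 'k::field) \<Rightarrow>
   (('l \<Rightarrow> 'l) \<Rightarrow> 'k) \<times> 'l \<times> ('l \<Rightarrow> 'l) \<Rightarrow> (('l \<Rightarrow> 'l) \<Rightarrow> 'k) \<times> 'l \<times> ('l \<Rightarrow> 'l) \<Rightarrow> 'k"
  where "E_form BL = (\<lambda>(c1, l1, d1) (c2, l2, d2). c1 d2 + c2 d1 + BL l1 l2)"

end

theory Submission
  imports Defs
begin

text \<open>The extension \<open>E = C \<oplus> L \<oplus> D\<close> is graded by the root lattice \<open>\<Q>(S)\<close> and by \<open>\<Lambda>\<close>, where \<open>C\<close> and
  \<open>D\<close> sit at the root \<open>0\<close>. Everything follows once this grading is recognised as the weight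
  decomposition for \<open>T\<close>.

  \<^item> \<open>T\<close> acts diagonally. An element of the Cartan subspace \<open>\<hh>\<close> acts on \<open>L\<^sub>q\<close> by a scalar linear in \<open>q\<close>,
    and \<open>t \<in> T\<^sub>D\<close> acts on everything of degree \<open>\<nu>\<close> by \<open>ev\<^sub>\<nu>(t)\<close>. The rest of \<open>T\<close> acts by \<open>0\<close>: centroidal
    derivations kill \<open>L\<^sup>0\<close>, and \<open>[D\<^sup>\<nu>, D\<^sup>-\<^sup>\<nu>] = 0\<close> because the centroid of the perfect algebra \<open>L\<close> is
    commutative, so that \<open>D\<close> annihilates \<open>T\<^sub>C\<close>
    (\<open>SCDer_opposite_commute\<close>, \<open>C_degree_0_kills_commutators\<close>, \<open>T_acts\<close>).
  \<^item> Different parts have different weights. Degrees are separated by \<open>T\<^sub>D\<close> by hypothesis. Points of the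
    root lattice are separated by the coroots: a rational combination \<open>v\<close> of roots is \<open>\<Sum> \<phi>(\<alpha>) \<alpha>\<close> for
    a rational combination \<open>\<phi>\<close> of coroots, so that \<open>\<phi>(v)\<close> is a sum of squares
    (\<open>coroots_separate\<close>). Hence the root spaces are the homogeneous parts (\<open>toral_grading\<close>).
  \<^item> A nonzero centroid element of degree \<open>\<nu>\<close> moves a coroot element to a nonzero element of \<open>L\<^sub>0\<^sup>\<nu>\<close>.
    So \<open>C\<close> and \<open>D\<close> live only in degrees where \<open>L\<^sub>0\<close> does, and every root of \<open>E\<close> is supported by an element
    \<open>e\<close> of \<open>L\<close> with a partner \<open>f\<close> such that \<open>(e | f) \<noteq> 0\<close> and \<open>[e, f] \<in> T\<close>. By invariance
    \<open>[e, f] / (e | f)\<close> represents the root. Its square length is \<open>-2 / (e | f)\<close> for a nonzero root of \<open>S\<close> and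
    \<open>0\<close> otherwise, which identifies the anisotropic roots (\<open>anisotropic_eq\<close>).

  The core is therefore generated by the spaces \<open>L\<^sub>\<xi>\<close> with \<open>\<xi> \<noteq> 0\<close>. It is perfect and maps onto \<open>L\<close>, which has
  trivial centre. By invariance of the form the centralizer of a perfect subalgebra is its orthogonal
  space, and the orthogonal space of \<open>C \<oplus> L\<close> is \<open>C\<close>; this gives the criteria for tameness
  (\<open>tame_iff\<close>, \<open>core_eq_iff_perfect\<close>). If \<open>D\<close> consists of degree derivations, then \<open>C\<^sub>m\<^sub>i\<^sub>n\<close> is spanned by
  evaluations at degrees, and these are obtained from the brackets \<open>[e, f]\<close> by removing coroot elements, which
  lie in the core by themselves (\<open>tame_if_degree_derivations\<close>). Isotropic roots come from \<open>L\<^sub>0\<close>, which is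
  spanned by brackets of opposite root spaces (\<open>roots_tame\<close>). Finally \<open>E\<^sub>0 = C\<^sup>0 \<oplus> L\<^sub>0\<^sup>0 \<oplus> D\<^sup>0\<close>, and \<open>L\<^sub>0\<^sup>0 = \<hh>\<close> characterises Lie tori by an
  \<open>sl\<^sub>2\<close>-argument: for \<open>x\<close> of the same degree as \<open>e\<close>, the element \<open>[f, x]\<close> of \<open>\<hh>\<close> is a multiple of \<open>[f, e]\<close>, and no
  nonzero vector of weight \<open>2\<close> is killed by \<open>f\<close> (\<open>lie_torus_iff\<close>).\<close>

section \<open>Direct sum decompositions\<close>

lemma decomposes_sum:
  assumes "decomposes I W x u" "finite F" "{i. u i \<noteq> 0} \<subseteq> F"
  shows "x = sum u F"
proof -
  have "x = sum u {i. u i \<noteq> 0}" using assms(1) by (simp add: decomposes_def)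
  also have "\<dots> = sum u F" by (rule sum.mono_neutral_left) (use assms in auto)
  finally show ?thesis .
qed

lemma decomposes_add:
  fixes u v :: "'i \<Rightarrow> 'a::ab_group_add"
  assumes "decomposes I W x u" "decomposes I W y v"
    and add: "\<And>i a b. i \<in> I \<Longrightarrow> a \<in> W i \<Longrightarrow> b \<in> W i \<Longrightarrow> a + b \<in> W i"
  shows "decomposes I W (x + y) (\<lambda>i. u i + v i)"
proof -
  let ?F = "{i. u i \<noteq> 0} \<union> {i. v i \<noteq> 0}"
  have F: "finite ?F" using assms by (auto simp: decomposes_def)
  have sub: "{i. u i + v i \<noteq> 0} \<subseteq> ?F" by auto
  have "x + y = sum u ?F + sum v ?F"
    using decomposes_sum[OF assms(1) F] decomposes_sum[OF assms(2) F] by auto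
  also have "\<dots> = (\<Sum>i\<in>?F. u i + v i)" by (simp add: sum.distrib)
  also have "\<dots> = (\<Sum>i | u i + v i \<noteq> 0. u i + v i)"
    by (rule sum.mono_neutral_right) (use F sub in auto)
  finally show ?thesis
    using assms finite_subset[OF sub F] by (auto simp: decomposes_def)
qed

context vector_space begin

lemma decomposes_scale:
  assumes "decomposes I W x u" "\<And>i. i \<in> I \<Longrightarrow> subspace (W i)"
  shows "decomposes I W (scale k x) (\<lambda>i. scale k (u i))"
proof -
  let ?F = "{i. u i \<noteq> 0}"
  have F: "finite ?F" using assms by (auto simp: decomposes_def)
  have "scale k x = (\<Sum>i\<in>?F. scale k (u i))"
    using decomposes_sum[OF assms(1) F] by (simp add: scale_sum_right)
  also have "\<dots> = (\<Sum>i | scale k (u i) \<noteq> 0. scale k (u i))"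
    by (rule sum.mono_neutral_right) (use F in auto)
  finally show ?thesis
    using assms finite_subset[OF _ F, of "{i. scale k (u i) \<noteq> 0}"]
    by (auto simp: decomposes_def subspace_scale)
qed

lemma decomposes_single:
  assumes "i \<in> I" "x \<in> W i" "\<And>i. i \<in> I \<Longrightarrow> subspace (W i)"
  shows "decomposes I W x (\<lambda>j. if j = i then x else 0)"
proof -
  have "{j. (if j = i then x else 0) \<noteq> 0} = (if x = 0 then {} else {i})" by auto
  then show ?thesis using assms by (auto simp: decomposes_def subspace_0)
qed

lemma is_direct_sumI:
  assumes sub: "\<And>i. i \<in> I \<Longrightarrow> subspace (W i)"
    and carrier: "\<And>i. i \<in> I \<Longrightarrow> W i \<subseteq> V"
    and spanning: "V \<subseteq> span (\<Union>i\<in>I. W i)"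
    and indep: "\<And>F u i. finite F \<Longrightarrow> F \<subseteq> I \<Longrightarrow> (\<And>i. i \<in> F \<Longrightarrow> u i \<in> W i) \<Longrightarrow> sum u F = 0 \<Longrightarrow>
      i \<in> F \<Longrightarrow> u i = 0"
  shows "is_direct_sum scale V I W"
  unfolding is_direct_sum_def
proof (intro conjI ballI)
  fix x assume "x \<in> V"
  then have x: "x \<in> span (\<Union>i\<in>I. W i)" using spanning by auto
  have ex: "\<exists>u. decomposes I W x u" using x
  proof (induction rule: span_induct_alt)
    case base
    show ?case by (intro exI[of _ "\<lambda>_. 0"]) (use sub in \<open>auto simp: decomposes_def subspace_0\<close>)
  next
    case (step c x y)
    then obtain i v where i: "i \<in> I" "x \<in> W i" and v: "decomposes I W y v" by auto
    have "decomposes I W (scale c x) (\<lambda>j. if j = i then scale c x else 0)"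
      by (rule decomposes_single) (use i sub subspace_scale in auto)
    from decomposes_add[OF this v] show ?case using sub subspace_add by blast
  qed
  show "\<exists>!u. decomposes I W x u"
  proof (rule ex_ex1I[OF ex])
    fix u v assume u: "decomposes I W x u" and v: "decomposes I W x v"
    let ?F = "{i. u i \<noteq> 0} \<union> {i. v i \<noteq> 0}"
    have F: "finite ?F" "?F \<subseteq> I" using u v by (auto simp: decomposes_def)
    have s: "(\<Sum>i\<in>?F. u i - v i) = 0"
      using decomposes_sum[OF u F(1)] decomposes_sum[OF v F(1)] by (auto simp: sum_subtractf)
    have in_W: "u i - v i \<in> W i" if "i \<in> ?F" for i
      using u v that F(2) sub subspace_diff unfolding decomposes_def by blast
    have "u i - v i = 0" if "i \<in> ?F" for i
      using indep[of ?F "\<lambda>i. u i - v i", OF F in_W s that] by simp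
    then have "u i = v i" for i by (cases "i \<in> ?F") auto
    then show "u = v" by auto
  qed
qed (use sub carrier in auto)

text \<open>Applying the projections to a vanishing sum of homogeneous elements gives independence.\<close>

lemma is_direct_sumI_projections:
  assumes sub: "\<And>i. i \<in> I \<Longrightarrow> subspace (W i)"
    and carrier: "\<And>i. i \<in> I \<Longrightarrow> W i \<subseteq> V"
    and V: "subspace V" and spanning: "V \<subseteq> span (\<Union>i\<in>I. W i)"
    and add: "\<And>i x y. x \<in> V \<Longrightarrow> y \<in> V \<Longrightarrow> p i (x + y) = p i x + p i y"
    and proj: "\<And>i j x. i \<in> I \<Longrightarrow> j \<in> I \<Longrightarrow> x \<in> W j \<Longrightarrow> p i x = (if j = i then x else 0)"
  shows "is_direct_sum scale V I W"
proof (rule is_direct_sumI[OF sub carrier spanning])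
  fix F u i
  assume F: "finite F" "F \<subseteq> I" and u: "\<And>i. i \<in> F \<Longrightarrow> u i \<in> W i"
    and s: "sum u F = 0" and i: "i \<in> F"
  have p0: "p i 0 = 0" using add[of 0 0 i] subspace_0[OF V] by simp
  have uV: "u j \<in> V" if "j \<in> F" for j using u[OF that] carrier F that by blast
  have sum: "p i (sum u G) = (\<Sum>j\<in>G. p i (u j))" if "finite G" "G \<subseteq> F" for G
    using that by (induction G rule: finite_induct) (auto simp: p0 add uV subspace_sum[OF V] subset_iff)
  have "0 = (\<Sum>j\<in>F. p i (u j))" using sum[OF F(1) subset_refl] s p0 by simp
  also have "\<dots> = (\<Sum>j\<in>F. if j = i then u j else 0)"
  proof (rule sum.cong)
    fix j assume "j \<in> F"
    then have "u j \<in> W j" "j \<in> I" "i \<in> I" using u F(2) i by blast+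
    then show "p i (u j) = (if j = i then u j else 0)" using proj[of i j "u j"] by auto
  qed simp
  also have "\<dots> = u i" using F i by simp
  finally show "u i = 0" by simp
qed

end

locale direct_sum_decomposition = vector_space s
  for s :: "'k::field \<Rightarrow> 'a::ab_group_add \<Rightarrow> 'a" +
  fixes V :: "'a set" and I :: "'i set" and W :: "'i \<Rightarrow> 'a set"
  assumes carrier: "module.subspace s V" and direct: "is_direct_sum s V I W"
begin

abbreviation pr where "pr \<equiv> component I W"

lemma part_subspace: "i \<in> I \<Longrightarrow> subspace (W i)"
  and part_subset: "i \<in> I \<Longrightarrow> W i \<subseteq> V"
  using direct by (auto simp: is_direct_sum_def)

lemma part_in: "i \<in> I \<Longrightarrow> x \<in> W i \<Longrightarrow> x \<in> V"
  using part_subset by blast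

lemma pr_unique:
  assumes "x \<in> V" "decomposes I W x u" shows "pr i x = u i"
proof -
  have "(THE u. decomposes I W x u) = u"
    by (rule the1_equality) (use direct assms in \<open>auto simp: is_direct_sum_def\<close>)
  then show ?thesis by (simp add: component_def)
qed

lemma pr_decomposes: assumes "x \<in> V" shows "decomposes I W x (\<lambda>i. pr i x)"
proof -
  obtain u where u: "decomposes I W x u" using direct assms by (auto simp: is_direct_sum_def)
  moreover have "(\<lambda>i. pr i x) = u" using pr_unique[OF assms u] by auto
  ultimately show ?thesis by simp
qed

lemma pr_in: "x \<in> V \<Longrightarrow> i \<in> I \<Longrightarrow> pr i x \<in> W i"
  and pr_outside: "x \<in> V \<Longrightarrow> i \<notin> I \<Longrightarrow> pr i x = 0"
  and pr_finite: "x \<in> V \<Longrightarrow> finite {i. pr i x \<noteq> 0}"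
  and sum_pr: "x \<in> V \<Longrightarrow> x = (\<Sum>i | pr i x \<noteq> 0. pr i x)"
  using pr_decomposes[of x] by (auto simp: decomposes_def)

lemma pr_support: "x \<in> V \<Longrightarrow> {i. pr i x \<noteq> 0} \<subseteq> I"
  using pr_outside by auto

lemma pr_add: "x \<in> V \<Longrightarrow> y \<in> V \<Longrightarrow> pr i (x + y) = pr i x + pr i y"
  by (rule pr_unique[OF _ decomposes_add[OF pr_decomposes pr_decomposes]])
    (use carrier part_subspace subspace_add in auto)

lemma pr_scale: "x \<in> V \<Longrightarrow> pr i (s k x) = s k (pr i x)"
  by (rule pr_unique[OF _ decomposes_scale[OF pr_decomposes]])
    (use carrier part_subspace subspace_scale in auto)

lemma pr_homogeneous: "j \<in> I \<Longrightarrow> x \<in> W j \<Longrightarrow> pr i x = (if i = j then x else 0)"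
  by (rule pr_unique[OF _ decomposes_single]) (use part_in part_subspace in auto)

lemma pr_zero: "pr i 0 = 0"
  using pr_scale[of 0 i 0] subspace_0[OF carrier] by simp

lemma pr_sum: "finite F \<Longrightarrow> (\<And>j. j \<in> F \<Longrightarrow> u j \<in> V) \<Longrightarrow> pr i (sum u F) = (\<Sum>j\<in>F. pr i (u j))"
  by (induction F rule: finite_induct) (auto simp: pr_zero pr_add subspace_sum[OF carrier])

lemma zero_if_pr_zero: "x \<in> V \<Longrightarrow> (\<And>i. i \<in> I \<Longrightarrow> pr i x = 0) \<Longrightarrow> x = 0"
  using sum_pr[of x] pr_outside[of x] by (metis (mono_tags, lifting) mem_Collect_eq sum.neutral)

lemma graded_induct [consumes 1, case_names zero homogeneous add]:
  assumes "x \<in> V" and "P 0" and hom: "\<And>i x. i \<in> I \<Longrightarrow> x \<in> W i \<Longrightarrow> P x"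
    and add: "\<And>x y. x \<in> V \<Longrightarrow> y \<in> V \<Longrightarrow> P x \<Longrightarrow> P y \<Longrightarrow> P (x + y)"
  shows "P x"
proof -
  have "P (sum (\<lambda>i. pr i x) F) \<and> sum (\<lambda>i. pr i x) F \<in> V" if "finite F" "F \<subseteq> I" for F
    using that
  proof (induction F rule: finite_induct)
    case empty
    then show ?case using \<open>P 0\<close> subspace_0[OF carrier] by simp
  next
    case (insert i F)
    then have "pr i x \<in> W i" "P (pr i x)" using pr_in \<open>x \<in> V\<close> hom by auto
    then show ?case using insert add part_in[of i] subspace_add[OF carrier] by auto
  qed
  from this[OF pr_finite pr_support] show ?thesis using sum_pr assms(1) by metis
qed

lemma pr_span:
  assumes "K \<subseteq> I" "x \<in> span (\<Union>i\<in>K. W i)"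
  shows "x \<in> V" and "i \<notin> K \<Longrightarrow> pr i x = 0"
proof -
  have "x \<in> V \<and> (i \<notin> K \<longrightarrow> pr i x = 0)" using assms(2)
  proof (induction rule: span_induct_alt)
    case base
    then show ?case using pr_zero subspace_0[OF carrier] by simp
  next
    case (step c x y)
    then obtain j where j: "j \<in> K" "x \<in> W j" by auto
    then have "x \<in> V" "pr i x = (if i = j then x else 0)"
      using assms(1) pr_homogeneous[of j x i] part_in[of j x] by auto
    then show ?case using step j pr_add pr_scale subspace_add[OF carrier] subspace_scale[OF carrier]
      by auto
  qed
  then show "x \<in> V" "i \<notin> K \<Longrightarrow> pr i x = 0" by auto
qed

lemma in_span_if_pr:
  assumes "x \<in> V" "\<And>i. i \<in> I \<Longrightarrow> i \<notin> K \<Longrightarrow> pr i x = 0"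
  shows "x \<in> span (\<Union>i\<in>K. W i)"
proof -
  have "(\<Sum>i | pr i x \<noteq> 0. pr i x) \<in> span (\<Union>i\<in>K. W i)"
    using assms pr_outside[of x] pr_in[of x] by (intro span_sum span_base) fastforce
  then show ?thesis using sum_pr[OF assms(1)] by metis
qed

text \<open>Elements of merged spaces with different labels have their components at disjoint sets of indices,
  so a vanishing sum of such elements vanishes term by term. The grading of \<open>L\<close> by degrees and the
  root space decomposition of the extension are obtained in this way from finer gradings.\<close>

lemma coarsening:
  assumes "p ` I \<subseteq> J"
  shows "is_direct_sum s V J (\<lambda>j. span (\<Union>i\<in>{i\<in>I. p i = j}. W i))"
proof (rule is_direct_sumI)
  fix j
  show "span (\<Union>i\<in>{i\<in>I. p i = j}. W i) \<subseteq> V"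
  proof
    fix x assume "x \<in> span (\<Union>i\<in>{i\<in>I. p i = j}. W i)"
    then show "x \<in> V" by (rule pr_span(1)[rotated]) simp
  qed
next
  show "V \<subseteq> span (\<Union>j\<in>J. span (\<Union>i\<in>{i\<in>I. p i = j}. W i))" (is "_ \<subseteq> span ?U")
  proof
    fix x assume "x \<in> V"
    then have "x \<in> span (\<Union>i\<in>I. W i)" by (rule in_span_if_pr) auto
    moreover have "W i \<subseteq> ?U" if "i \<in> I" for i
    proof -
      have "W i \<subseteq> span (\<Union>k\<in>{k\<in>I. p k = p i}. W k)" using that
        by (auto intro: span_base)
      then show ?thesis using assms that by auto
    qed
    ultimately show "x \<in> span ?U" using span_mono[of "\<Union>i\<in>I. W i" ?U] by auto
  qed
next
  fix F and u :: "'b \<Rightarrow> 'a" and j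
  assume F: "finite F" "F \<subseteq> J" and u: "\<And>j. j \<in> F \<Longrightarrow> u j \<in> span (\<Union>i\<in>{i\<in>I. p i = j}. W i)"
    and s: "sum u F = 0" and j: "j \<in> F"
  have V: "u k \<in> V" if "k \<in> F" for k
    by (rule pr_span(1)[OF _ u[OF that]]) auto
  show "u j = 0"
  proof (rule zero_if_pr_zero[OF V[OF j]])
    fix i assume i: "i \<in> I"
    have z: "pr i (u k) = 0" if "k \<in> F" "p i \<noteq> k" for k
      by (rule pr_span(2)[OF _ u[OF that(1)]]) (use that in auto)
    show "pr i (u j) = 0"
    proof (cases "p i = j")
      case True
      have "0 = pr i (sum u F)" using s pr_zero by simp
      also have "\<dots> = (\<Sum>k\<in>F. pr i (u k))" using F V by (intro pr_sum) auto
      also have "\<dots> = (\<Sum>k\<in>F. if k = j then pr i (u j) else 0)"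
        by (intro sum.cong) (use z True in auto)
      also have "\<dots> = pr i (u j)" using F j by simp
      finally show ?thesis by simp
    qed (use z j in auto)
  qed
qed auto

text \<open>Comparing components in an eigenvalue equation then shows that an eigenvector has components
  only in parts with the same eigenvalue. This is how homogeneous elements are recognised later.\<close>

lemma pr_eigenoperator:
  assumes add: "\<And>x y. x \<in> V \<Longrightarrow> y \<in> V \<Longrightarrow> A (x + y) = A x + A y"
    and zero: "A 0 = 0"
    and eigen: "\<And>i x. i \<in> I \<Longrightarrow> x \<in> W i \<Longrightarrow> A x = s (w i) x"
    and "x \<in> V" "i \<in> I"
  shows "A x \<in> V \<and> pr i (A x) = s (w i) (pr i x)"
  using \<open>x \<in> V\<close>
proof (induction rule: graded_induct)
  case zero
  then show ?case using assms subspace_0[OF carrier] pr_zero by simp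
next
  case (homogeneous j x)
  then show ?case using eigen pr_homogeneous[of j x i] pr_scale[of x i] part_in[of j x]
    subspace_scale[OF carrier] by auto
next
  case (add x y)
  then show ?case using assms(1) subspace_add[OF carrier] pr_add by (auto simp: scale_right_distrib)
qed

end

section \<open>Locally finite root systems\<close>

text \<open>The field carries no order, but its rational elements form a copy of the ordered field of
  rational numbers.\<close>

lemma rational_sum_squares_eq_0:
  fixes f :: "'i \<Rightarrow> 'k::field_char_0"
  assumes "finite A" "\<And>a. a \<in> A \<Longrightarrow> f a \<in> \<rat>" "(\<Sum>a\<in>A. f a * f a) = 0" "a \<in> A"
  shows "f a = 0"
proof -
  have "\<forall>a\<in>A. \<exists>r::rat. f a = of_rat r" using assms(2) by (auto simp: Rats_def)
  then obtain r :: "'i \<Rightarrow> rat" where r: "\<And>a. a \<in> A \<Longrightarrow> f a = of_rat (r a)"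
    by metis
  have "of_rat (\<Sum>a\<in>A. r a * r a) = (\<Sum>a\<in>A. f a * f a)"
    by (simp add: of_rat_sum of_rat_mult r)
  then have "(\<Sum>a\<in>A. r a * r a) = 0" using assms(3) by simp
  then have "r a * r a = 0" using assms by (subst (asm) sum_nonneg_eq_0_iff) auto
  then show ?thesis using r assms by simp
qed

context locally_finite_root_system begin

lemma coroot_add: "\<alpha> \<in> S - {0} \<Longrightarrow> co \<alpha> (x + y) = co \<alpha> x + co \<alpha> y"
  and coroot_scale: "\<alpha> \<in> S - {0} \<Longrightarrow> co \<alpha> (sY k x) = k * co \<alpha> x"
  using coroot_linear[of \<alpha>] by (auto simp: Vector_Spaces.linear_iff)

lemma coroot_minus: "\<alpha> \<in> S - {0} \<Longrightarrow> co \<alpha> (- x) = - co \<alpha> x"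
  using coroot_scale[of \<alpha> "-1" x] by (simp)

lemma coroot_diff: "\<alpha> \<in> S - {0} \<Longrightarrow> co \<alpha> (x - y) = co \<alpha> x - co \<alpha> y"
  using coroot_add[of \<alpha> x "-y"] coroot_minus[of \<alpha> y] by simp

lemma coroot_sum: "\<alpha> \<in> S - {0} \<Longrightarrow> co \<alpha> (sum g A) = (\<Sum>a\<in>A. co \<alpha> (g a))"
  using coroot_scale[of \<alpha> 0 0] by (induction A rule: infinite_finite_induct) (auto simp: coroot_add)

lemma reflection_in: "\<alpha> \<in> S - {0} \<Longrightarrow> \<beta> \<in> S \<Longrightarrow> \<beta> - sY (co \<alpha> \<beta>) \<alpha> \<in> S"
  using reflection[of \<alpha>] by blast

lemma uminus_in: assumes "\<alpha> \<in> S" shows "- \<alpha> \<in> S"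
proof (cases "\<alpha> = 0")
  case False
  have "sY 2 \<alpha> = \<alpha> + \<alpha>" using scale_left_distrib[of 1 1 \<alpha>] by simp
  then show ?thesis using reflection_in[of \<alpha> \<alpha>] coroot_two[of \<alpha>] assms False by simp
qed (use zero_in in auto)

text \<open>If two functionals take the value 2 at \<open>\<alpha>\<close> and both reflections preserve \<open>S\<close>, the product of
  the reflections is a transvection along \<open>\<alpha>\<close>. It would have infinite orbits in the finite set of
  roots in a plane unless it is the identity.\<close>

lemma coroot_unique:
  assumes \<alpha>: "\<alpha> \<in> S - {0}" and lin: "Vector_Spaces.linear sY (*) g"
    and two: "g \<alpha> = 2"
    and refl: "(\<lambda>y. y - sY (g y) \<alpha>) ` S \<subseteq> S"
  shows "g = co \<alpha>"
proof -
  have g_add: "g (x + y) = g x + g y" and g_scale: "g (sY k x) = k * g x" for x y k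
    using lin by (auto simp: Vector_Spaces.linear_iff)
  have on_S: "g \<beta> = co \<alpha> \<beta>" if \<beta>: "\<beta> \<in> S" for \<beta>
  proof (rule ccontr)
    assume ne: "g \<beta> \<noteq> co \<alpha> \<beta>"
    \<comment> \<open>the length of the translation by which the product of the reflections moves \<open>\<beta>\<close>\<close>
    define n where "n = g \<beta> - co \<alpha> \<beta>"
    have n: "n \<noteq> 0" using ne by (simp add: n_def)
    have orbit: "\<beta> + sY (of_nat k * n) \<alpha> \<in> S" for k
    proof (induction k)
      case (Suc k)
      let ?b = "\<beta> + sY (of_nat k * n) \<alpha>"
      let ?c = "?b - sY (g ?b) \<alpha>"
      have "?c \<in> S" using Suc refl by blast
      then have "?c - sY (co \<alpha> ?c) \<alpha> \<in> S" using reflection_in[OF \<alpha>] by blast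
      moreover have "co \<alpha> ?c = co \<alpha> \<beta> - 2 * g \<beta> + - 2 * (of_nat k * n)"
        using \<alpha> coroot_two[OF \<alpha>] two
        by (simp add: coroot_add coroot_diff coroot_scale g_add g_scale algebra_simps)
      moreover have "g ?b = g \<beta> + 2 * (of_nat k * n)" using two by (simp add: g_add g_scale)
      ultimately have "?b - sY (g \<beta> + 2 * (of_nat k * n)) \<alpha>
          - sY (co \<alpha> \<beta> - 2 * g \<beta> + - 2 * (of_nat k * n)) \<alpha> \<in> S" by simp
      also have "?b - sY (g \<beta> + 2 * (of_nat k * n)) \<alpha>
          - sY (co \<alpha> \<beta> - 2 * g \<beta> + - 2 * (of_nat k * n)) \<alpha> = \<beta> + sY (of_nat (Suc k) * n) \<alpha>"
      proof -
        have "?b - sY c \<alpha> - sY c' \<alpha> = \<beta> + sY (of_nat k * n - c - c') \<alpha>" for c c'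
          by (simp add: scale_left_diff_distrib)
        moreover have "of_nat k * n - (g \<beta> + 2 * (of_nat k * n))
            - (co \<alpha> \<beta> - 2 * g \<beta> + - 2 * (of_nat k * n)) = of_nat (Suc k) * n"
          by (simp add: n_def algebra_simps)
        ultimately show ?thesis by simp
      qed
      finally show ?case .
    qed (use \<beta> in simp)
    have "range (\<lambda>k. \<beta> + sY (of_nat k * n) \<alpha>) \<subseteq> S \<inter> span {\<alpha>, \<beta>}"
      using orbit by (auto intro: span_add[OF span_base span_scale[OF span_base]])
    then have "finite (range (\<lambda>k::nat. \<beta> + sY (of_nat k * n) \<alpha>))"
      by (rule finite_subset) (simp add: locally_finite)
    moreover have "inj (\<lambda>k::nat. \<beta> + sY (of_nat k * n) \<alpha>)"
      using \<alpha> n by (auto simp: inj_def)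
    ultimately show False using finite_imageD by blast
  qed
  show ?thesis
  proof
    fix x
    have "x \<in> span S" using spanning by simp
    then show "g x = co \<alpha> x"
    proof (induction rule: span_induct_alt)
      case base
      show ?case using g_scale[of 0 0] coroot_scale[OF \<alpha>, of 0 0] by simp
    next
      case (step c x y)
      then show ?case using on_S \<alpha> by (simp add: g_add g_scale coroot_add coroot_scale)
    qed
  qed
qed

lemma indivisible_in: "\<alpha> \<in> indivisible sY S \<Longrightarrow> \<alpha> \<in> S - {0}"
  by (auto simp: indivisible_def)

text \<open>If \<open>\<alpha>/2\<close> is a root, then \<open>\<alpha>/4\<close> is not, because the coroot of \<open>\<alpha>\<close> would take the value \<open>1/2\<close> there.
  Moreover half the coroot of \<open>\<alpha>/2\<close> defines the same reflection as the coroot of \<open>\<alpha>\<close>, so uniqueness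
  of coroots applies.\<close>

lemma divisible_cases:
  assumes "\<alpha> \<in> S - {0}"
  obtains "\<alpha> \<in> indivisible sY S"
  | "sY (1/2) \<alpha> \<in> indivisible sY S" "\<And>y. co \<alpha> y = 1/2 * co (sY (1/2) \<alpha>) y"
proof (cases "\<alpha> \<in> indivisible sY S")
  case False
  define \<gamma> where "\<gamma> = sY (1/2) \<alpha>"
  have \<gamma>: "\<gamma> \<in> S - {0}" using False assms by (auto simp: indivisible_def \<gamma>_def)
  have \<alpha>\<gamma>: "\<alpha> = sY 2 \<gamma>" by (simp add: \<gamma>_def)
  have "\<gamma> \<in> indivisible sY S"
  proof (rule ccontr)
    assume "\<gamma> \<notin> indivisible sY S"
    then have "sY (1/4) \<alpha> \<in> S" using \<gamma> by (auto simp: indivisible_def \<gamma>_def)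
    then have "co \<alpha> (sY (1/4) \<alpha>) \<in> \<int>" using integral assms by blast
    then have "(1/2 :: 'k) \<in> \<int>" using coroot_scale[OF assms] coroot_two[OF assms] by simp
    then obtain n :: int where "1/2 = (of_int n :: 'k)" by (auto elim: Ints_cases)
    then have "of_int 1 = (of_int (2 * n) :: 'k)" by (simp add: field_simps)
    then have "1 = 2 * n" by (simp only: of_int_eq_iff)
    then show False by presburger
  qed
  moreover have "(\<lambda>y. 1/2 * co \<gamma> y) = co \<alpha>"
  proof (rule coroot_unique[OF assms])
    show "Vector_Spaces.linear sY (*) (\<lambda>y. 1 / 2 * co \<gamma> y)"
      using coroot_linear[OF \<gamma>] by (auto simp: Vector_Spaces.linear_iff algebra_simps)
    show "1/2 * co \<gamma> \<alpha> = 2" using coroot_two[OF \<gamma>] coroot_scale[OF \<gamma>]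
      by (simp add: \<alpha>\<gamma>)
    have eq: "(\<lambda>y. y - sY (1/2 * co \<gamma> y) \<alpha>) = (\<lambda>y. y - sY (co \<gamma> y) \<gamma>)" by (simp add: \<alpha>\<gamma>)
    show "(\<lambda>y. y - sY (1/2 * co \<gamma> y) \<alpha>) ` S \<subseteq> S"
      unfolding eq using reflection[OF \<gamma>] by (rule equalityD1)
  qed
  ultimately show ?thesis using that(2) \<gamma>_def by metis
qed (use that in auto)

text \<open>Only indivisible roots are admitted because the Cartan subspace is defined by their coroots.\<close>

lemma lattice_rational_combination:
  assumes "v \<in> group_closure S"
  shows "\<exists>F r. finite F \<and> F \<subseteq> indivisible sY S \<and> (\<forall>\<beta>. r \<beta> \<in> \<rat>) \<and> v = (\<Sum>\<beta>\<in>F. sY (r \<beta>) \<beta>)"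
  using assms
proof induction
  case (base s)
  show ?case
  proof (cases "s = 0")
    case True
    then show ?thesis by (intro exI[of _ "{}"] exI[of _ "\<lambda>_. 0"]) auto
  next
    case False
    then have "s \<in> S - {0}" using base by auto
    then show ?thesis
    proof (cases rule: divisible_cases)
      case 1
      then show ?thesis by (intro exI[of _ "{s}"] exI[of _ "\<lambda>_. 1"]) auto
    next
      case 2
      then show ?thesis by (intro exI[of _ "{sY (1/2) s}"] exI[of _ "\<lambda>_. 2"]) auto
    qed
  qed
next
  case (diff x y)
  obtain F r where F: "finite F" "F \<subseteq> indivisible sY S" "\<forall>\<beta>. r \<beta> \<in> \<rat>"
    "x = (\<Sum>\<beta>\<in>F. sY (r \<beta>) \<beta>)" using diff.IH(1) by blast
  obtain G q where G: "finite G" "G \<subseteq> indivisible sY S" "\<forall>\<beta>. q \<beta> \<in> \<rat>"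
    "y = (\<Sum>\<beta>\<in>G. sY (q \<beta>) \<beta>)" using diff.IH(2) by blast
  define r' where "r' \<beta> = (if \<beta> \<in> F then r \<beta> else 0)" for \<beta>
  define q' where "q' \<beta> = (if \<beta> \<in> G then q \<beta> else 0)" for \<beta>
  have "x = (\<Sum>\<beta>\<in>F \<union> G. sY (r' \<beta>) \<beta>)"
    unfolding F(4) r'_def by (rule sum.mono_neutral_cong_left) (use F G in auto)
  moreover have "y = (\<Sum>\<beta>\<in>F \<union> G. sY (q' \<beta>) \<beta>)"
    unfolding G(4) q'_def by (rule sum.mono_neutral_cong_left) (use F G in auto)
  ultimately have "x - y = (\<Sum>\<beta>\<in>F \<union> G. sY (r' \<beta> - q' \<beta>) \<beta>)"
    by (simp add: sum_subtractf scale_left_diff_distrib)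
  then show ?case
    using F G by (intro exI[of _ "F \<union> G"] exI[of _ "\<lambda>\<beta>. r' \<beta> - q' \<beta>"]) (auto simp: r'_def q'_def)
qed

text \<open>The sum on the left is mapped to its negative by the reflection in \<open>\<beta>\<close>, hence is a multiple of
  \<open>\<beta>\<close>. So every root is recovered from its coroot through the finite set \<open>A\<close> of roots.\<close>

lemma coroot_recovers_root:
  assumes A: "finite A" "\<And>\<alpha>. \<alpha> \<in> A \<Longrightarrow> \<alpha> - sY (co \<beta> \<alpha>) \<beta> \<in> A" and \<beta>: "\<beta> \<in> S - {0}"
  shows "sY 2 (\<Sum>\<alpha>\<in>A. sY (co \<beta> \<alpha>) \<alpha>) = sY (\<Sum>\<alpha>\<in>A. co \<beta> \<alpha> * co \<beta> \<alpha>) \<beta>"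
proof -
  let ?s = "\<lambda>\<alpha>. \<alpha> - sY (co \<beta> \<alpha>) \<beta>"
    and ?x = "\<Sum>\<alpha>\<in>A. sY (co \<beta> \<alpha>) \<alpha>"
  have co_s: "co \<beta> (?s \<alpha>) = - co \<beta> \<alpha>" for \<alpha>
    using \<beta> coroot_two[OF \<beta>] by (simp add: coroot_diff coroot_scale)
  have ss: "?s (?s \<alpha>) = \<alpha>" for \<alpha> using co_s[of \<alpha>]
    by (simp add: scale_left_distrib[symmetric])
  have "?x = (\<Sum>\<alpha>\<in>A. sY (co \<beta> (?s \<alpha>)) (?s \<alpha>))"
    by (rule sum.reindex_bij_witness[of _ ?s ?s]) (simp_all only: ss A)
  also have "\<dots> = (\<Sum>\<alpha>\<in>A. sY (co \<beta> \<alpha> * co \<beta> \<alpha>) \<beta> - sY (co \<beta> \<alpha>) \<alpha>)"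
    by (simp only: co_s) (simp add: scale_right_diff_distrib)
  also have "\<dots> = sY (\<Sum>\<alpha>\<in>A. co \<beta> \<alpha> * co \<beta> \<alpha>) \<beta> - ?x"
    by (simp add: sum_subtractf scale_sum_left)
  finally have "?x + ?x = sY (\<Sum>\<alpha>\<in>A. co \<beta> \<alpha> * co \<beta> \<alpha>) \<beta>"
    by (simp add: algebra_simps)
  then show ?thesis using scale_left_distrib[of 1 1 ?x] by simp
qed

text \<open>By the preceding lemma a rational combination \<open>v\<close> of roots is \<open>\<Sum> \<phi>(\<alpha>) \<alpha>\<close> for a
  rational combination \<open>\<phi>\<close> of coroots, so \<open>\<phi>(v) = \<Sum> \<phi>(\<alpha>)\<^sup>2\<close>. If all coroots vanish at \<open>v\<close>,
  then \<open>\<phi>(v) = 0\<close>, hence \<open>\<phi> = 0\<close> on these roots and \<open>v = 0\<close>.\<close>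

lemma coroots_separate:
  assumes "v \<in> group_closure S" and van: "\<And>\<alpha>. \<alpha> \<in> indivisible sY S \<Longrightarrow> co \<alpha> v = 0"
  shows "v = 0"
proof -
  obtain F r where F: "finite F" "F \<subseteq> indivisible sY S"
    and r: "\<And>\<beta>. r \<beta> \<in> \<rat>"
    and v: "v = (\<Sum>\<beta>\<in>F. sY (r \<beta>) \<beta>)" using lattice_rational_combination[OF assms(1)]
      by metis
  have FS: "\<beta> \<in> S - {0}" if "\<beta> \<in> F" for \<beta> using F indivisible_in that by auto
  define A where "A = S \<inter> span F"
  have A: "finite A" unfolding A_def by (rule locally_finite[OF F(1)])
  have A_refl: "\<alpha> - sY (co \<beta> \<alpha>) \<beta> \<in> A" if "\<alpha> \<in> A" "\<beta> \<in> F" for \<alpha> \<beta>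
    using that FS reflection_in[of \<beta> \<alpha>] span_diff[OF _ span_scale[OF span_base[of \<beta> F]], of \<alpha>]
    by (auto simp: A_def)
  have int: "co \<beta> \<alpha> \<in> \<rat>" if "\<alpha> \<in> A" "\<beta> \<in> F" for \<alpha> \<beta>
    using integral[of \<beta> \<alpha>] FS that Ints_subset_Rats by (auto simp: A_def)
  define c where "c \<beta> = (\<Sum>\<alpha>\<in>A. co \<beta> \<alpha> * co \<beta> \<alpha>)" for \<beta>
  have c_rat: "c \<beta> \<in> \<rat>" if "\<beta> \<in> F" for \<beta> unfolding c_def using int that
    by (intro Rats_sum) auto
  have c_ne: "c \<beta> \<noteq> 0" if \<beta>: "\<beta> \<in> F" for \<beta>
  proof
    assume "c \<beta> = 0"
    then have "co \<beta> \<beta> = 0" unfolding c_def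
      using rational_sum_squares_eq_0[OF A, of "co \<beta>" \<beta>] int \<beta> FS
        by (auto simp: A_def span_base)
    then show False using coroot_two FS[OF \<beta>] by simp
  qed
  define \<phi> where "\<phi> x = (\<Sum>\<beta>\<in>F. r \<beta> * 2 / c \<beta> * co \<beta> x)" for x
  have \<phi>_rat: "\<phi> \<alpha> \<in> \<rat>" if "\<alpha> \<in> A" for \<alpha>
    unfolding \<phi>_def using that r c_rat int by (intro Rats_sum) auto
  have "(\<Sum>\<alpha>\<in>A. sY (\<phi> \<alpha>) \<alpha>) = (\<Sum>\<alpha>\<in>A. \<Sum>\<beta>\<in>F. sY (r \<beta> * 2 / c \<beta> * co \<beta> \<alpha>) \<alpha>)"
    by (simp add: \<phi>_def scale_sum_left)
  also have "\<dots> = (\<Sum>\<beta>\<in>F. \<Sum>\<alpha>\<in>A. sY (r \<beta> * 2 / c \<beta> * co \<beta> \<alpha>) \<alpha>)" by (rule sum.swap)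
  also have "\<dots> = (\<Sum>\<beta>\<in>F. sY (r \<beta> / c \<beta>) (sY 2 (\<Sum>\<alpha>\<in>A. sY (co \<beta> \<alpha>) \<alpha>)))"
    by (simp add: scale_sum_right mult_ac)
  also have "\<dots> = (\<Sum>\<beta>\<in>F. sY (r \<beta> / c \<beta>) (sY (c \<beta>) \<beta>))"
    unfolding c_def
    by (intro sum.cong refl arg_cong[of _ _ "sY _"] coroot_recovers_root) (use A A_refl FS in auto)
  also have "\<dots> = v" unfolding v using c_ne by (intro sum.cong) auto
  finally have v_eq: "v = (\<Sum>\<alpha>\<in>A. sY (\<phi> \<alpha>) \<alpha>)" by simp
  have \<phi>_v: "\<phi> v = 0" unfolding \<phi>_def using van F by (intro sum.neutral) auto
  have "\<phi> v = (\<Sum>\<beta>\<in>F. r \<beta> * 2 / c \<beta> * (\<Sum>\<alpha>\<in>A. \<phi> \<alpha> * co \<beta> \<alpha>))"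
    unfolding \<phi>_def[of v] by (subst v_eq) (use FS in \<open>simp add: coroot_sum coroot_scale\<close>)
  also have "\<dots> = (\<Sum>\<alpha>\<in>A. \<phi> \<alpha> * \<phi> \<alpha>)"
  proof -
    have "(\<Sum>\<alpha>\<in>A. \<phi> \<alpha> * \<phi> \<alpha>) = (\<Sum>\<alpha>\<in>A. \<Sum>\<beta>\<in>F. \<phi> \<alpha> * (r \<beta> * 2 / c \<beta> * co \<beta> \<alpha>))"
      by (simp only: \<phi>_def[symmetric] sum_distrib_left[symmetric])
    also have "\<dots> = (\<Sum>\<beta>\<in>F. \<Sum>\<alpha>\<in>A. \<phi> \<alpha> * (r \<beta> * 2 / c \<beta> * co \<beta> \<alpha>))" by (rule sum.swap)
    finally show ?thesis by (simp add: sum_distrib_left sum_divide_distrib mult_ac)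
  qed
  finally have "(\<Sum>\<alpha>\<in>A. \<phi> \<alpha> * \<phi> \<alpha>) = 0" using \<phi>_v by simp
  then have "\<phi> \<alpha> = 0" if "\<alpha> \<in> A" for \<alpha>
    using rational_sum_squares_eq_0[OF A, of \<phi> \<alpha>] \<phi>_rat that by auto
  then show ?thesis using v_eq by simp
qed

end

section \<open>Predivision graded Lie algebras with an invariant form\<close>

context lie_algebra begin

lemma br_add_left: "x \<in> V \<Longrightarrow> y \<in> V \<Longrightarrow> z \<in> V \<Longrightarrow> br (x + y) z = br x z + br y z"
  and br_add_right: "x \<in> V \<Longrightarrow> y \<in> V \<Longrightarrow> z \<in> V \<Longrightarrow> br z (x + y) = br z x + br z y"
  and br_scale_left: "x \<in> V \<Longrightarrow> y \<in> V \<Longrightarrow> br (s k x) y = s k (br x y)"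
  and br_scale_right: "x \<in> V \<Longrightarrow> y \<in> V \<Longrightarrow> br x (s k y) = s k (br x y)"
  using bracket_bilinear by (auto simp: bilinear_on_def)

lemma br_zero_left: "x \<in> V \<Longrightarrow> br 0 x = 0"
  and br_zero_right: "x \<in> V \<Longrightarrow> br x 0 = 0"
  using br_scale_left[of 0 x 0] br_scale_right[of x 0 0] subspace_0[OF carrier_subspace] by auto

lemma br_skew: assumes "x \<in> V" "y \<in> V" shows "br x y = - br y x"
proof -
  have "br (x + y) (x + y) = 0"
    using assms carrier_subspace by (auto intro: bracket_alternating subspace_add)
  moreover have "br (x + y) (x + y) = br x y + br y x"
    using assms carrier_subspace
    by (simp add: br_add_left br_add_right subspace_add bracket_alternating[of x] bracket_alternating[of y])
  ultimately show ?thesis by (simp add: eq_neg_iff_add_eq_0)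
qed

lemma br_minus_left: "x \<in> V \<Longrightarrow> y \<in> V \<Longrightarrow> br (- x) y = - br x y"
  and br_minus_right: "x \<in> V \<Longrightarrow> y \<in> V \<Longrightarrow> br x (- y) = - br x y"
  using br_scale_left[of x y "-1"] br_scale_right[of x y "-1"] by auto

lemma br_derivation:
  assumes "x \<in> V" "y \<in> V" "z \<in> V"
  shows "br x (br y z) = br (br x y) z + br y (br x z)"
proof -
  have "br x (br y z) + br y (br z x) + br z (br x y) = 0" using jacobi assms by auto
  moreover have "br y (br z x) = - br y (br x z)"
    using assms br_skew[of z x] br_minus_right bracket_closed by simp
  moreover have "br z (br x y) = - br (br x y) z" using assms bracket_closed by (intro br_skew) auto
  ultimately show ?thesis by (simp add: algebra_simps)
qed

end

lemma funpow_zero_mono: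
  fixes A :: "'a::zero \<Rightarrow> 'a"
  assumes "(A ^^ n) y = 0" "A 0 = 0" "n \<le> m" shows "(A ^^ m) y = 0"
proof -
  have "(A ^^ (k + n)) y = 0" for k by (induction k) (use assms in auto)
  from this[of "m - n"] show ?thesis using assms by simp
qed

context predivision_graded_lie_algebra begin

lemma lattice_S: "q \<in> S \<Longrightarrow> q \<in> group_closure S"
  by (auto intro: group_closure.base)

lemma Lg_subspace: "q \<in> group_closure S \<Longrightarrow> subspace (Lg q \<nu>)"
  using grading by (auto simp: is_direct_sum_def)

end

sublocale predivision_graded_lie_algebra \<subseteq>
  bigrading: direct_sum_decomposition sL UNIV "group_closure S \<times> UNIV" "\<lambda>(q, \<nu>). Lg q \<nu>"
  by unfold_locales (use grading in auto)

context predivision_graded_lie_algebra begin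

lemma Lg_eq_0:
  assumes "q \<in> group_closure S" "q \<notin> S" "x \<in> Lg q \<nu>" shows "x = 0"
proof -
  have "x \<in> root_part sL Lg q" unfolding root_part_def using assms by (auto intro: span_base)
  then show ?thesis using RG1[of q] assms by auto
qed

lemma degree_direct_sum: "is_direct_sum sL UNIV UNIV (degree_part S sL Lg)"
proof -
  have "(\<Union>i\<in>{i \<in> group_closure S \<times> UNIV. snd i = \<nu>}. case i of (q, \<nu>) \<Rightarrow> Lg q \<nu>) =
      (\<Union>q\<in>group_closure S. Lg q \<nu>)" for \<nu> by auto
  then have "degree_part S sL Lg =
      (\<lambda>\<nu>. span (\<Union>i\<in>{i \<in> group_closure S \<times> UNIV. snd i = \<nu>}. case i of (q, \<nu>) \<Rightarrow> Lg q \<nu>))"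
    by (simp add: degree_part_def fun_eq_iff)
  then show ?thesis using bigrading.coarsening[of snd UNIV] by simp
qed

end

sublocale predivision_graded_lie_algebra \<subseteq>
  degree: direct_sum_decomposition sL UNIV UNIV "degree_part S sL Lg"
  by unfold_locales (use degree_direct_sum in auto)

context predivision_graded_lie_algebra begin

lemma Lg_degree_part: "q \<in> group_closure S \<Longrightarrow> x \<in> Lg q \<nu> \<Longrightarrow> x \<in> degree_part S sL Lg \<nu>"
  unfolding degree_part_def by (auto intro: span_base)

lemma Lg_root_part: "x \<in> Lg q \<nu> \<Longrightarrow> x \<in> root_part sL Lg q"
  unfolding root_part_def by (auto intro: span_base)

lemma degree_part_pr:
  assumes "x \<in> degree_part S sL Lg \<nu>" "\<mu> \<noteq> \<nu>" shows "bigrading.pr (q, \<mu>) x = 0"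
proof -
  have "(\<Union>q\<in>group_closure S. Lg q \<nu>) = (\<Union>i\<in>group_closure S \<times> {\<nu>}. case i of (q, \<nu>) \<Rightarrow> Lg q \<nu>)" by auto
  then show ?thesis
    using bigrading.pr_span(2)[of "group_closure S \<times> {\<nu>}" x "(q, \<mu>)"] assms
    by (auto simp: degree_part_def)
qed

lemma in_LgI:
  assumes "q \<in> group_closure S" "\<And>p \<mu>. p \<in> group_closure S \<Longrightarrow> (p, \<mu>) \<noteq> (q, \<nu>) \<Longrightarrow> bigrading.pr (p, \<mu>) x = 0"
  shows "x \<in> Lg q \<nu>"
proof -
  have "x \<in> span (\<Union>i\<in>{(q, \<nu>)}. case i of (q, \<nu>) \<Rightarrow> Lg q \<nu>)"
  proof (rule bigrading.in_span_if_pr)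
    fix i assume "i \<in> group_closure S \<times> (UNIV :: 'g set)" "i \<notin> {(q, \<nu>)}"
    then show "bigrading.pr i x = 0" using assms(2)[of "fst i" "snd i"] by auto
  qed simp
  then have "x \<in> span (Lg q \<nu>)" by simp
  then show ?thesis using span_eq_iff Lg_subspace[OF assms(1)] by metis
qed

lemma L_induct [case_names zero homogeneous add]:
  assumes "P 0" and hom: "\<And>q \<nu> x. q \<in> S \<Longrightarrow> x \<in> Lg q \<nu> \<Longrightarrow> P x"
    and "\<And>x y. P x \<Longrightarrow> P y \<Longrightarrow> P (x + y)"
  shows "P x"
proof (rule bigrading.graded_induct[of x P])
  fix i x assume i: "i \<in> group_closure S \<times> (UNIV :: 'g set)" "x \<in> (case i of (q, \<nu>) \<Rightarrow> Lg q \<nu>)"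
  then show "P x" using hom[of "fst i" x "snd i"] Lg_eq_0[of "fst i" x "snd i"] \<open>P 0\<close>
    by (cases "fst i \<in> S") auto
qed (use assms in auto)

lemma root_part_induct [consumes 2, case_names zero homogeneous add]:
  assumes "q \<in> group_closure S" "x \<in> root_part sL Lg q" "P 0" "\<And>\<nu> x. x \<in> Lg q \<nu> \<Longrightarrow> P x"
    and "\<And>x y. x \<in> root_part sL Lg q \<Longrightarrow> y \<in> root_part sL Lg q \<Longrightarrow> P x \<Longrightarrow> P y \<Longrightarrow> P (x + y)"
  shows "P x"
proof -
  have "x \<in> root_part sL Lg q \<and> P x" using assms(2) unfolding root_part_def
  proof (induction rule: span_induct_alt)
    case base
    then show ?case using assms span_zero by simp
  next
    case (step c x y)
    then obtain \<nu> where "x \<in> Lg q \<nu>" by auto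
    then have "sL c x \<in> Lg q \<nu>" using Lg_subspace[OF assms(1)] subspace_scale by blast
    then show ?case using step assms(4,5) Lg_root_part span_add unfolding root_part_def by metis
  qed
  then show ?thesis by simp
qed

lemma degree_part_induct [consumes 1, case_names zero homogeneous add]:
  assumes "x \<in> degree_part S sL Lg \<nu>" "P 0" "\<And>q x. q \<in> S \<Longrightarrow> x \<in> Lg q \<nu> \<Longrightarrow> P x"
    and "\<And>x y. P x \<Longrightarrow> P y \<Longrightarrow> P (x + y)"
  shows "P x"
  using assms(1) unfolding degree_part_def
proof (induction rule: span_induct_alt)
  case (step c x y)
  then obtain q where q: "q \<in> group_closure S" "x \<in> Lg q \<nu>" by auto
  then have "sL c x \<in> Lg q \<nu>" using Lg_subspace[OF q(1)] subspace_scale by blast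
  then have "P (sL c x)" using assms(2,3) Lg_eq_0[OF q(1), of "sL c x" \<nu>] by (cases "q \<in> S") auto
  then show ?case using step assms(4) by blast
qed (use assms in auto)

lemma invertible_acts:
  "invertible_with S co sL brL Lg \<alpha> \<nu> e f \<Longrightarrow> q \<in> group_closure S \<Longrightarrow> x \<in> Lg q \<mu> \<Longrightarrow>
    brL (brL f e) x = sL (co \<alpha> q) x"
  using Lg_root_part by (auto simp: invertible_with_def)

text \<open>The points \<open>q + n \<xi>\<close> are pairwise different and lie in a plane, which contains only finitely many roots.\<close>

lemma ad_locally_nilpotent:
  assumes \<xi>: "\<xi> \<in> S - {0}" and x: "x \<in> Lg \<xi> \<nu>"
  shows "\<exists>n. (brL x ^^ n) y = 0"
proof (induction y rule: L_induct)
  case zero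
  then show ?case by (intro exI[of _ 0]) simp
next
  case (homogeneous q \<mu> y)
  let ?q = "\<lambda>n::nat. q + sY (of_nat n) \<xi>"
  have lattice: "?q n \<in> group_closure S" for n
  proof (induction n)
    case (Suc n)
    have "?q (Suc n) = ?q n + \<xi>" by (simp add: algebra_simps)
    then show ?case using Suc \<xi> lattice_S group_closure_add by (metis DiffD1)
  qed (use homogeneous lattice_S in simp)
  have mem: "(brL x ^^ n) y \<in> Lg (?q n) (\<mu> + (\<Sum>i<n. \<nu>))" for n
  proof (induction n)
    case (Suc n)
    have "brL x ((brL x ^^ n) y) \<in> Lg (\<xi> + ?q n) (\<nu> + (\<mu> + (\<Sum>i<n. \<nu>)))"
      using \<xi> lattice_S lattice Suc x by (intro grading_bracket) auto
    then show ?case by (simp add: algebra_simps)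
  qed (use homogeneous in simp)
  show ?case
  proof (rule ccontr)
    assume "\<nexists>n. (brL x ^^ n) y = 0"
    then have "?q n \<in> S" for n using Lg_eq_0[OF lattice _ mem] by auto
    then have "range ?q \<subseteq> S \<inter> root_system.span {\<xi>, q}"
      by (auto intro: root_system.span_add[OF root_system.span_base root_system.span_scale[OF root_system.span_base]])
    then have "finite (range ?q)" by (rule finite_subset) (simp add: root_system.locally_finite)
    moreover have "inj ?q" using \<xi> by (auto simp: inj_def)
    ultimately show False using finite_imageD by blast
  qed
next
  case (add y z)
  then obtain m n where mn: "(brL x ^^ m) y = 0" "(brL x ^^ n) z = 0" by blast
  have "(brL x ^^ k) (y + z) = (brL x ^^ k) y + (brL x ^^ k) z" for k
    by (induction k) (auto simp: br_add_right)
  then show ?case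
    using funpow_zero_mono[OF mn(1) br_zero_right, of "max m n"]
      funpow_zero_mono[OF mn(2) br_zero_right, of "max m n"] by (intro exI[of _ "max m n"]) auto
qed

text \<open>A vector of weight 2 killed by \<open>f\<close> would be a lowest weight vector: \<open>f\<close> maps
  \<open>e\<^sup>n x\<close> to \<open>n(n+1) e\<^sup>n\<^sup>-\<^sup>1 x\<close>, so no power of \<open>e\<close> could kill it.\<close>

lemma no_lowest_weight_vector:
  assumes \<xi>: "\<xi> \<in> S - {0}" and inv: "invertible_with S co sL brL Lg \<xi> \<nu> e f"
    and x: "x \<in> Lg \<xi> \<mu>" "brL f x = 0"
  shows "x = 0"
proof (rule ccontr)
  assume "x \<noteq> 0"
  define h where "h = brL f e"
  have e: "e \<in> Lg \<xi> \<nu>" using inv by (simp add: invertible_with_def)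
  have he: "brL h e = sL 2 e" and hx: "brL h x = sL 2 x"
    using invertible_acts[OF inv lattice_S] \<xi> e x root_system.coroot_two by (auto simp: h_def)
  have h_pow: "brL h ((brL e ^^ n) x) = sL (of_nat (2 + 2 * n)) ((brL e ^^ n) x)" for n
  proof (induction n)
    case (Suc n)
    have "brL h ((brL e ^^ Suc n) x) = brL (brL h e) ((brL e ^^ n) x) + brL e (brL h ((brL e ^^ n) x))"
      using br_derivation[of h e] by simp
    also have "\<dots> = sL 2 ((brL e ^^ Suc n) x) + sL (of_nat (2 + 2 * n)) ((brL e ^^ Suc n) x)"
      using Suc he by (simp add: br_scale_left br_scale_right)
    also have "\<dots> = sL (2 + of_nat (2 + 2 * n)) ((brL e ^^ Suc n) x)"
      by (rule scale_left_distrib[symmetric])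
    finally show ?case by (simp add: algebra_simps)
  qed (use hx in simp)
  have f_pow: "brL f ((brL e ^^ Suc n) x) = sL (of_nat (Suc n * (n + 2))) ((brL e ^^ n) x)" for n
  proof (induction n)
    case 0
    show ?case using br_derivation[of f e x] x hx br_zero_right by (simp add: h_def)
  next
    case (Suc n)
    let ?y = "(brL e ^^ Suc n) x"
    have "brL f (brL e ?y) = brL h ?y + brL e (brL f ?y)"
      using br_derivation[of f e ?y] by (simp add: h_def)
    also have "\<dots> = sL (of_nat (2 + 2 * Suc n)) ?y + sL (of_nat (Suc n * (n + 2))) ?y"
      unfolding h_pow Suc by (simp add: br_scale_right)
    also have "\<dots> = sL (of_nat (2 + 2 * Suc n) + of_nat (Suc n * (n + 2))) ?y"
      by (rule scale_left_distrib[symmetric])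
    also have "(of_nat (2 + 2 * Suc n) + of_nat (Suc n * (n + 2)) :: 'k) = of_nat (Suc (Suc n) * (Suc n + 2))"
      unfolding of_nat_add[symmetric] by (rule arg_cong[of _ _ of_nat]) (simp add: algebra_simps)
    finally show ?case by simp
  qed
  obtain n where n: "(brL e ^^ n) x = 0" using ad_locally_nilpotent[OF \<xi> e] by blast
  have "(brL e ^^ n) x \<noteq> 0" for n
  proof (induction n)
    case (Suc n)
    show ?case
    proof
      assume "(brL e ^^ Suc n) x = 0"
      then have "sL (of_nat (Suc n * (n + 2))) ((brL e ^^ n) x) = 0"
        using f_pow[of n] br_zero_right by simp
      moreover have "(of_nat (Suc n * (n + 2)) :: 'k) \<noteq> 0" by (simp only: of_nat_eq_0_iff) simp
      ultimately show False using Suc scale_eq_0_iff by blast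
    qed
  qed (use \<open>x \<noteq> 0\<close> in simp)
  then show False using n by blast
qed

text \<open>(RG3) speaks about brackets of arbitrary elements of opposite root spaces. Expanding both factors
  into homogeneous components and taking the component of degree \<open>\<kappa>\<close> leaves homogeneous brackets.\<close>

lemma Lg_0_spanned:
  assumes x: "x \<in> Lg 0 \<kappa>"
  shows "x \<in> span {brL a b | a b \<xi> \<mu>. \<xi> \<in> S - {0} \<and> a \<in> Lg \<xi> \<mu> \<and> b \<in> Lg (- \<xi>) (\<kappa> - \<mu>)}" (is "_ \<in> span ?B")
proof -
  have 0: "0 \<in> group_closure S" by simp
  have br: "bigrading.pr (0, \<kappa>) (brL a b) \<in> span ?B"
    if \<alpha>: "\<alpha> \<in> S - {0}" and a: "a \<in> root_part sL Lg \<alpha>"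
      and b: "b \<in> root_part sL Lg (- \<alpha>)" for \<alpha> a b
  proof -
    have lat: "\<alpha> \<in> group_closure S" "- \<alpha> \<in> group_closure S" using \<alpha> lattice_S
      by auto
    show ?thesis using lat(1) a
    proof (induction rule: root_part_induct)
      case zero
      then show ?case by (simp add: br_zero_left bigrading.pr_zero span_zero)
    next
      case (homogeneous \<mu> a)
      note a = this
      show ?case using lat(2) b
      proof (induction rule: root_part_induct)
        case zero
        then show ?case by (simp add: br_zero_right bigrading.pr_zero span_zero)
      next
        case (homogeneous \<nu> b)
        have "brL a b \<in> Lg 0 (\<mu> + \<nu>)" using grading_bracket[OF lat a homogeneous] by simp
        then have "bigrading.pr (0, \<kappa>) (brL a b) = (if \<kappa> = \<mu> + \<nu> then brL a b else 0)"
          using bigrading.pr_homogeneous[of "(0, \<mu> + \<nu>)" "brL a b" "(0, \<kappa>)"] by auto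
        moreover have "brL a b \<in> ?B" if "\<kappa> = \<mu> + \<nu>"
        proof -
          have "b \<in> Lg (- \<alpha>) (\<kappa> - \<mu>)" using that homogeneous by simp
          then show ?thesis using a \<alpha> by blast
        qed
        ultimately show ?case by (auto intro: span_base span_zero)
      next
        case (add x y)
        then show ?case by (simp add: br_add_right bigrading.pr_add span_add)
      qed
    next
      case (add x y)
      then show ?case by (simp add: br_add_left bigrading.pr_add span_add)
    qed
  qed
  have "x \<in> root_part sL Lg 0" using x Lg_root_part by auto
  then have "bigrading.pr (0, \<kappa>) x \<in> span ?B" unfolding RG3
  proof (induction rule: span_induct_alt)
    case base
    then show ?case by (simp add: bigrading.pr_zero span_zero)
  next
    case (step c y z)
    then have "bigrading.pr (0, \<kappa>) y \<in> span ?B" using br by auto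
    then show ?case using step by (simp add: bigrading.pr_add bigrading.pr_scale span_add span_scale)
  qed
  moreover have "bigrading.pr (0, \<kappa>) x = x"
    using bigrading.pr_homogeneous[of "(0, \<kappa>)" x "(0, \<kappa>)"] x by simp
  ultimately show ?thesis by simp
qed

end

context predivision_graded_lie_algebra begin

lemma Lg_0_induct [consumes 1, case_names zero bracket add]:
  assumes x: "x \<in> Lg 0 \<kappa>" and zero: "P 0"
    and br: "\<And>\<xi> \<mu> a b. \<xi> \<in> S - {0} \<Longrightarrow> a \<in> Lg \<xi> \<mu> \<Longrightarrow> b \<in> Lg (- \<xi>) (\<kappa> - \<mu>) \<Longrightarrow> P (brL a b)"
    and add: "\<And>x y. P x \<Longrightarrow> P y \<Longrightarrow> P (x + y)"
  shows "P x"
  using Lg_0_spanned[OF x]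
proof (induction rule: span_induct_alt)
  case (step k y z)
  then obtain a b \<xi> \<mu> where y: "y = brL a b" and \<xi>: "\<xi> \<in> S - {0}"
    and ab: "a \<in> Lg \<xi> \<mu>" "b \<in> Lg (- \<xi>) (\<kappa> - \<mu>)"
    by blast
  have "sL k a \<in> Lg \<xi> \<mu>" using subspace_scale[OF Lg_subspace ab(1)] lattice_S \<xi> by blast
  then have "P (brL (sL k a) b)" using br \<xi> ab(2) by blast
  then show ?case using step add by (simp add: y br_scale_left)
qed (rule zero)

end

text \<open>The part of the data that concerns \<open>L\<close> and its form. It determines the Cartan subspace, the
  centroid and the centroidal derivations.\<close>

locale invariant_predivision_algebra = predivision_graded_lie_algebra sY S co sL brL Lg
  for sY :: "'k::field_char_0 \<Rightarrow> 'y::ab_group_add \<Rightarrow> 'y"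
    and S :: "'y set" and co :: "'y \<Rightarrow> 'y \<Rightarrow> 'k"
    and sL :: "'k \<Rightarrow> 'l::ab_group_add \<Rightarrow> 'l"
      and brL :: "'l \<Rightarrow> 'l \<Rightarrow> 'l"
    and Lg :: "'y \<Rightarrow> 'g::ab_group_add \<Rightarrow> 'l set" +
  fixes BL :: "'l \<Rightarrow> 'l \<Rightarrow> 'k"
  assumes graded_form: "graded_invariant_form sY S co sL brL Lg BL"
    and root_parts_nonzero: "\<And>\<xi>. \<xi> \<in> S \<Longrightarrow> root_part sL Lg \<xi> \<noteq> {0}"
begin

lemma invariant: "invariant_form sL UNIV brL BL"
  using graded_form by (simp add: graded_invariant_form_def)

lemma form_add_left: "BL (x + y) z = BL x z + BL y z"
  and form_add_right: "BL z (x + y) = BL z x + BL z y"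
  and form_scale_left: "BL (sL k x) y = k * BL x y"
  and form_scale_right: "BL x (sL k y) = k * BL x y"
  and form_sym: "BL x y = BL y x"
  and form_invariant: "BL (brL x y) z = BL x (brL y z)"
  using invariant by (auto simp: invariant_form_def bilinear_on_def)

lemma form_zero_left: "BL 0 x = 0" and form_zero_right: "BL x 0 = 0"
  using form_scale_left[of 0 0 x] form_scale_right[of x 0 0] by auto

lemma form_minus_left: "BL (- x) y = - BL x y" and form_minus_right: "BL x (- y) = - BL x y"
  using form_scale_left[of "-1" x y] form_scale_right[of x "-1" y] by auto

lemma form_diff_left: "BL (x - y) z = BL x z - BL y z" and form_diff_right: "BL z (x - y) = BL z x - BL z y"
  using form_add_left[of x "-y" z] form_add_right[of z x "-y"]
    by (auto simp: form_minus_left form_minus_right)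

lemma form_nondegenerate: "(\<And>y. BL x y = 0) \<Longrightarrow> x = 0"
  using invariant by (auto simp: invariant_form_def nondegenerate_on_def)

lemma invertible_exists:
  assumes "\<xi> \<in> S - {0}"
  obtains \<nu> e f where "invertible_with S co sL brL Lg \<xi> \<nu> e f"
proof -
  have "\<exists>\<nu>. Lg \<xi> \<nu> \<noteq> {0}"
  proof (rule ccontr)
    assume "\<nexists>\<nu>. Lg \<xi> \<nu> \<noteq> {0}"
    then have "root_part sL Lg \<xi> = span {0}" by (simp add: root_part_def)
    then show False using root_parts_nonzero[of \<xi>] assms by simp
  qed
  then show ?thesis using predivision[OF assms] that by blast
qed

lemma nonzero_root_exists: "\<exists>\<xi>. \<xi> \<in> S - {0}"
proof (rule ccontr)
  assume "\<nexists>\<xi>. \<xi> \<in> S - {0}"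
  then have "{brL x y | x y \<alpha>. \<alpha> \<in> S - {0} \<and> x \<in> root_part sL Lg \<alpha> \<and> y \<in> root_part sL Lg (- \<alpha>)} = {}"
    by blast
  then have "root_part sL Lg 0 = span {}" unfolding RG3 by (simp only:)
  then show False using root_parts_nonzero[of 0] root_system.zero_in by simp
qed

text \<open>The algebra \<open>L\<close> is perfect: on \<open>L\<^sub>\<xi>\<close> with \<open>\<xi> \<noteq> 0\<close> some element acts as multiplication by 2, and \<open>L\<^sub>0\<close> is
  spanned by brackets.\<close>

lemma perfect_induct [case_names zero bracket add]:
  assumes "P 0" "\<And>a b. P (brL a b)" and add: "\<And>x y. P x \<Longrightarrow> P y \<Longrightarrow> P (x + y)"
  shows "P x"
proof (induction x rule: L_induct)
  case (homogeneous q \<nu> x)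
  show ?case
  proof (cases "q = 0")
    case True
    then have "x \<in> root_part sL Lg 0" using homogeneous Lg_root_part by auto
    then show ?thesis unfolding RG3
    proof (induction rule: span_induct_alt)
      case (step c y z)
      then obtain a b where "y = brL a b" by auto
      then have "sL c y = brL (sL c a) b" by (simp add: br_scale_left)
      then show ?case using step assms by metis
    qed (use assms in auto)
  next
    case False
    then obtain \<mu> e f where inv: "invertible_with S co sL brL Lg q \<mu> e f"
      using invertible_exists[of q] homogeneous by auto
    have "brL (brL f e) x = sL 2 x"
      using invertible_acts[OF inv lattice_S] homogeneous False root_system.coroot_two by simp
    then have "x = brL (sL (1/2) (brL f e)) x" by (simp add: br_scale_left)
    then show ?thesis using assms(2) by metis
  qed
qed (use assms in auto)

text \<open>By invariance a central element is orthogonal to all brackets, and these span \<open>L\<close>.\<close>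

lemma centre_trivial:
  assumes "\<And>y. brL z y = 0" shows "z = 0"
proof (rule form_nondegenerate)
  fix y show "BL z y = 0"
  proof (induction y rule: perfect_induct)
    case (bracket a b)
    show ?case using form_invariant[of z a b] assms form_zero_left by simp
  qed (auto simp: form_zero_right form_add_right)
qed

lemma same_action_eq:
  assumes "\<And>q \<nu> x. q \<in> S \<Longrightarrow> x \<in> Lg q \<nu> \<Longrightarrow> brL a x = brL b x"
  shows "a = b"
proof -
  have "brL a x = brL b x" for x
    by (induction x rule: L_induct) (auto simp: assms br_zero_right br_add_right)
  then have "brL (a - b) y = 0" for y
    using br_add_left[of a "-b" y] br_minus_left[of b y] by simp
  then show ?thesis using centre_trivial by force
qed

text \<open>The element of \<open>L\<close> through which the coroot of \<open>\<alpha>\<close> acts. As \<open>L\<close> has trivial centre it does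
  not depend on the degree of an invertible pair that produces it.\<close>

definition coroot_element :: "'y \<Rightarrow> 'l" where
  "coroot_element \<alpha> = (THE h. \<forall>q\<in>S. \<forall>\<nu>. \<forall>x\<in>Lg q \<nu>. brL h x = sL (co \<alpha> q) x)"

lemma coroot_elementI:
  assumes "\<And>q \<nu> x. q \<in> S \<Longrightarrow> x \<in> Lg q \<nu> \<Longrightarrow> brL h x = sL (co \<alpha> q) x"
  shows "coroot_element \<alpha> = h"
  unfolding coroot_element_def
proof (rule the_equality)
  fix h' assume "\<forall>q\<in>S. \<forall>\<nu>. \<forall>x\<in>Lg q \<nu>. brL h' x = sL (co \<alpha> q) x"
  then show "h' = h" by (simp add: assms same_action_eq[of h' h])
qed (use assms in blast)

lemma invertible_coroot_element:
  assumes "invertible_with S co sL brL Lg \<xi> \<nu> e f"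
  shows "brL f e = coroot_element \<xi>"
  by (rule coroot_elementI[symmetric]) (rule invertible_acts[OF assms lattice_S])

lemma coroot_element_acts:
  assumes "\<xi> \<in> S - {0}" "q \<in> group_closure S" "x \<in> Lg q \<nu>"
  shows "brL (coroot_element \<xi>) x = sL (co \<xi> q) x"
proof -
  obtain \<nu> e f where inv: "invertible_with S co sL brL Lg \<xi> \<nu> e f"
    by (rule invertible_exists[OF assms(1)])
  show ?thesis using invertible_acts[OF inv assms(2,3)] invertible_coroot_element[OF inv] by simp
qed

lemma coroot_element_degree:
  assumes "\<xi> \<in> S - {0}" shows "coroot_element \<xi> \<in> Lg 0 0"
proof -
  obtain \<nu> e f where inv: "invertible_with S co sL brL Lg \<xi> \<nu> e f"
    by (rule invertible_exists[OF assms])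
  then have "brL f e \<in> Lg (- \<xi> + \<xi>) (- \<nu> + \<nu>)"
    using assms lattice_S[of \<xi>] by (intro grading_bracket) (auto simp: invertible_with_def)
  then show ?thesis using invertible_coroot_element[OF inv] by simp
qed

definition cartan_subspace :: "'l set" where
  "cartan_subspace = span (coroot_element ` indivisible sY S)"

text \<open>For divisible \<open>\<xi>\<close> the coroot is half the coroot of \<open>\<xi>/2\<close>, and the elements of \<open>L\<close> are determined by
  their action.\<close>

lemma coroot_element_cartan: assumes "\<xi> \<in> S - {0}" shows "coroot_element \<xi> \<in> cartan_subspace"
  using assms
proof (cases rule: root_system.divisible_cases)
  case 1
  then show ?thesis by (auto simp: cartan_subspace_def intro: span_base)
next
  case 2
  let ?\<gamma> = "sY (1/2) \<xi>"
  have "coroot_element \<xi> = sL (1/2) (coroot_element ?\<gamma>)"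
  proof (rule coroot_elementI)
    fix q \<nu> x assume "q \<in> S" "x \<in> Lg q \<nu>"
    then show "brL (sL (1/2) (coroot_element ?\<gamma>)) x = sL (co \<xi> q) x"
      using coroot_element_acts[of ?\<gamma> q x \<nu>] root_system.indivisible_in[OF 2(1)] lattice_S 2(2)
      by (simp add: br_scale_left)
  qed
  then show ?thesis using 2 by (auto simp: cartan_subspace_def intro: span_scale span_base)
qed

lemma cartan_subspace_degree: "cartan_subspace \<subseteq> Lg 0 0"
  unfolding cartan_subspace_def
  by (rule span_minimal) (use coroot_element_degree root_system.indivisible_in Lg_subspace in auto)

text \<open>The hypothesis on the form speaks about some choice of invertible pairs. As coroot elements are
  unique, every choice spans the same subspace.\<close>

lemma cartan_nondegenerate: "nondegenerate_on cartan_subspace BL"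
proof -
  obtain e f where inv: "\<And>\<alpha>. \<alpha> \<in> indivisible sY S \<Longrightarrow> invertible_with S co sL brL Lg \<alpha> 0 (e \<alpha>) (f \<alpha>)"
    and nd: "nondegenerate_on (span {brL (e \<alpha>) (f \<alpha>) | \<alpha>. \<alpha> \<in> indivisible sY S}) BL" (is "nondegenerate_on (span ?B) BL")
    using graded_form unfolding graded_invariant_form_def by blast
  have eq: "brL (e \<alpha>) (f \<alpha>) = - coroot_element \<alpha>" if "\<alpha> \<in> indivisible sY S" for \<alpha>
    using invertible_coroot_element[OF inv[OF that]] br_skew[of "e \<alpha>" "f \<alpha>"] by simp
  have "span ?B \<subseteq> cartan_subspace" unfolding cartan_subspace_def
    by (rule span_minimal) (auto simp: eq intro!: span_neg span_base[OF imageI])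
  moreover have "cartan_subspace \<subseteq> span ?B" unfolding cartan_subspace_def
  proof (rule span_minimal)
    show "coroot_element ` indivisible sY S \<subseteq> span ?B"
    proof
      fix x assume "x \<in> coroot_element ` indivisible sY S"
      then obtain \<alpha> where "\<alpha> \<in> indivisible sY S" "x = - brL (e \<alpha>) (f \<alpha>)"
        using eq by auto
      then show "x \<in> span ?B" by (auto intro!: span_neg intro: span_base)
    qed
  qed simp
  ultimately show ?thesis using nd by simp
qed

text \<open>Existence passes from the coroots to linear combinations of coroot elements. Uniqueness holds
  because \<open>S\<close> spans the space and all \<open>L\<^sub>\<xi>\<close> with \<open>\<xi> \<in> S\<close> are nonzero.\<close>

lemma cartan_weight_exists:
  assumes "x \<in> cartan_subspace"
  shows "\<exists>!w. Vector_Spaces.linear sY (*) w \<and>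
    (\<forall>q\<in>group_closure S. \<forall>\<nu>. \<forall>y\<in>Lg q \<nu>. brL x y = sL (w q) y)"
proof (rule ex_ex1I)
  show "\<exists>w. Vector_Spaces.linear sY (*) w \<and> (\<forall>q\<in>group_closure S. \<forall>\<nu>. \<forall>y\<in>Lg q \<nu>. brL x y = sL (w q) y)"
    using assms unfolding cartan_subspace_def
  proof (induction rule: span_induct_alt)
    case base
    have "Vector_Spaces.linear sY (*) (\<lambda>_. 0)"
      using root_system.vector_space_axioms
      by (auto simp: Vector_Spaces.linear_iff vector_space_def algebra_simps)
    then show ?case by (intro exI[of _ "\<lambda>_. 0"]) (auto simp: br_zero_left)
  next
    case (step c x y)
    then obtain \<alpha> w where \<alpha>: "\<alpha> \<in> S - {0}" "x = coroot_element \<alpha>"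
      and w: "Vector_Spaces.linear sY (*) w"
      "\<forall>q\<in>group_closure S. \<forall>\<nu>. \<forall>z\<in>Lg q \<nu>. brL y z = sL (w q) z"
      using root_system.indivisible_in by blast
    have "Vector_Spaces.linear sY (*) (\<lambda>q. c * co \<alpha> q + w q)"
      using w(1) root_system.coroot_linear[OF \<alpha>(1)]
        by (auto simp: Vector_Spaces.linear_iff algebra_simps)
    moreover have "brL (sL c x + y) z = sL (c * co \<alpha> q + w q) z"
      if "q \<in> group_closure S" "z \<in> Lg q \<nu>" for q \<nu> z
      using that w coroot_element_acts[OF \<alpha>(1) that] \<alpha>
      by (simp add: br_add_left br_scale_left scale_left_distrib)
    ultimately show ?case by blast
  qed
next
  fix w w'
  assume w: "Vector_Spaces.linear sY (*) w \<and> (\<forall>q\<in>group_closure S. \<forall>\<nu>. \<forall>y\<in>Lg q \<nu>. brL x y = sL (w q) y)"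
    and w': "Vector_Spaces.linear sY (*) w' \<and> (\<forall>q\<in>group_closure S. \<forall>\<nu>. \<forall>y\<in>Lg q \<nu>. brL x y = sL (w' q) y)"
  have on_S: "w q = w' q" if "q \<in> S" for q
  proof (cases "q = 0")
    case True
    have "v 0 = 0" if "Vector_Spaces.linear sY (*) v" for v
    proof -
      have "v (0 + 0) = v 0 + v 0" using that unfolding Vector_Spaces.linear_iff by blast
      then show ?thesis by simp
    qed
    then show ?thesis using w w' True by metis
  next
    case False
    then have "q \<in> S - {0}" using \<open>q \<in> S\<close> by simp
    then obtain \<nu> e f where "invertible_with S co sL brL Lg q \<nu> e f" by (rule invertible_exists)
    then have "e \<in> Lg q \<nu>" "e \<noteq> 0" by (auto simp: invertible_with_def)
    moreover from this have "sL (w q) e = sL (w' q) e" using w w' lattice_S[OF \<open>q \<in> S\<close>]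
      by metis
    ultimately show ?thesis by simp
  qed
  show "w = w'"
  proof
    fix y have "y \<in> root_system.span S" using root_system.spanning by simp
    then show "w y = w' y"
    proof (induction rule: root_system.span_induct_alt)
      case base
      show ?case using on_S root_system.zero_in by blast
    next
      case (step c y z)
      then show ?case using w w' on_S by (simp add: Vector_Spaces.linear_iff)
    qed
  qed
qed

definition cartan_weight :: "'l \<Rightarrow> 'y \<Rightarrow> 'k" where
  "cartan_weight x = (THE w. Vector_Spaces.linear sY (*) w \<and>
    (\<forall>q\<in>group_closure S. \<forall>\<nu>. \<forall>y\<in>Lg q \<nu>. brL x y = sL (w q) y))"

lemma cartan_weight_linear: "x \<in> cartan_subspace \<Longrightarrow> Vector_Spaces.linear sY (*) (cartan_weight x)"
  and cartan_acts: "x \<in> cartan_subspace \<Longrightarrow> q \<in> group_closure S \<Longrightarrow> y \<in> Lg q \<nu> \<Longrightarrow>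
    brL x y = sL (cartan_weight x q) y"
  using theI'[OF cartan_weight_exists, of x] by (auto simp: cartan_weight_def)

lemma cartan_weightI:
  assumes "x \<in> cartan_subspace" "Vector_Spaces.linear sY (*) w"
    "\<And>q \<nu> y. q \<in> group_closure S \<Longrightarrow> y \<in> Lg q \<nu> \<Longrightarrow> brL x y = sL (w q) y"
  shows "cartan_weight x = w"
  unfolding cartan_weight_def by (rule the1_equality[OF cartan_weight_exists]) (use assms in auto)

lemma cartan_weight_coroot_element: "\<xi> \<in> S - {0} \<Longrightarrow> cartan_weight (coroot_element \<xi>) = co \<xi>"
  by (intro cartan_weightI)
    (auto simp: coroot_element_cartan root_system.coroot_linear coroot_element_acts)

lemma cartan_weight_add_root: "x \<in> cartan_subspace \<Longrightarrow> cartan_weight x (p + q) = cartan_weight x p + cartan_weight x q"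
  using cartan_weight_linear by (auto simp: Vector_Spaces.linear_iff)

lemma cartan_weight_zero_root: "x \<in> cartan_subspace \<Longrightarrow> cartan_weight x 0 = 0"
  using cartan_weight_add_root[of x 0 0] by simp

lemma cartan_weight_minus_root: "x \<in> cartan_subspace \<Longrightarrow> cartan_weight x (- q) = - cartan_weight x q"
  using cartan_weight_add_root[of x q "-q"]
    by (simp add: cartan_weight_zero_root eq_neg_iff_add_eq_0 add.commute)

lemma cartan_subspace_subspace: "subspace cartan_subspace"
  by (simp add: cartan_subspace_def)

lemma cartan_weight_add:
  assumes "x \<in> cartan_subspace" "y \<in> cartan_subspace"
  shows "cartan_weight (x + y) q = cartan_weight x q + cartan_weight y q"
proof -
  have "cartan_weight (x + y) = (\<lambda>q. cartan_weight x q + cartan_weight y q)"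
    using assms cartan_weight_linear[of x] cartan_weight_linear[of y] cartan_subspace_subspace
    by (intro cartan_weightI)
      (auto simp: subspace_add Vector_Spaces.linear_iff algebra_simps br_add_left
          cartan_acts[OF assms(1)] cartan_acts[OF assms(2)] scale_left_distrib)
  then show ?thesis by simp
qed

lemma cartan_weight_scale:
  assumes "x \<in> cartan_subspace" shows "cartan_weight (sL k x) q = k * cartan_weight x q"
proof -
  have "cartan_weight (sL k x) = (\<lambda>q. k * cartan_weight x q)"
    using assms cartan_weight_linear[of x] cartan_subspace_subspace
    by (intro cartan_weightI)
      (auto simp: subspace_scale Vector_Spaces.linear_iff algebra_simps br_scale_left cartan_acts[OF assms])
  then show ?thesis by simp
qed

text \<open>Hence the grading of \<open>L\<close> by the root lattice can be recovered from the action of the Cartan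
  subspace.\<close>

lemma cartan_separates:
  assumes "q \<in> group_closure S" "\<And>x. x \<in> cartan_subspace \<Longrightarrow> cartan_weight x q = 0"
  shows "q = 0"
proof (rule root_system.coroots_separate[OF assms(1)])
  fix \<alpha> assume "\<alpha> \<in> indivisible sY S"
  then have "\<alpha> \<in> S - {0}" by (rule root_system.indivisible_in)
  then show "co \<alpha> q = 0"
    using assms(2)[OF coroot_element_cartan] cartan_weight_coroot_element by auto
qed

lemma in_Lg_if_cartan_eigenvector:
  assumes q: "q \<in> group_closure S" and x: "x \<in> degree_part S sL Lg \<nu>"
    and eigen: "\<And>h. h \<in> cartan_subspace \<Longrightarrow> brL h x = sL (cartan_weight h q) x"
  shows "x \<in> Lg q \<nu>"
proof (rule in_LgI[OF q])
  fix p \<mu> assume p: "p \<in> group_closure S" "(p, \<mu>) \<noteq> (q, \<nu>)"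
  show "bigrading.pr (p, \<mu>) x = 0"
  proof (cases "\<mu> = \<nu>")
    case True
    then have "p - q \<noteq> 0" using p by auto
    moreover have "p - q \<in> group_closure S" using p q group_closure.diff by blast
    ultimately obtain h where h: "h \<in> cartan_subspace" "cartan_weight h (p - q) \<noteq> 0"
      using cartan_separates by blast
    have "cartan_weight h p \<noteq> cartan_weight h q"
      using h cartan_weight_add_root[OF h(1), of "p - q" q] by auto
    moreover have "bigrading.pr (p, \<mu>) (brL h x) = sL (cartan_weight h (fst (p, \<mu>))) (bigrading.pr (p, \<mu>) x)"
      by (rule conjunct2[OF bigrading.pr_eigenoperator[where A="brL h" and w="\<lambda>i. cartan_weight h (fst i)"]])
        (use p h in \<open>auto simp: br_add_right br_zero_right cartan_acts\<close>)
    ultimately show ?thesis using eigen[OF h(1)] bigrading.pr_scale[of x] by simp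
  next
    case False
    then show ?thesis using degree_part_pr x by auto
  qed
qed

lemma form_degree_orthogonal:
  "\<nu> + \<mu> \<noteq> 0 \<Longrightarrow> x \<in> degree_part S sL Lg \<nu> \<Longrightarrow> y \<in> degree_part S sL Lg \<mu> \<Longrightarrow> BL x y = 0"
  using graded_form unfolding graded_invariant_form_def by blast

text \<open>The Cartan subspace acts by skew operators, so paired elements have opposite weights.\<close>

lemma form_graded:
  assumes "p \<in> group_closure S" "q \<in> group_closure S" "x \<in> Lg p \<nu>" "y \<in> Lg q \<mu>" "BL x y \<noteq> 0"
  shows "q = - p" "\<mu> = - \<nu>"
proof -
  have "\<nu> + \<mu> = 0"
    using form_degree_orthogonal Lg_degree_part[OF assms(1,3)] Lg_degree_part[OF assms(2,4)] assms(5) by blast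
  then show "\<mu> = - \<nu>" by (simp add: eq_neg_iff_add_eq_0 add.commute)
  have "p + q = 0"
  proof (rule cartan_separates)
    fix h assume h: "h \<in> cartan_subspace"
    have "BL (brL x h) y = BL x (brL h y)" by (rule form_invariant)
    then have "- cartan_weight h p * BL x y = cartan_weight h q * BL x y"
      using br_skew[of x h] cartan_acts[OF h assms(1,3)] cartan_acts[OF h assms(2,4)]
      by (simp add: form_scale_left form_scale_right form_minus_left)
    then have "cartan_weight h q * BL x y = - (cartan_weight h p * BL x y)" by simp
    then have "cartan_weight h (p + q) * BL x y = 0"
      using cartan_weight_add_root[OF h] by (simp add: distrib_right)
    then show "cartan_weight h (p + q) = 0" using assms(5) by simp
  qed (use assms group_closure_add in auto)
  then show "q = - p" by (simp add: eq_neg_iff_add_eq_0 add.commute)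
qed

lemma graded_partner:
  assumes q: "q \<in> group_closure S" and x: "x \<in> Lg q \<nu>" "x \<noteq> 0"
  obtains y where "y \<in> Lg (- q) (- \<nu>)" "BL x y \<noteq> 0"
proof -
  have "\<exists>y\<in>Lg (- q) (- \<nu>). BL x y \<noteq> 0"
  proof (rule ccontr)
    assume no: "\<not> ?thesis"
    have "BL x y = 0" for y
    proof (induction y rule: L_induct)
      case (homogeneous p \<mu> y)
      show ?case
      proof (rule ccontr)
        assume "BL x y \<noteq> 0"
        then show False using form_graded[OF q lattice_S x(1)] homogeneous no by blast
      qed
    qed (auto simp: form_zero_right form_add_right)
    then show False using x form_nondegenerate by blast
  qed
  then show ?thesis using that by blast
qed

lemma form_coroot_element:
  assumes "\<xi> \<in> S - {0}" "invertible_with S co sL brL Lg \<xi> \<nu> e f" "h \<in> cartan_subspace"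
  shows "BL (coroot_element \<xi>) h = - (cartan_weight h \<xi> * BL e f)"
proof -
  have e: "e \<in> Lg \<xi> \<nu>" using assms by (auto simp: invertible_with_def)
  have "BL (brL f e) h = BL f (brL e h)" by (rule form_invariant)
  also have "\<dots> = BL f (- (brL h e))" using br_skew[of e h] by simp
  also have "\<dots> = - (cartan_weight h \<xi> * BL f e)"
    using cartan_acts[OF assms(3) lattice_S e] assms by (simp add: form_minus_right form_scale_right)
  finally show ?thesis using invertible_coroot_element[OF assms(2)] form_sym[of e f] by simp
qed

text \<open>Otherwise the coroot element would lie in the radical of the form on the Cartan subspace.\<close>

lemma invertible_pair_form_nonzero:
  assumes "\<xi> \<in> S - {0}" "invertible_with S co sL brL Lg \<xi> \<nu> e f"
  shows "BL e f \<noteq> 0"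
proof
  assume "BL e f = 0"
  then have "\<forall>h\<in>cartan_subspace. BL (coroot_element \<xi>) h = 0"
    using form_coroot_element[OF assms] by simp
  then have "coroot_element \<xi> = 0"
    using cartan_nondegenerate coroot_element_cartan[OF assms(1)] by (auto simp: nondegenerate_on_def)
  moreover have "brL (coroot_element \<xi>) e = sL 2 e"
    using coroot_element_acts[OF assms(1) lattice_S] assms root_system.coroot_two
      by (auto simp: invertible_with_def)
  ultimately show False using assms(2) br_zero_left by (auto simp: invertible_with_def)
qed

end

section \<open>The centroid and centroidal derivations\<close>

lemma vector_space_fun_scale:
  assumes "vector_space s" shows "vector_space (fun_scale s)"
proof -
  interpret vector_space s by fact
  show ?thesis by unfold_locales (auto simp: fun_scale_def fun_eq_iff scale_right_distrib scale_left_distrib)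
qed

context invariant_predivision_algebra begin

abbreviation Cent where "Cent \<equiv> centroid_part S sL brL Lg"

abbreviation Ldeg where "Ldeg \<equiv> degree_part S sL Lg"

lemma centroid_add: "\<chi> \<in> Cent \<nu> \<Longrightarrow> \<chi> (x + y) = \<chi> x + \<chi> y"
  and centroid_scale: "\<chi> \<in> Cent \<nu> \<Longrightarrow> \<chi> (sL k x) = sL k (\<chi> x)"
  and centroid_bracket_right: "\<chi> \<in> Cent \<nu> \<Longrightarrow> \<chi> (brL x y) = brL x (\<chi> y)"
  by (auto simp: centroid_part_def Vector_Spaces.linear_iff)

lemma centroid_degree: assumes "\<chi> \<in> Cent \<nu>" "x \<in> Ldeg \<mu>"
  shows "\<chi> x \<in> Ldeg (\<nu> + \<mu>)"
proof -
  have "\<chi> ` Ldeg \<mu> \<subseteq> Ldeg (\<nu> + \<mu>)" using assms(1) by (simp add: centroid_part_def)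
  then show ?thesis using assms(2) by (rule subsetD[OF _ imageI])
qed

lemma centroid_zero: "\<chi> \<in> Cent \<nu> \<Longrightarrow> \<chi> 0 = 0"
  using centroid_scale[of \<chi> \<nu> 0 0] by simp

lemma centroid_minus: "\<chi> \<in> Cent \<nu> \<Longrightarrow> \<chi> (- x) = - \<chi> x"
  using centroid_scale[of \<chi> \<nu> "-1" x] by simp

lemma centroid_bracket_left: assumes "\<chi> \<in> Cent \<nu>" shows "\<chi> (brL x y) = brL (\<chi> x) y"
  using centroid_bracket_right[OF assms, of y x] centroid_minus[OF assms, of "brL y x"]
    br_skew[of x y] br_skew[of "\<chi> x" y] by simp

text \<open>As \<open>L\<close> is perfect, \<open>y\<close> may be taken to be \<open>[a, b]\<close>. Then
  \<open>(\<chi> x | [a, b]) = (\<chi> [x, a] | b) = ([x, \<chi> a] | b) = (x | \<chi> [a, b])\<close>.\<close>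

lemma centroid_symmetric: assumes "\<chi> \<in> Cent \<nu>" shows "BL (\<chi> x) y = BL x (\<chi> y)"
proof (induction y rule: perfect_induct)
  case (bracket a b)
  have "BL (\<chi> x) (brL a b) = BL (\<chi> (brL x a)) b"
    using centroid_bracket_left[OF assms] form_invariant by simp
  also have "\<dots> = BL x (\<chi> (brL a b))"
    using centroid_bracket_right[OF assms] centroid_bracket_left[OF assms] form_invariant by metis
  finally show ?case .
qed (auto simp: form_zero_right form_add_right centroid_zero[OF assms] centroid_add[OF assms])

text \<open>On a bracket, one of the two maps can be moved to the left factor and the other to the right one.\<close>

lemma centroid_commute: assumes "\<chi> \<in> Cent \<nu>" "\<psi> \<in> Cent \<mu>"
  shows "\<chi> (\<psi> x) = \<psi> (\<chi> x)"
proof (induction x rule: perfect_induct)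
  case (bracket a b)
  show ?case
    using centroid_bracket_right[OF assms(2)] centroid_bracket_left[OF assms(1)] by metis
qed (simp_all add: centroid_zero[OF assms(1)] centroid_zero[OF assms(2)]
    centroid_add[OF assms(1)] centroid_add[OF assms(2)])

lemma centroid_homogeneous:
  assumes "\<chi> \<in> Cent \<nu>" "q \<in> group_closure S" "x \<in> Lg q \<mu>"
    shows "\<chi> x \<in> Lg q (\<nu> + \<mu>)"
proof (rule in_Lg_if_cartan_eigenvector)
  fix h assume "h \<in> cartan_subspace"
  then show "brL h (\<chi> x) = sL (cartan_weight h q) (\<chi> x)"
    using centroid_bracket_right[OF assms(1), of h x] centroid_scale[OF assms(1)] cartan_acts assms by simp
qed (use assms centroid_degree Lg_degree_part in auto)

text \<open>An element of the centroid that vanishes on all \<open>L\<^sub>\<xi>\<close> with \<open>\<xi> \<noteq> 0\<close> also vanishes on their brackets, hence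
  is zero. So \<open>\<chi> x \<noteq> 0\<close> for some \<open>x \<in> L\<^sub>\<xi>\<close> with \<open>\<xi> \<noteq> 0\<close>, and for the coroot element \<open>h\<close> of \<open>\<xi>\<close> the equation
  \<open>[\<chi> h, x] = \<chi> [h, x] = 2 \<chi> x\<close> shows that \<open>\<chi> h\<close> is a nonzero element of \<open>L\<^sub>0\<^sup>\<nu>\<close>.\<close>

lemma centroid_nonzero_degree:
  assumes \<chi>: "\<chi> \<in> Cent \<nu>" and "\<chi> x \<noteq> 0"
  shows "Lg 0 \<nu> \<noteq> {0}"
proof -
  have "\<exists>\<xi>\<in>S - {0}. \<exists>\<mu>. \<exists>x\<in>Lg \<xi> \<mu>. \<chi> x \<noteq> 0"
  proof (rule ccontr)
    assume no: "\<not> ?thesis"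
    have "\<chi> x = 0" for x
    proof (induction x rule: L_induct)
      case (homogeneous q \<mu> x)
      show ?case
      proof (cases "q = 0")
        case True
        then have "x \<in> Lg 0 \<mu>" using homogeneous by simp
        then show ?thesis
        proof (induction rule: Lg_0_induct)
          case (bracket \<xi> \<mu>' a b)
          then have "\<chi> a = 0" using no by blast
          then show ?case using centroid_bracket_left[OF \<chi>] br_zero_left by simp
        qed (use centroid_zero[OF \<chi>] centroid_add[OF \<chi>] in auto)
      qed (use no homogeneous in blast)
    qed (auto simp: centroid_zero[OF \<chi>] centroid_add[OF \<chi>])
    then show False using assms by simp
  qed
  then obtain \<xi> \<mu> x where \<xi>: "\<xi> \<in> S - {0}"
    and x: "x \<in> Lg \<xi> \<mu>" "\<chi> x \<noteq> 0" by blast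
  let ?h = "coroot_element \<xi>"
  have "brL (\<chi> ?h) x = \<chi> (brL ?h x)" using centroid_bracket_left[OF \<chi>] by simp
  also have "\<dots> = sL 2 (\<chi> x)"
    using coroot_element_acts[OF \<xi> lattice_S x(1)] \<xi> centroid_scale[OF \<chi>] root_system.coroot_two
      by simp
  finally have "\<chi> ?h \<noteq> 0" using x br_zero_left by auto
  moreover have "\<chi> ?h \<in> Lg 0 \<nu>"
    using centroid_homogeneous[OF \<chi> _ coroot_element_degree[OF \<xi>]] by simp
  ultimately show ?thesis by auto
qed

lemma degree_induct [case_names zero homogeneous add]:
  assumes "P 0" "\<And>\<nu> x. x \<in> Ldeg \<nu> \<Longrightarrow> P x" "\<And>x y. P x \<Longrightarrow> P y \<Longrightarrow> P (x + y)" shows "P x"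
  by (rule degree.graded_induct[of x P]) (use assms in auto)

lemma centroidal_derivation_homogeneous:
  assumes "\<theta> \<nu> 0 = 0" "x \<in> Ldeg \<nu>"
  shows "centroidal_derivation S sL Lg \<theta> x = \<theta> \<nu> x"
proof -
  have pr: "degree.pr \<mu> x = (if \<mu> = \<nu> then x else 0)" for \<mu>
    using degree.pr_homogeneous[of \<nu> x \<mu>] assms by simp
  then have "{\<mu>. degree.pr \<mu> x \<noteq> 0} = (if x = 0 then {} else {\<nu>})" by auto
  then show ?thesis using assms pr unfolding centroidal_derivation_def by simp
qed

lemma centroidal_derivation_linear:
  assumes "\<And>\<mu>. Vector_Spaces.linear sL sL (\<theta> \<mu>)"
  shows "Vector_Spaces.linear sL sL (centroidal_derivation S sL Lg \<theta>)"
proof -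
  have add: "\<theta> \<mu> (x + y) = \<theta> \<mu> x + \<theta> \<mu> y"
    and scale: "\<theta> \<mu> (sL k x) = sL k (\<theta> \<mu> x)" for \<mu> k x y
    using assms by (auto simp: Vector_Spaces.linear_iff)
  have zero: "\<theta> \<mu> 0 = 0" for \<mu> using scale[of \<mu> 0 0] by simp
  have sup: "centroidal_derivation S sL Lg \<theta> x = (\<Sum>\<mu>\<in>F. \<theta> \<mu> (degree.pr \<mu> x))"
    if "finite F" "{\<mu>. degree.pr \<mu> x \<noteq> 0} \<subseteq> F" for x F
    unfolding centroidal_derivation_def
    by (rule sum.mono_neutral_left) (use that zero in auto)
  have "centroidal_derivation S sL Lg \<theta> (x + y) =
      centroidal_derivation S sL Lg \<theta> x + centroidal_derivation S sL Lg \<theta> y" for x y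
  proof -
    let ?F = "{\<mu>. degree.pr \<mu> x \<noteq> 0} \<union> {\<mu>. degree.pr \<mu> y \<noteq> 0}"
    have F: "finite ?F" using degree.pr_finite by simp
    have "{\<mu>. degree.pr \<mu> (x + y) \<noteq> 0} \<subseteq> ?F" using degree.pr_add[of x y] by auto
    then have "centroidal_derivation S sL Lg \<theta> (x + y) = (\<Sum>\<mu>\<in>?F. \<theta> \<mu> (degree.pr \<mu> (x + y)))"
      by (rule sup[OF F])
    also have "\<dots> = (\<Sum>\<mu>\<in>?F. \<theta> \<mu> (degree.pr \<mu> x)) + (\<Sum>\<mu>\<in>?F. \<theta> \<mu> (degree.pr \<mu> y))"
      by (simp add: degree.pr_add add sum.distrib)
    also have "\<dots> = centroidal_derivation S sL Lg \<theta> x + centroidal_derivation S sL Lg \<theta> y"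
      using sup[OF F, of x] sup[OF F, of y] by auto
    finally show ?thesis .
  qed
  moreover have "centroidal_derivation S sL Lg \<theta> (sL k x) = sL k (centroidal_derivation S sL Lg \<theta> x)" for k x
  proof -
    let ?F = "{\<mu>. degree.pr \<mu> x \<noteq> 0}"
    have F: "finite ?F" using degree.pr_finite by simp
    have "{\<mu>. degree.pr \<mu> (sL k x) \<noteq> 0} \<subseteq> ?F" using degree.pr_scale[of x] by auto
    then have "centroidal_derivation S sL Lg \<theta> (sL k x) = (\<Sum>\<mu>\<in>?F. \<theta> \<mu> (degree.pr \<mu> (sL k x)))"
      by (rule sup[OF F])
    also have "\<dots> = sL k (\<Sum>\<mu>\<in>?F. \<theta> \<mu> (degree.pr \<mu> x))"
      by (simp add: degree.pr_scale scale scale_sum_right)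
    also have "\<dots> = sL k (centroidal_derivation S sL Lg \<theta> x)" using sup[OF F, of x] by auto
    finally show ?thesis .
  qed
  ultimately show ?thesis using vector_space_axioms by (auto simp: Vector_Spaces.linear_iff)
qed

abbreviation SCD where "SCD \<equiv> SCDer S sL brL Lg"

lemma SCDer_exists:
  assumes "d \<in> SCD \<nu>"
  shows "\<exists>\<theta>. additive \<theta> \<and> (\<forall>\<mu>. \<theta> \<mu> \<in> Cent \<nu>) \<and> \<theta> \<nu> = 0 \<and> (\<forall>\<mu>. \<forall>x\<in>Ldeg \<mu>. d x = \<theta> \<mu> x)"
    and "Vector_Spaces.linear sL sL d"
proof -
  obtain \<theta> where \<theta>: "additive \<theta>" "range \<theta> \<subseteq> Cent \<nu>" "\<theta> \<nu> = 0" and d: "d = centroidal_derivation S sL Lg \<theta>"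
    using assms by (auto simp: SCDer_def)
  then have mem: "\<theta> \<mu> \<in> Cent \<nu>" for \<mu> by auto
  show "Vector_Spaces.linear sL sL d" unfolding d
    by (rule centroidal_derivation_linear) (use mem in \<open>auto simp: centroid_part_def\<close>)
  have "d x = \<theta> \<mu> x" if "x \<in> Ldeg \<mu>" for \<mu> x
    unfolding d by (rule centroidal_derivation_homogeneous[of \<theta> \<mu>, OF centroid_zero[OF mem] that])
  then show "\<exists>\<theta>. additive \<theta> \<and> (\<forall>\<mu>. \<theta> \<mu> \<in> Cent \<nu>) \<and> \<theta> \<nu> = 0 \<and> (\<forall>\<mu>. \<forall>x\<in>Ldeg \<mu>. d x = \<theta> \<mu> x)"
    using \<theta> mem by blast
qed

lemma SCDer_add: "d \<in> SCD \<nu> \<Longrightarrow> d (x + y) = d x + d y"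
  and SCDer_scale: "d \<in> SCD \<nu> \<Longrightarrow> d (sL k x) = sL k (d x)"
  using SCDer_exists(2)[of d \<nu>] by (auto simp: Vector_Spaces.linear_iff)

lemma SCDer_zero: "d \<in> SCD \<nu> \<Longrightarrow> d 0 = 0"
  using SCDer_scale[of d \<nu> 0 0] by simp

lemma SCDer_degree: assumes d: "d \<in> SCD \<nu>" and "x \<in> Ldeg \<mu>"
  shows "d x \<in> Ldeg (\<nu> + \<mu>)"
proof -
  obtain \<theta> where "\<theta> \<mu> \<in> Cent \<nu>" "d x = \<theta> \<mu> x"
    using SCDer_exists(1)[OF d] assms(2) by blast
  then show ?thesis using centroid_degree assms by simp
qed

lemma SCDer_degree_0: assumes d: "d \<in> SCD \<nu>" and "x \<in> Ldeg 0" shows "d x = 0"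
proof -
  obtain \<theta> where \<theta>: "additive \<theta>" "\<And>\<mu> x. x \<in> Ldeg \<mu> \<Longrightarrow> d x = \<theta> \<mu> x" using SCDer_exists(1)[OF d] by blast
  show ?thesis using \<theta>(2)[OF assms(2)] additive.zero[OF \<theta>(1)] by simp
qed

lemma bracket_degree:
  assumes "x \<in> Ldeg \<nu>" "y \<in> Ldeg \<mu>" shows "brL x y \<in> Ldeg (\<nu> + \<mu>)"
  using assms(1)
proof (induction rule: degree_part_induct)
  case (homogeneous p x)
  note x = this
  show ?case using assms(2)
  proof (induction rule: degree_part_induct)
    case (homogeneous q y)
    have "brL x y \<in> Lg (p + q) (\<nu> + \<mu>)" using x homogeneous lattice_S
      by (intro grading_bracket) auto
    then show ?case using Lg_degree_part group_closure_add lattice_S x homogeneous by metis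
  qed (auto simp: br_zero_right br_add_right degree.part_subspace subspace_0 subspace_add)
qed (auto simp: br_zero_left br_add_left degree.part_subspace subspace_0 subspace_add)

lemma SCDer_derivation:
  assumes d: "d \<in> SCD \<nu>" shows "d (brL x y) = brL (d x) y + brL x (d y)"
proof -
  obtain \<theta> where add: "additive \<theta>" and C: "\<And>\<mu>. \<theta> \<mu> \<in> Cent \<nu>"
    and \<theta>: "\<And>\<mu> x. x \<in> Ldeg \<mu> \<Longrightarrow> d x = \<theta> \<mu> x"
    using SCDer_exists(1)[OF d] by blast
  note lin = SCDer_add[OF d] SCDer_zero[OF d]
  show ?thesis
  proof (induction x rule: degree_induct)
    case (homogeneous \<mu> x)
    note x = this
    show ?case
    proof (induction y rule: degree_induct)
      case (homogeneous \<kappa> y)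
      have "d (brL x y) = \<theta> (\<mu> + \<kappa>) (brL x y)"
        using \<theta>[OF bracket_degree[OF x homogeneous]] .
      also have "\<dots> = \<theta> \<mu> (brL x y) + \<theta> \<kappa> (brL x y)" using additive.add[OF add]
        by simp
      also have "\<dots> = brL (d x) y + brL x (d y)"
        using centroid_bracket_left[OF C] centroid_bracket_right[OF C] \<theta>[OF x] \<theta>[OF homogeneous]
          by simp
      finally show ?case .
    qed (auto simp: lin br_zero_right br_add_right)
  qed (auto simp: lin br_zero_left br_add_left)
qed

text \<open>The form pairs the degrees \<open>\<nu> + \<mu>\<close> and \<open>\<kappa>\<close> only if \<open>\<kappa> = -\<nu> - \<mu>\<close>, and then \<open>\<theta>(\<kappa>) = -\<theta>(\<mu>)\<close> because
  \<open>\<theta>(\<nu>) = 0\<close>.\<close>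

lemma SCDer_skew: assumes d: "d \<in> SCD \<nu>" shows "BL (d x) y = - BL x (d y)"
proof -
  obtain \<theta> where add: "additive \<theta>" and C: "\<And>\<mu>. \<theta> \<mu> \<in> Cent \<nu>"
    and \<nu>: "\<theta> \<nu> = 0"
    and \<theta>: "\<And>\<mu> x. x \<in> Ldeg \<mu> \<Longrightarrow> d x = \<theta> \<mu> x"
      using SCDer_exists(1)[OF d] by blast
  note lin = SCDer_add[OF d] SCDer_zero[OF d]
  show ?thesis
  proof (induction x rule: degree_induct)
    case (homogeneous \<mu> x)
    note x = this
    show ?case
    proof (induction y rule: degree_induct)
      case (homogeneous \<kappa> y)
      show ?case
      proof (cases "\<nu> + \<mu> + \<kappa> = 0")
        case True
        then have "\<kappa> = - \<nu> - \<mu>" by (simp add: eq_neg_iff_add_eq_0 algebra_simps)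
        then have "\<theta> \<kappa> = - \<theta> \<mu>"
          using additive.diff[OF add] additive.minus[OF add] \<nu> by simp
        then have "BL x (d y) = - BL x (\<theta> \<mu> y)" using \<theta>[OF homogeneous]
          by (simp add: form_minus_right)
        then show ?thesis using \<theta>[OF x] centroid_symmetric[OF C] by simp
      next
        case False
        then have "BL (d x) y = 0" "BL x (d y) = 0"
          using form_degree_orthogonal[OF _ SCDer_degree[OF d x] homogeneous]
            form_degree_orthogonal[OF _ x SCDer_degree[OF d homogeneous]] by (auto simp: algebra_simps)
        then show ?thesis by simp
      qed
    qed (auto simp: lin form_zero_right form_add_right)
  qed (auto simp: lin form_zero_left form_add_left)
qed

text \<open>For \<open>\<theta>\<close> of degree \<open>\<nu>\<close> and \<open>\<psi>\<close> of degree \<open>-\<nu>\<close> the correction terms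
  \<open>\<theta>(-\<nu>)\<close> and \<open>\<psi>(\<nu>)\<close> in the commutator vanish and the centroid is commutative.\<close>

lemma SCDer_opposite_commute:
  assumes d: "d \<in> SCD \<nu>" and d': "d' \<in> SCD (- \<nu>)" shows "commutator d d' = 0"
proof -
  obtain \<theta> where add: "additive \<theta>" and C: "\<And>\<mu>. \<theta> \<mu> \<in> Cent \<nu>"
    and \<nu>: "\<theta> \<nu> = 0"
    and \<theta>: "\<And>\<mu> x. x \<in> Ldeg \<mu> \<Longrightarrow> d x = \<theta> \<mu> x"
      using SCDer_exists(1)[OF d] by blast
  obtain \<psi> where add': "additive \<psi>" and C': "\<And>\<mu>. \<psi> \<mu> \<in> Cent (- \<nu>)"
    and \<nu>': "\<psi> (- \<nu>) = 0"
    and \<psi>: "\<And>\<mu> x. x \<in> Ldeg \<mu> \<Longrightarrow> d' x = \<psi> \<mu> x"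
      using SCDer_exists(1)[OF d'] by blast
  have z: "\<theta> (- \<nu> + \<mu>) = \<theta> \<mu>" "\<psi> (\<nu> + \<mu>) = \<psi> \<mu>" for \<mu>
    using additive.add[OF add, of "- \<nu>" \<mu>] additive.minus[OF add, of \<nu>] \<nu>
      additive.add[OF add', of \<nu> \<mu>] additive.minus[OF add', of \<nu>] \<nu>' by simp_all
  have "d (d' x) = d' (d x)" for x
  proof (induction x rule: degree_induct)
    case (homogeneous \<mu> x)
    have "d (d' x) = \<theta> \<mu> (\<psi> \<mu> x)"
      using \<theta>[OF SCDer_degree[OF d' homogeneous]] \<psi>[OF homogeneous] z by simp
    also have "\<dots> = \<psi> \<mu> (\<theta> \<mu> x)" by (rule centroid_commute[OF C C'])
    also have "\<dots> = d' (d x)" using \<psi>[OF SCDer_degree[OF d homogeneous]] \<theta>[OF homogeneous] z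
      by simp
    finally show ?case .
  qed (auto simp: SCDer_add[OF d] SCDer_zero[OF d] SCDer_add[OF d'] SCDer_zero[OF d'])
  then show ?thesis by (auto simp: commutator_def)
qed

lemma SCDer_nonzero_degree:
  assumes d: "d \<in> SCD \<nu>" and "d \<noteq> 0" shows "Lg 0 \<nu> \<noteq> {0}"
proof -
  obtain \<theta> where C: "\<And>\<mu>. \<theta> \<mu> \<in> Cent \<nu>"
    and \<theta>: "\<And>\<mu> x. x \<in> Ldeg \<mu> \<Longrightarrow> d x = \<theta> \<mu> x"
      using SCDer_exists(1)[OF d] by blast
  have "\<exists>\<mu>. \<exists>x\<in>Ldeg \<mu>. d x \<noteq> 0"
  proof (rule ccontr)
    assume "\<not> ?thesis"
    then have "d x = 0" for x
      by (induction x rule: degree_induct) (auto simp: SCDer_add[OF d] SCDer_zero[OF d])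
    then show False using \<open>d \<noteq> 0\<close> by auto
  qed
  then show ?thesis using centroid_nonzero_degree[OF C] \<theta> by metis
qed

lemma degree_derivation_homogeneous: "x \<in> Ldeg \<nu> \<Longrightarrow> degree_derivation S sL Lg \<theta> x = sL (\<theta> \<nu>) x"
  unfolding degree_derivation_def by (rule centroidal_derivation_homogeneous) auto

lemma additive_determined:
  assumes "additive \<theta>" "additive \<theta>'" "\<And>\<nu>. \<nu> \<in> X \<Longrightarrow> \<theta> \<nu> = \<theta>' \<nu>" "\<nu> \<in> group_closure X"
  shows "\<theta> \<nu> = \<theta>' \<nu>"
  using assms(4)
  by induction (use assms in \<open>auto simp: additive.zero additive.diff\<close>)

end

section \<open>The derivation algebra and its graded dual\<close>

sublocale affine_extension_data \<subseteq> invariant_predivision_algebra sY S co sL brL Lg BL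
  by unfold_locales (fact L_invariant, fact full_support)

sublocale affine_extension_data \<subseteq>
  D_space: direct_sum_decomposition "fun_scale sL" D UNIV "D_part S sL brL Lg D"
  by (intro direct_sum_decomposition.intro direct_sum_decomposition_axioms.intro
      vector_space_fun_scale vector_space_axioms D_subspace D_graded)

sublocale affine_extension_data \<subseteq>
  C_space: direct_sum_decomposition "fun_scale (*)" C UNIV "C_part S sL brL Lg D C"
  by (intro direct_sum_decomposition.intro direct_sum_decomposition_axioms.intro
      vector_space_fun_scale C_subspace C_graded) (unfold_locales, auto simp: algebra_simps)

context affine_extension_data begin

abbreviation Dg where "Dg \<equiv> D_part S sL brL Lg D"
abbreviation Cg where "Cg \<equiv> C_part S sL brL Lg D C"
abbreviation contra where "contra \<equiv> contragredient D"
abbreviation sg where "sg \<equiv> sigma D BL"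
abbreviation sF where "sF \<equiv> fun_scale sL"
abbreviation sC where "sC \<equiv> fun_scale ((*) :: 'k \<Rightarrow> 'k \<Rightarrow> 'k)"

lemma Dg_SCD: "d \<in> Dg \<nu> \<Longrightarrow> d \<in> SCD \<nu>"
  and Dg_in: "d \<in> Dg \<nu> \<Longrightarrow> d \<in> D"
  by (auto simp: D_part_def)

lemma D_induct [consumes 1, case_names zero homogeneous add]:
  assumes "d \<in> D" "P 0" "\<And>\<nu> d. d \<in> Dg \<nu> \<Longrightarrow> P d"
    "\<And>d d'. d \<in> D \<Longrightarrow> d' \<in> D \<Longrightarrow> P d \<Longrightarrow> P d' \<Longrightarrow> P (d + d')"
  shows "P d"
  by (rule D_space.graded_induct[of d P]) (use assms in auto)

lemma C_induct [consumes 1, case_names zero homogeneous add]: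
  assumes "c \<in> C" "P 0" "\<And>\<nu> c. c \<in> Cg \<nu> \<Longrightarrow> P c"
    "\<And>c c'. c \<in> C \<Longrightarrow> c' \<in> C \<Longrightarrow> P c \<Longrightarrow> P c' \<Longrightarrow> P (c + c')"
  shows "P c"
  by (rule C_space.graded_induct[of c P]) (use assms in auto)

lemma D_add: "d \<in> D \<Longrightarrow> d (x + y) = d x + d y"
  by (induction rule: D_induct) (auto dest!: Dg_SCD simp: SCDer_add)

lemma D_scale: "d \<in> D \<Longrightarrow> d (sL k x) = sL k (d x)"
  by (induction rule: D_induct) (auto dest!: Dg_SCD simp: SCDer_scale scale_right_distrib)

lemma D_zero: "d \<in> D \<Longrightarrow> d 0 = 0"
  using D_scale[of d 0 0] by simp

lemma D_minus: "d \<in> D \<Longrightarrow> d (- x) = - d x"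
  using D_scale[of d "-1" x] by simp

lemma D_diff: "d \<in> D \<Longrightarrow> d (x - y) = d x - d y"
  using D_add[of d x "-y"] D_minus[of d y] by simp

lemma D_derivation: "d \<in> D \<Longrightarrow> d (brL x y) = brL (d x) y + brL x (d y)"
  by (induction rule: D_induct) (auto dest!: Dg_SCD simp: SCDer_derivation br_zero_left br_zero_right br_add_left br_add_right)

lemma D_skew: "d \<in> D \<Longrightarrow> BL (d x) y = - BL x (d y)"
  by (induction rule: D_induct) (auto dest!: Dg_SCD simp: SCDer_skew form_zero_left form_zero_right form_add_left form_add_right)

lemma D_kills_degree_0: "d \<in> D \<Longrightarrow> x \<in> Ldeg 0 \<Longrightarrow> d x = 0"
  by (induction rule: D_induct) (auto dest!: Dg_SCD simp: SCDer_degree_0)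

lemma D_zero_in: "0 \<in> D" and D_add_in: "d \<in> D \<Longrightarrow> d' \<in> D \<Longrightarrow> d + d' \<in> D"
  and D_scale_in: "d \<in> D \<Longrightarrow> sF k d \<in> D"
  using D_subspace D_space.subspace_0 D_space.subspace_add D_space.subspace_scale by auto

lemma C_zero_in: "0 \<in> C" and C_add_in: "c \<in> C \<Longrightarrow> c' \<in> C \<Longrightarrow> c + c' \<in> C"
  and C_scale_in: "c \<in> C \<Longrightarrow> sC k c \<in> C"
    and C_diff_in: "c \<in> C \<Longrightarrow> c' \<in> C \<Longrightarrow> c - c' \<in> C"
  using C_subspace C_space.subspace_0 C_space.subspace_add C_space.subspace_scale C_space.subspace_diff
    by auto

lemma C_dual: "c \<in> C \<Longrightarrow> c \<in> dual_on sF D"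
  using C_graded_dual by (auto simp: graded_dual_def)

lemma C_add: "c \<in> C \<Longrightarrow> d \<in> D \<Longrightarrow> d' \<in> D \<Longrightarrow> c (d + d') = c d + c d'"
  and C_scale: "c \<in> C \<Longrightarrow> d \<in> D \<Longrightarrow> c (sF k d) = k * c d"
  and C_outside: "c \<in> C \<Longrightarrow> d \<notin> D \<Longrightarrow> c d = 0"
  using C_dual[of c] by (auto simp: dual_on_def)

lemma C_zero: "c \<in> C \<Longrightarrow> c 0 = 0"
  using C_scale[of c 0 0] D_zero_in by (simp add: fun_scale_def zero_fun_def)

lemma C_minus: "c \<in> C \<Longrightarrow> d \<in> D \<Longrightarrow> c (- d) = - c d"
proof -
  assume "c \<in> C" "d \<in> D"
  moreover have "sF (-1) d = - d" by (simp add: fun_scale_def fun_eq_iff)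
  ultimately show ?thesis using C_scale[of c d "-1"] by simp
qed

lemma C_eqI:
  assumes "c \<in> C" "c' \<in> C" "\<And>d. d \<in> D \<Longrightarrow> c d = c' d" shows "c = c'"
proof
  fix d show "c d = c' d"
    using assms(3) C_outside[OF assms(1)] C_outside[OF assms(2)] by (cases "d \<in> D") auto
qed

lemma C_homogeneous: "c \<in> Cg \<nu> \<Longrightarrow> d \<in> Dg \<mu> \<Longrightarrow> \<mu> \<noteq> - \<nu> \<Longrightarrow> c d = 0"
  and Cg_in: "c \<in> Cg \<nu> \<Longrightarrow> c \<in> C"
  by (auto simp: C_part_def graded_dual_part_def)

lemma sigma_apply: "d \<in> D \<Longrightarrow> sg x y d = BL (d x) y"
  by (simp add: sigma_def)

lemma contra_apply: "d' \<in> D \<Longrightarrow> contra d c d' = - c (commutator d d')"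
  by (simp add: contragredient_def)

lemma sigma_add_left: "sg (x + y) z = sg x z + sg y z" and sigma_add_right: "sg z (x + y) = sg z x + sg z y"
  and sigma_scale_left: "sg (sL k x) y = sC k (sg x y)" and sigma_scale_right: "sg x (sL k y) = sC k (sg x y)"
  by (auto simp: sigma_def fun_eq_iff fun_scale_def D_add D_scale form_add_left form_add_right form_scale_left
      form_scale_right)

lemma sigma_degree_0_left: "x \<in> Ldeg 0 \<Longrightarrow> sg x y = 0"
  by (auto simp: sigma_def fun_eq_iff D_kills_degree_0 form_zero_left)

lemma sigma_skew: "sg x y = - sg y x"
proof -
  have "BL (d x) y = - BL (d y) x" if "d \<in> D" for d
    using D_skew[OF that, of x y] form_sym[of x "d y"] by simp
  then show ?thesis by (simp add: sigma_def fun_eq_iff)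
qed

lemma commutator_add_left: "d \<in> D \<Longrightarrow> d' \<in> D \<Longrightarrow> d'' \<in> D \<Longrightarrow> commutator (d + d') d'' = commutator d d'' + commutator d' d''"
  and commutator_add_right: "d \<in> D \<Longrightarrow> d' \<in> D \<Longrightarrow> d'' \<in> D \<Longrightarrow> commutator d'' (d + d') = commutator d'' d + commutator d'' d'"
  and commutator_scale_left: "d \<in> D \<Longrightarrow> d' \<in> D \<Longrightarrow> commutator (sF k d) d' = sF k (commutator d d')"
  and commutator_scale_right: "d \<in> D \<Longrightarrow> d' \<in> D \<Longrightarrow> commutator d (sF k d') = sF k (commutator d d')"
  by (auto simp: commutator_def fun_eq_iff fun_scale_def D_add D_scale scale_right_diff_distrib)

lemma commutator_skew: "commutator d' d = - commutator d d'"
  by (auto simp: commutator_def)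

lemma commutator_zero_left: "d \<in> D \<Longrightarrow> commutator 0 d = 0"
  and commutator_zero_right: "d \<in> D \<Longrightarrow> commutator d 0 = 0"
  by (auto simp: commutator_def D_zero)

lemma commutator_jacobi:
  assumes "d1 \<in> D" "d2 \<in> D" "d3 \<in> D"
  shows "commutator (commutator d1 d2) d3 = commutator d1 (commutator d2 d3) - commutator d2 (commutator d1 d3)"
  using assms by (auto simp: commutator_def fun_eq_iff D_diff)

text \<open>The components of \<open>d\<close> of other degrees shift degrees by other amounts than \<open>d\<close> does, hence vanish.\<close>

lemma DgI:
  assumes d: "d \<in> D" and shift: "\<And>\<mu> x. x \<in> Ldeg \<mu> \<Longrightarrow> d x \<in> Ldeg (\<nu> + \<mu>)"
  shows "d \<in> Dg \<nu>"
proof -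
  have comp: "D_space.pr \<kappa> d \<in> SCD \<kappa>" for \<kappa>
    by (rule Dg_SCD[OF D_space.pr_in[OF d]]) simp
  have val: "degree.pr (\<kappa> + \<mu>) (d x) = D_space.pr \<kappa> d x" if x: "x \<in> Ldeg \<mu>" for \<mu> x \<kappa>
  proof -
    have fin: "finite {\<kappa>. D_space.pr \<kappa> d \<noteq> 0}" by (rule D_space.pr_finite[OF d])
    have "d x = (\<Sum>\<kappa> | D_space.pr \<kappa> d \<noteq> 0. D_space.pr \<kappa> d) x"
      using D_space.sum_pr[OF d] by simp
    also have "\<dots> = (\<Sum>\<kappa> | D_space.pr \<kappa> d \<noteq> 0. D_space.pr \<kappa> d x)"
    proof -
      have "sum (\<lambda>\<kappa>. D_space.pr \<kappa> d) F x = (\<Sum>\<kappa>\<in>F. D_space.pr \<kappa> d x)" if "finite F" for F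
        using that by (induction F rule: finite_induct) auto
      then show ?thesis using fin by blast
    qed
    finally have "degree.pr (\<kappa> + \<mu>) (d x) =
        (\<Sum>\<kappa>' | D_space.pr \<kappa>' d \<noteq> 0. degree.pr (\<kappa> + \<mu>) (D_space.pr \<kappa>' d x))"
      using degree.pr_sum[OF fin] by simp
    also have "\<dots> = (\<Sum>\<kappa>' | D_space.pr \<kappa>' d \<noteq> 0. if \<kappa>' = \<kappa> then D_space.pr \<kappa> d x else 0)"
    proof (rule sum.cong)
      fix \<kappa>'
      have "D_space.pr \<kappa>' d x \<in> Ldeg (\<kappa>' + \<mu>)" by (rule SCDer_degree[OF comp x])
      then show "degree.pr (\<kappa> + \<mu>) (D_space.pr \<kappa>' d x) = (if \<kappa>' = \<kappa> then D_space.pr \<kappa> d x else 0)"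
        using degree.pr_homogeneous[of "\<kappa>' + \<mu>" "D_space.pr \<kappa>' d x" "\<kappa> + \<mu>"]
          by auto
    qed simp
    also have "\<dots> = D_space.pr \<kappa> d x" using fin by (cases "D_space.pr \<kappa> d = 0") auto
    finally show ?thesis .
  qed
  have "D_space.pr \<kappa> d = 0" if "\<kappa> \<noteq> \<nu>" for \<kappa>
  proof
    fix x show "D_space.pr \<kappa> d x = 0 x"
    proof (induction x rule: degree_induct)
      case (homogeneous \<mu> x)
      have "degree.pr (\<kappa> + \<mu>) (d x) = 0"
        using degree.pr_homogeneous[OF _ shift[OF homogeneous], of "\<kappa> + \<mu>"] that by simp
      then show ?case using val[OF homogeneous, of \<kappa>] by simp
    qed (auto simp: SCDer_add[OF comp] SCDer_zero[OF comp])
  qed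
  then have "d = D_space.pr \<nu> d"
    using decomposes_sum[OF D_space.pr_decomposes[OF d], of "{\<nu>}"] by auto
  then show ?thesis using D_space.pr_in[OF d, of \<nu>] by simp
qed

lemma commutator_degree:
  assumes "d \<in> Dg \<nu>" "d' \<in> Dg \<mu>" shows "commutator d d' \<in> Dg (\<nu> + \<mu>)"
proof (rule DgI)
  fix \<kappa> x assume x: "x \<in> Ldeg \<kappa>"
  have "d (d' x) \<in> Ldeg (\<nu> + (\<mu> + \<kappa>))" "d' (d x) \<in> Ldeg (\<mu> + (\<nu> + \<kappa>))"
    using SCDer_degree x assms Dg_SCD by blast+
  moreover have "\<nu> + (\<mu> + \<kappa>) = \<nu> + \<mu> + \<kappa>" "\<mu> + (\<nu> + \<kappa>) = \<nu> + \<mu> + \<kappa>" by (simp_all add: algebra_simps)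
  ultimately show "commutator d d' x \<in> Ldeg (\<nu> + \<mu> + \<kappa>)"
    using degree.part_subspace[of "\<nu> + \<mu> + \<kappa>"] by (simp add: commutator_def subspace_diff)
qed (use assms D_closed Dg_in in blast)

text \<open>Commutators of homogeneous derivations with total degree \<open>0\<close> vanish, and \<open>t\<close> vanishes in all other degrees.\<close>

lemma C_degree_0_kills_commutators:
  assumes t: "t \<in> Cg 0" and d: "d \<in> D" and d': "d' \<in> D"
  shows "t (commutator d d') = 0"
  using d
proof (induction rule: D_induct)
  case zero
  then show ?case using d' C_zero[OF Cg_in[OF t]] by (simp add: commutator_zero_left del: zero_fun_apply)
next
  case (homogeneous \<nu> d)
  note d = this
  show ?case using d'
  proof (induction rule: D_induct)
    case zero
    then show ?case using Dg_in[OF d] C_zero[OF Cg_in[OF t]]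
      by (simp add: commutator_zero_right del: zero_fun_apply)
  next
    case (homogeneous \<mu> d')
    show ?case
    proof (cases "\<mu> = - \<nu>")
      case True
      then show ?thesis
        using SCDer_opposite_commute[OF Dg_SCD[OF d]] Dg_SCD[OF homogeneous] C_zero[OF Cg_in[OF t]]
        by (simp del: zero_fun_apply)
    next
      case False
      then have "\<nu> + \<mu> \<noteq> 0" by (simp add: eq_neg_iff_add_eq_0 add.commute)
      then show ?thesis using C_homogeneous[OF t commutator_degree[OF d homogeneous]] by simp
    qed
  next
    case (add d1 d2)
    then show ?case
      using commutator_add_right[OF add(1,2) Dg_in[OF d]] C_add[OF Cg_in[OF t]] D_closed Dg_in[OF d]
      by (simp del: plus_fun_apply)
  qed
next
  case (add d1 d2)
  then show ?case using commutator_add_left[OF add(1,2) d'] C_add[OF Cg_in[OF t]] D_closed d'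
    by (simp del: plus_fun_apply)
qed

lemma TC_C: "t \<in> TC \<Longrightarrow> t \<in> C" using TC_degree Cg_in by blast

lemma contra_TC: "t \<in> TC \<Longrightarrow> d \<in> D \<Longrightarrow> contra d t = 0"
  using C_degree_0_kills_commutators TC_degree by (auto simp: contragredient_def fun_eq_iff)

lemma TD_D: "t \<in> TD \<Longrightarrow> t \<in> D" using TD_degree Dg_in by blast

abbreviation evt where "evt \<equiv> ev S sL Lg"

text \<open>The degrees of \<open>L\<close> generate the grading group, so an additive map is determined by its degree
  derivation.\<close>

lemma ev_unique:
  assumes "additive \<theta>" "t \<in> TD" "\<And>\<mu> x. x \<in> Ldeg \<mu> \<Longrightarrow> t x = sL (\<theta> \<mu>) x"
  shows "evt \<nu> t = \<theta> \<nu>"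
proof -
  have uniq: "\<theta>' = \<theta>''" if add: "additive \<theta>'" "additive \<theta>''"
    and act: "\<And>\<mu> x. x \<in> Ldeg \<mu> \<Longrightarrow> t x = sL (\<theta>' \<mu>) x" "\<And>\<mu> x. x \<in> Ldeg \<mu> \<Longrightarrow> t x = sL (\<theta>'' \<mu>) x" for \<theta>' \<theta>''
  proof
    fix \<nu>
    show "\<theta>' \<nu> = \<theta>'' \<nu>"
    proof (rule additive_determined[OF add])
      fix \<mu> assume "\<mu> \<in> {\<nu>. Ldeg \<nu> \<noteq> {0}}"
      then obtain x where "x \<in> Ldeg \<mu>" "x \<noteq> 0"
        using subspace_0[OF degree.part_subspace, of \<mu>] by auto
      moreover from this have "sL (\<theta>' \<mu>) x = sL (\<theta>'' \<mu>) x" using act by metis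
      ultimately show "\<theta>' \<mu> = \<theta>'' \<mu>" by simp
    qed (simp add: degrees_generate)
  qed
  obtain \<theta>0 where \<theta>0: "additive \<theta>0" "t = degree_derivation S sL Lg \<theta>0"
    using assms(2) TD_degree by (auto simp: degree_derivations_def)
  have "\<theta>0 = \<theta>" using \<theta>0 assms degree_derivation_homogeneous[of _ _ \<theta>0]
    by (intro uniq) auto
  moreover have "(THE \<theta>. additive \<theta> \<and> t = degree_derivation S sL Lg \<theta>) = \<theta>0"
  proof (rule the_equality)
    fix \<theta>1 assume "additive \<theta>1 \<and> t = degree_derivation S sL Lg \<theta>1"
    then show "\<theta>1 = \<theta>0" using \<theta>0 degree_derivation_homogeneous by (intro uniq) metis+
  qed (use \<theta>0 in simp)
  ultimately show ?thesis by (simp add: ev_def)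
qed

lemma ev_exists:
  assumes "t \<in> TD"
  shows "\<exists>\<theta>. additive \<theta> \<and> (\<forall>\<mu>. \<forall>x\<in>Ldeg \<mu>. t x = sL (\<theta> \<mu>) x) \<and> (\<forall>\<nu>. evt \<nu> t = \<theta> \<nu>)"
proof -
  obtain \<theta> where \<theta>: "additive \<theta>" "t = degree_derivation S sL Lg \<theta>"
    using assms TD_degree by (auto simp: degree_derivations_def)
  have act: "t x = sL (\<theta> \<mu>) x" if "x \<in> Ldeg \<mu>" for \<mu> x
    using \<theta> that degree_derivation_homogeneous by simp
  then show ?thesis using ev_unique[OF \<theta>(1) assms act] \<theta>(1) by blast
qed

lemma ev_additive: "t \<in> TD \<Longrightarrow> additive (\<lambda>\<nu>. evt \<nu> t)"
  using ev_exists[of t] by (auto simp: additive_def)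

lemma TD_acts: "t \<in> TD \<Longrightarrow> x \<in> Ldeg \<mu> \<Longrightarrow> t x = sL (evt \<mu> t) x"
  using ev_exists[of t] by auto

lemma TD_add_in: "t \<in> TD \<Longrightarrow> t' \<in> TD \<Longrightarrow> t + t' \<in> TD"
  and TD_scale_in: "t \<in> TD \<Longrightarrow> sF k t \<in> TD"
  and TD_zero_in: "0 \<in> TD"
  using TD_subspace D_space.subspace_add D_space.subspace_scale D_space.subspace_0 by auto

lemma ev_add: assumes "t \<in> TD" "t' \<in> TD" shows "evt \<nu> (t + t') = evt \<nu> t + evt \<nu> t'"
proof -
  have "additive (\<lambda>\<nu>. evt \<nu> t + evt \<nu> t')"
    using ev_additive[OF assms(1)] ev_additive[OF assms(2)] by (simp add: additive_def)
  moreover have "(t + t') x = sL (evt \<mu> t + evt \<mu> t') x" if "x \<in> Ldeg \<mu>" for \<mu> x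
    using that assms TD_acts by (simp add: scale_left_distrib)
  ultimately show ?thesis using ev_unique[OF _ TD_add_in[OF assms]] by blast
qed

lemma ev_scale: assumes "t \<in> TD" shows "evt \<nu> (sF k t) = k * evt \<nu> t"
proof -
  have "additive (\<lambda>\<nu>. k * evt \<nu> t)"
    using ev_additive[OF assms(1)] by (simp add: additive_def distrib_left)
  moreover have "sF k t x = sL (k * evt \<mu> t) x" if "x \<in> Ldeg \<mu>" for \<mu> x
    using TD_acts[OF assms that] by (simp add: fun_scale_def)
  ultimately show ?thesis using ev_unique[OF _ TD_scale_in[OF assms]] by blast
qed

lemma ev_separates:
  assumes "\<And>t. t \<in> TD \<Longrightarrow> evt \<nu> t = evt \<mu> t" shows "\<nu> = \<mu>"
proof -
  have "restrict (evt \<nu>) TD = restrict (evt \<mu>) TD" using assms by (auto simp: restrict_def fun_eq_iff)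
  then show ?thesis using TD_injective by (auto simp: inj_def)
qed

lemma TD_commutator:
  assumes t: "t \<in> TD" and d: "d \<in> Dg \<nu>" shows "commutator t d = sF (evt \<nu> t) d"
proof
  fix x show "commutator t d x = sF (evt \<nu> t) d x"
  proof (induction x rule: degree_induct)
    case zero
    show ?case using D_zero[OF TD_D[OF t]] D_zero[OF Dg_in[OF d]] by (simp add: commutator_def fun_scale_def)
  next
    case (homogeneous \<mu> x)
    have "d x \<in> Ldeg (\<nu> + \<mu>)" using SCDer_degree Dg_SCD d homogeneous by blast
    then have "commutator t d x = sL (evt (\<nu> + \<mu>) t) (d x) - sL (evt \<mu> t) (d x)"
      using TD_acts[OF t] homogeneous D_scale[OF Dg_in[OF d]] by (simp add: commutator_def)
    then show ?case
      using additive.add[OF ev_additive[OF t]] by (simp add: fun_scale_def scale_left_distrib)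
  next
    case (add x y)
    then show ?case using D_add[OF TD_D[OF t]] D_add[OF Dg_in[OF d]]
      by (simp add: commutator_def fun_scale_def scale_right_distrib algebra_simps)
  qed
qed

lemma contra_add_left:
  "d \<in> D \<Longrightarrow> d' \<in> D \<Longrightarrow> c \<in> C \<Longrightarrow> contra (d + d') c = contra d c + contra d' c"
  and contra_scale_left: "d \<in> D \<Longrightarrow> c \<in> C \<Longrightarrow> contra (sF k d) c = sC k (contra d c)"
  by (auto simp: contragredient_def fun_eq_iff fun_scale_def[of "(*)"] commutator_add_left
      commutator_scale_left C_add C_scale D_closed)

lemma contra_add_right: "contra d (c + c') = contra d c + contra d c'"
  and contra_scale_right: "contra d (sC k c) = sC k (contra d c)"
  by (auto simp: contragredient_def fun_eq_iff fun_scale_def[of "(*)"])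

lemma TD_contra:
  assumes t: "t \<in> TD" and c: "c \<in> Cg \<nu>" shows "contra t c = sC (evt \<nu> t) c"
proof (rule C_eqI)
  fix d assume "d \<in> D"
  then show "contra t c d = sC (evt \<nu> t) c d"
  proof (induction rule: D_induct)
    case zero
    then show ?case using C_zero[OF Cg_in[OF c]] TD_D[OF t] D_zero_in
      by (simp add: contra_apply commutator_zero_right fun_scale_def del: zero_fun_apply)
  next
    case (homogeneous \<mu> d)
    have "contra t c d = - (evt \<mu> t * c d)"
      using TD_commutator[OF t homogeneous] C_scale[OF Cg_in[OF c]] Dg_in[OF homogeneous]
        by (simp add: contra_apply)
    also have "\<dots> = evt \<nu> t * c d"
      using C_homogeneous[OF c homogeneous] additive.minus[OF ev_additive[OF t], of \<nu>]
        by (cases "\<mu> = - \<nu>") auto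
    finally show ?case by (simp add: fun_scale_def)
  next
    case (add d d')
    then show ?case using D_closed TD_D[OF t] C_add[OF Cg_in[OF c]] D_add_in
      by (simp add: contra_apply commutator_add_right fun_scale_def algebra_simps del: plus_fun_apply)
  qed
qed (use c t Cg_in C_invariant TD_D C_scale_in in auto)

lemma D_nonzero_degree: "Dg \<nu> \<noteq> {0} \<Longrightarrow> Lg 0 \<nu> \<noteq> {0}"
  using SCDer_nonzero_degree[OF Dg_SCD] D_space.subspace_0[OF D_space.part_subspace, of \<nu>] by blast

text \<open>A nonzero functional of degree \<open>\<nu>\<close> requires nonzero derivations of degree \<open>-\<nu>\<close>. So \<open>L\<^sub>0\<close> is nonzero in
  degree \<open>-\<nu>\<close>, and the form pairs this degree with \<open>\<nu>\<close>.\<close>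

lemma C_nonzero_degree: assumes "Cg \<nu> \<noteq> {0}" shows "Lg 0 \<nu> \<noteq> {0}"
proof -
  obtain c where c: "c \<in> Cg \<nu>" "c \<noteq> 0"
    using assms C_space.subspace_0[OF C_space.part_subspace, of \<nu>] by auto
  have "\<exists>d\<in>Dg (- \<nu>). c d \<noteq> 0"
  proof (rule ccontr)
    assume no: "\<not> ?thesis"
    have "c d = 0" if "d \<in> D" for d using that
    proof (induction rule: D_induct)
      case (homogeneous \<mu> d)
      then show ?case using no C_homogeneous[OF c(1) homogeneous] by (cases "\<mu> = - \<nu>") auto
    qed (use C_zero[OF Cg_in[OF c(1)]] C_add[OF Cg_in[OF c(1)]] in \<open>auto simp del: zero_fun_apply plus_fun_apply\<close>)
    then have "c = 0" using Cg_in[OF c(1)] C_zero_in by (intro C_eqI) auto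
    then show False using c by simp
  qed
  then have "Dg (- \<nu>) \<noteq> {0}" using C_zero[OF Cg_in[OF c(1)]] by (metis singletonD)
  then have "Lg 0 (- \<nu>) \<noteq> {0}" by (rule D_nonzero_degree)
  then obtain x where "x \<in> Lg 0 (- \<nu>)" "x \<noteq> 0"
    using subspace_0[OF Lg_subspace[of 0 "- \<nu>"]] by auto
  then obtain y where "y \<in> Lg 0 \<nu>" "BL x y \<noteq> 0" using graded_partner[of 0 x "- \<nu>"] by auto
  then show ?thesis using form_zero_right by auto
qed

lemma tau_add_left: "d \<in> D \<Longrightarrow> d' \<in> D \<Longrightarrow> d'' \<in> D \<Longrightarrow> \<tau> (d + d') d'' = \<tau> d d'' + \<tau> d' d''"
  and tau_add_right: "d \<in> D \<Longrightarrow> d' \<in> D \<Longrightarrow> d'' \<in> D \<Longrightarrow> \<tau> d'' (d + d') = \<tau> d'' d + \<tau> d'' d'"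
  and tau_scale_left: "d \<in> D \<Longrightarrow> d' \<in> D \<Longrightarrow> \<tau> (sF k d) d' = sC k (\<tau> d d')"
  and tau_scale_right: "d \<in> D \<Longrightarrow> d' \<in> D \<Longrightarrow> \<tau> d (sF k d') = sC k (\<tau> d d')"
  using tau_bilinear by (auto simp: bilinear_on_def)

lemma tau_skew: assumes "d \<in> D" "d' \<in> D" shows "\<tau> d d' = - \<tau> d' d"
proof -
  have "\<tau> (d + d') (d + d') = \<tau> d d' + \<tau> d' d"
    using assms tau_alternating[of d] tau_alternating[of d']
      by (simp add: tau_add_left tau_add_right D_add_in)
  then have "\<tau> d d' + \<tau> d' d = 0" using tau_alternating[of "d + d'"] assms D_add_in by simp
  then show ?thesis by (simp add: eq_neg_iff_add_eq_0)
qed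

lemma tau_zero: "d \<in> D \<Longrightarrow> \<tau> 0 d = 0" "d \<in> D \<Longrightarrow> \<tau> d 0 = 0"
  using tau_toral TD_zero_in tau_skew[of d 0] D_zero_in by auto

lemma choice_coroot_element:
  "\<xi> \<in> S - {0} \<Longrightarrow> Lg \<xi> \<nu> \<noteq> {0} \<Longrightarrow> h \<xi> \<nu> = coroot_element \<xi>"
  using choice_nonzero invertible_coroot_element by metis

lemma cartan_eq: "cartan sY S sL h = cartan_subspace"
proof -
  have "h \<xi> 0 = coroot_element \<xi>" if \<xi>: "\<xi> \<in> indivisible sY S" for \<xi>
  proof (rule choice_coroot_element)
    obtain e f where "invertible_with S co sL brL Lg \<xi> 0 e f" using RG2[OF \<xi>] by blast
    then show "Lg \<xi> 0 \<noteq> {0}" by (auto simp: invertible_with_def)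
  qed (rule root_system.indivisible_in[OF \<xi>])
  then have "{h \<xi> 0 |\<xi>. \<xi> \<in> indivisible sY S} = coroot_element ` indivisible sY S"
    unfolding setcompr_eq_image by (simp cong: image_cong)
  then show ?thesis by (simp add: cartan_def cartan_subspace_def)
qed

lemma choice_in:
  assumes "\<xi> \<in> S" "Lg \<xi> \<nu> \<noteq> {0}"
  shows "e \<xi> \<nu> \<in> Lg \<xi> \<nu>" "f \<xi> \<nu> \<in> Lg (- \<xi>) (- \<nu>)"
  using choice_nonzero[of \<xi> \<nu>] choice_zero[of \<nu>] assms
    by (cases "\<xi> = 0"; auto simp: invertible_with_def)+

lemma choice_form_nonzero: "\<xi> \<in> S \<Longrightarrow> Lg \<xi> \<nu> \<noteq> {0} \<Longrightarrow> BL (e \<xi> \<nu>) (f \<xi> \<nu>) \<noteq> 0"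
  using choice_nonzero[of \<xi> \<nu>] choice_zero[of \<nu>] invertible_pair_form_nonzero[of \<xi> \<nu>]
    by (cases "\<xi> = 0") auto

lemma choice_bracket:
  assumes "\<xi> \<in> S" "Lg \<xi> \<nu> \<noteq> {0}"
  shows "brL (e \<xi> \<nu>) (f \<xi> \<nu>) = (if \<xi> = 0 then 0 else - coroot_element \<xi>)"
  using choice_nonzero[of \<xi> \<nu>] choice_zero[of \<nu>] choice_coroot_element[of \<xi> \<nu>] assms br_skew[of "e \<xi> \<nu>" "f \<xi> \<nu>"]
  by (cases "\<xi> = 0") auto

end

section \<open>The extension as a toral pair\<close>

lemma root_space_subspace:
  assumes "lie_algebra s V br" "T \<subseteq> V" shows "module.subspace s (root_space s V br T \<alpha>)"
proof -
  interpret lie_algebra s V br by fact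
  have "t \<in> V" if "t \<in> T" for t using assms that by blast
  then show ?thesis
    using subspace_0[OF carrier_subspace] subspace_add[OF carrier_subspace] subspace_scale[OF carrier_subspace]
    by (intro subspaceI) (auto simp: root_space_def br_zero_right br_add_right br_scale_right scale_right_distrib mult.commute)
qed

text \<open>An eigenvector has components only in parts with its own weight. So the root spaces arise from the
  given parts by merging those of equal weight, and here no two parts have equal weight.\<close>

lemma toral_grading:
  fixes wt :: "'i \<Rightarrow> 'a::ab_group_add \<Rightarrow> 'k::field"
  assumes lie: "lie_algebra s V br" and T: "T \<subseteq> V" and ds: "is_direct_sum s V I W"
    and dual: "\<And>i. i \<in> I \<Longrightarrow> wt i \<in> dual_on s T" and inj: "inj_on wt I"
    and act: "\<And>i t x. i \<in> I \<Longrightarrow> t \<in> T \<Longrightarrow> x \<in> W i \<Longrightarrow> br t x = s (wt i t) x"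
  shows "is_direct_sum s V (dual_on s T) (root_space s V br T)"
    and "\<And>i. i \<in> I \<Longrightarrow> root_space s V br T (wt i) = W i"
    and "\<And>\<alpha>. \<alpha> \<in> dual_on s T \<Longrightarrow> \<alpha> \<notin> wt ` I \<Longrightarrow> root_space s V br T \<alpha> = {0}"
proof -
  interpret lie_algebra s V br by fact
  interpret direct_sum_decomposition s V I W by unfold_locales (fact carrier_subspace, fact ds)
  let ?R = "root_space s V br T"
  have eq: "?R \<alpha> = span (\<Union>i\<in>{i\<in>I. wt i = \<alpha>}. W i)" if \<alpha>: "\<alpha> \<in> dual_on s T" for \<alpha>
  proof
    show "span (\<Union>i\<in>{i\<in>I. wt i = \<alpha>}. W i) \<subseteq> ?R \<alpha>"
    proof (rule span_minimal)
      show "(\<Union>i\<in>{i\<in>I. wt i = \<alpha>}. W i) \<subseteq> ?R \<alpha>" using act part_in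
        by (auto simp: root_space_def)
    qed (rule root_space_subspace[OF lie T])
    show "?R \<alpha> \<subseteq> span (\<Union>i\<in>{i\<in>I. wt i = \<alpha>}. W i)"
    proof
      fix x assume x: "x \<in> ?R \<alpha>"
      then have xV: "x \<in> V" by (simp add: root_space_def)
      show "x \<in> span (\<Union>i\<in>{i\<in>I. wt i = \<alpha>}. W i)"
      proof (rule in_span_if_pr[OF xV])
        fix i assume i: "i \<in> I" "i \<notin> {i\<in>I. wt i = \<alpha>}"
        have "\<exists>t\<in>T. wt i t \<noteq> \<alpha> t"
        proof (rule ccontr)
          assume "\<not> ?thesis"
          then have "wt i t = \<alpha> t" for t
            using dual[OF i(1)] \<alpha> by (cases "t \<in> T") (auto simp: dual_on_def)
          then show False using i by auto
        qed
        then obtain t where t: "t \<in> T" "wt i t \<noteq> \<alpha> t" by blast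
        have "pr i (br t x) = s (wt i t) (pr i x)"
          by (rule conjunct2[OF pr_eigenoperator[where A="br t" and w="\<lambda>i. wt i t"]])
            (use t T act i xV in \<open>auto simp: br_add_right br_zero_right\<close>)
        moreover have "br t x = s (\<alpha> t) x" using x t by (simp add: root_space_def)
        ultimately show "pr i x = 0" using t pr_scale[OF xV, of i "\<alpha> t"] by auto
      qed
    qed
  qed
  have "is_direct_sum s V (dual_on s T) (\<lambda>\<alpha>. span (\<Union>i\<in>{i\<in>I. wt i = \<alpha>}. W i))"
    by (rule coarsening) (use dual in auto)
  moreover have "decomposes (dual_on s T) (\<lambda>\<alpha>. span (\<Union>i\<in>{i\<in>I. wt i = \<alpha>}. W i)) = decomposes (dual_on s T) ?R"
    using eq by (auto simp: fun_eq_iff decomposes_def)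
  ultimately show "is_direct_sum s V (dual_on s T) ?R" using eq by (simp add: is_direct_sum_def)
  show "?R (wt i) = W i" if "i \<in> I" for i
  proof -
    have "{j \<in> I. wt j = wt i} = {i}" using inj that by (auto simp: inj_on_def)
    then have "?R (wt i) = span (W i)" using eq[OF dual[OF that]] by simp
    then show ?thesis using span_eq_iff part_subspace[OF that] by metis
  qed
  show "?R \<alpha> = {0}" if "\<alpha> \<in> dual_on s T" "\<alpha> \<notin> wt ` I" for \<alpha>
  proof -
    have none: "{i \<in> I. wt i = \<alpha>} = {}" using that by auto
    show ?thesis unfolding eq[OF that(1)] none by simp
  qed
qed

context affine_extension_data begin

abbreviation sE where "sE \<equiv> E_scale sL"
abbreviation Ecar where "Ecar \<equiv> C \<times> (UNIV :: 'l set) \<times> D"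
abbreviation brE where "brE \<equiv> E_bracket brL BL D \<tau>"
abbreviation BE where "BE \<equiv> E_form BL"
abbreviation T where "T \<equiv> TC \<times> cartan_subspace \<times> TD"

lemma brE_apply: "brE (c1, l1, d1) (c2, l2, d2) =
    (sg l1 l2 + contra d1 c2 - contra d2 c1 + \<tau> d1 d2, brL l1 l2 + d1 l2 - d2 l1, commutator d1 d2)"
  by (simp add: E_bracket_def)

lemma sE_apply: "sE k (c, l, d) = (sC k c, sL k l, sF k d)"
  by (simp add: E_scale_def)

lemma BE_apply: "BE (c1, l1, d1) (c2, l2, d2) = c1 d2 + c2 d1 + BL l1 l2"
  by (simp add: E_form_def)

lemma vector_space_E: "vector_space sE"
proof
  fix a b and x y :: "(('l \<Rightarrow> 'l) \<Rightarrow> 'k) \<times> 'l \<times> ('l \<Rightarrow> 'l)"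
  obtain c l d c' l' d' where [simp]: "x = (c, l, d)" "y = (c', l', d')" by (metis prod_cases3)
  show "sE a (x + y) = sE a x + sE a y"
    by (simp add: sE_apply C_space.scale_right_distrib D_space.scale_right_distrib scale_right_distrib)
  show "sE (a + b) x = sE a x + sE b x"
    by (simp add: sE_apply C_space.scale_left_distrib D_space.scale_left_distrib scale_left_distrib)
  show "sE a (sE b x) = sE (a * b) x" by (simp add: sE_apply)
  show "sE 1 x = x" by (simp add: sE_apply)
qed

interpretation E_space: vector_space sE by (rule vector_space_E)

lemma subspace_product:
  assumes "C_space.subspace A" "subspace B" "D_space.subspace X"
    shows "E_space.subspace (A \<times> B \<times> X)"
proof (rule E_space.subspaceI)
  show "0 \<in> A \<times> B \<times> X"
    using assms C_space.subspace_0 subspace_0 D_space.subspace_0 by (auto simp: zero_prod_def)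
next
  fix x y assume "x \<in> A \<times> B \<times> X" "y \<in> A \<times> B \<times> X"
  then show "x + y \<in> A \<times> B \<times> X"
    using assms C_space.subspace_add subspace_add D_space.subspace_add by auto
next
  fix k x assume "x \<in> A \<times> B \<times> X"
  then show "sE k x \<in> A \<times> B \<times> X"
    using assms C_space.subspace_scale subspace_scale D_space.subspace_scale by (auto simp: sE_apply)
qed

lemma E_subspace: "E_space.subspace Ecar"
  by (rule subspace_product) (use C_subspace D_subspace in auto)

lemma T_subspace: "E_space.subspace T"
  by (rule subspace_product) (use TC_subspace TD_subspace cartan_subspace_subspace in auto)

lemma T_subset: "T \<subseteq> Ecar"
  using TC_C TD_D by auto

lemma sigma_C: "sg x y \<in> C" by (rule C_sigma)

lemma brE_closed: "x \<in> Ecar \<Longrightarrow> y \<in> Ecar \<Longrightarrow> brE x y \<in> Ecar"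
  by (auto simp: brE_apply intro!: C_add_in C_diff_in sigma_C C_invariant tau_range D_closed)

lemma sigma_diff_right: "sg x (y - z) = sg x y - sg x z"
  by (auto simp: sigma_def fun_eq_iff form_diff_right)

lemma contra_diff_right: "contra d (c - c') = contra d c - contra d c'"
  by (auto simp: contragredient_def fun_eq_iff)

lemma brE_bilinear: "bilinear_on sE sE Ecar brE"
proof -
  have "brE (x + y) z = brE x z + brE y z \<and> brE z (x + y) = brE z x + brE z y"
    if xyz: "x \<in> Ecar" "y \<in> Ecar" "z \<in> Ecar" for x y z
  proof -
    obtain c1 l1 d1 c2 l2 d2 c3 l3 d3 where e: "x = (c1, l1, d1)" "y = (c2, l2, d2)" "z = (c3, l3, d3)"
      by (metis prod_cases3)
    have m: "c1 \<in> C" "c2 \<in> C" "c3 \<in> C" "d1 \<in> D" "d2 \<in> D" "d3 \<in> D" using xyz e by auto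
    show ?thesis unfolding e
      using m
      by (simp add: brE_apply sigma_add_left sigma_add_right contra_add_left contra_add_right tau_add_left
          tau_add_right br_add_left br_add_right D_add commutator_add_left commutator_add_right)
  qed
  moreover have "brE (sE k x) y = sE k (brE x y) \<and> brE x (sE k y) = sE k (brE x y)"
    if xy: "x \<in> Ecar" "y \<in> Ecar" for k x y
  proof -
    obtain c1 l1 d1 c2 l2 d2 where e: "x = (c1, l1, d1)" "y = (c2, l2, d2)"
      by (metis prod_cases3)
    have m: "c1 \<in> C" "c2 \<in> C" "d1 \<in> D" "d2 \<in> D" using xy e by auto
    have sF: "sF k d l = sL k (d l)" for d l by (simp add: fun_scale_def)
    show ?thesis unfolding e
      using m
      by (simp add: brE_apply sE_apply sigma_scale_left sigma_scale_right contra_scale_left contra_scale_right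
          tau_scale_left tau_scale_right br_scale_left br_scale_right D_scale commutator_scale_left
          commutator_scale_right sF C_space.scale_right_distrib C_space.scale_right_diff_distrib
          scale_right_distrib scale_right_diff_distrib)
  qed
  ultimately show ?thesis unfolding bilinear_on_def by (intro conjI ballI allI; simp only:)
qed

lemma sigma_self: "sg x x = 0"
proof -
  have "BL (d x) x = 0" if "d \<in> D" for d
  proof -
    have "BL (d x) x = - BL (d x) x" using D_skew[OF that, of x x] form_sym[of x "d x"] by simp
    then have "BL (d x) x + BL (d x) x = 0" by (simp only: eq_neg_iff_add_eq_0)
    then show ?thesis by (metis mult_2 mult_eq_0_iff zero_neq_numeral)
  qed
  then show ?thesis by (simp add: sigma_def fun_eq_iff)
qed

lemma commutator_self: "commutator d d = 0"
  by (simp add: commutator_def zero_fun_def)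

lemma brE_alternating: "x \<in> Ecar \<Longrightarrow> brE x x = 0"
  by (auto simp: brE_apply sigma_self tau_alternating bracket_alternating commutator_self zero_prod_def)

text \<open>As derivations are skew, one term of the commutator with \<open>d\<close> can be moved to the other side of the form.\<close>

lemma contra_sigma: assumes d: "d \<in> D" shows "contra d (sg x y) = sg (d x) y + sg x (d y)"
proof
  fix d'
  show "contra d (sg x y) d' = (sg (d x) y + sg x (d y)) d'"
  proof (cases "d' \<in> D")
    case True
    then have "commutator d d' \<in> D" using D_closed d by blast
    then show ?thesis
      using True D_skew[OF d, of "d' x" y]
      by (simp add: contra_apply sigma_apply commutator_def form_diff_left)
  qed (simp add: contragredient_def sigma_def)
qed

lemma contra_commutator:
  assumes "d \<in> D" "d' \<in> D" "c \<in> C"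
  shows "contra (commutator d d') c = contra d (contra d' c) - contra d' (contra d c)"
proof
  fix x
  show "contra (commutator d d') c x = (contra d (contra d' c) - contra d' (contra d c)) x"
  proof (cases "x \<in> D")
    case True
    have "commutator (commutator d d') x = commutator d (commutator d' x) + (- commutator d' (commutator d x))"
      using commutator_jacobi[OF assms(1,2) True] by simp
    then have "c (commutator (commutator d d') x) = c (commutator d (commutator d' x)) + c (- commutator d' (commutator d x))"
      using C_add[OF assms(3)] D_closed assms True D_scale_in[of _ "-1"]
      by (metis D_space.subspace_neg D_subspace)
    then show ?thesis
      using True assms D_closed C_minus[OF assms(3)] by (simp add: contra_apply)
  qed (simp add: contragredient_def)
qed

text \<open>At \<open>d\<close> the three terms become the terms of the product rule for \<open>d[x, y]\<close>, paired with \<open>z\<close>.\<close>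

lemma sigma_cyclic: "sg x (brL y z) + sg y (brL z x) + sg z (brL x y) = 0"
proof
  fix d
  show "(sg x (brL y z) + sg y (brL z x) + sg z (brL x y)) d = 0 d"
  proof (cases "d \<in> D")
    case True
    have "BL (d x) (brL y z) = BL (brL (d x) y) z" by (simp add: form_invariant)
    moreover have "BL (d y) (brL z x) = BL (brL x (d y)) z"
      using form_sym[of "d y" "brL z x"] form_invariant[of z x "d y"] form_sym[of z] by simp
    moreover have "BL (d z) (brL x y) = - BL (d (brL x y)) z"
      using D_skew[OF True, of z "brL x y"] form_sym[of z "d (brL x y)"] by simp
    ultimately show ?thesis
      using True by (simp add: sigma_apply D_derivation form_add_left)
  qed (simp add: sigma_def)
qed

text \<open>In the component in \<open>C\<close> the terms without \<open>D\<close> cancel by the cyclic identity for \<open>\<sigma>\<close>, those with one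
  derivation by its equivariance, those with two derivations and one functional because \<open>C\<close> is a module
  over \<open>D\<close>, and the remaining ones by the cocycle condition for \<open>\<tau>\<close>. In \<open>L\<close> the terms cancel by the Jacobi
  identity of \<open>L\<close> and the product rule for derivations.\<close>

lemma brE_jacobi:
  assumes "x \<in> Ecar" "y \<in> Ecar" "z \<in> Ecar"
  shows "brE x (brE y z) + brE y (brE z x) + brE z (brE x y) = 0"
proof -
  obtain c1 l1 d1 c2 l2 d2 c3 l3 d3 where e: "x = (c1, l1, d1)" "y = (c2, l2, d2)" "z = (c3, l3, d3)"
    by (metis prod_cases3)
  have m: "c1 \<in> C" "c2 \<in> C" "c3 \<in> C" "d1 \<in> D" "d2 \<in> D" "d3 \<in> D" using assms e by auto
  note cl = D_closed
  have s: "sg (d1 l2) l3 = - sg l3 (d1 l2)" "sg (d2 l3) l1 = - sg l1 (d2 l3)" "sg (d3 l1) l2 = - sg l2 (d3 l1)"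
    by (rule sigma_skew)+
  have t: "\<tau> d1 (commutator d2 d3) = - \<tau> (commutator d2 d3) d1" "\<tau> d2 (commutator d3 d1) = - \<tau> (commutator d3 d1) d2"
    "\<tau> d3 (commutator d1 d2) = - \<tau> (commutator d1 d2) d3" using m cl by (auto intro: tau_skew)
  have cyc: "sg l3 (brL l1 l2) = - sg l1 (brL l2 l3) - sg l2 (brL l3 l1)"
    using sigma_cyclic[of l1 l2 l3] by (simp add: eq_neg_iff_add_eq_0 algebra_simps)
  have tc: "contra d3 (\<tau> d1 d2) = \<tau> (commutator d1 d2) d3 + \<tau> (commutator d2 d3) d1 + \<tau> (commutator d3 d1) d2
      - contra d1 (\<tau> d2 d3) - contra d2 (\<tau> d3 d1)"
    using tau_cocycle[of d1 d2 d3] m by (simp add: algebra_simps)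
  have 1: "sg l1 (brL l2 l3 + d2 l3 - d3 l2)
        + contra d1 (sg l2 l3 + contra d2 c3 - contra d3 c2 + \<tau> d2 d3) - contra (commutator d2 d3) c1
        + \<tau> d1 (commutator d2 d3)
     + (sg l2 (brL l3 l1 + d3 l1 - d1 l3)
        + contra d2 (sg l3 l1 + contra d3 c1 - contra d1 c3 + \<tau> d3 d1) - contra (commutator d3 d1) c2
        + \<tau> d2 (commutator d3 d1))
     + (sg l3 (brL l1 l2 + d1 l2 - d2 l1)
        + contra d3 (sg l1 l2 + contra d1 c2 - contra d2 c1 + \<tau> d1 d2) - contra (commutator d1 d2) c3
        + \<tau> d3 (commutator d1 d2)) = 0"
    using m by (simp add: sigma_add_right sigma_diff_right contra_add_right contra_diff_right contra_sigma
        contra_commutator s t cyc tc)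
  have b: "brL (d1 l2) l3 = - brL l3 (d1 l2)" "brL (d2 l3) l1 = - brL l1 (d2 l3)" "brL (d3 l1) l2 = - brL l2 (d3 l1)"
    by (rule br_skew; simp)+
  have bj: "brL l3 (brL l1 l2) = - brL l1 (brL l2 l3) - brL l2 (brL l3 l1)"
    using jacobi[of l1 l2 l3] by (simp add: eq_neg_iff_add_eq_0 algebra_simps)
  have brd: "brL w (u + v) = brL w u + brL w v" "brL w (u - v) = brL w u - brL w v" for u v w
    using br_add_right[of u v w] br_add_right[of u "- v" w] br_minus_right[of w v] by auto
  have 2: "brL l1 (brL l2 l3 + d2 l3 - d3 l2) + d1 (brL l2 l3 + d2 l3 - d3 l2) - commutator d2 d3 l1
      + (brL l2 (brL l3 l1 + d3 l1 - d1 l3) + d2 (brL l3 l1 + d3 l1 - d1 l3) - commutator d3 d1 l2)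
      + (brL l3 (brL l1 l2 + d1 l2 - d2 l1) + d3 (brL l1 l2 + d1 l2 - d2 l1) - commutator d1 d2 l3) = 0"
    using m by (simp add: brd D_add D_diff D_derivation b bj commutator_def)
  have 3: "commutator d1 (commutator d2 d3) + commutator d2 (commutator d3 d1) + commutator d3 (commutator d1 d2) = 0"
    using m by (auto simp: commutator_def fun_eq_iff D_diff)
  show ?thesis unfolding e brE_apply using 1 2 3 by (simp only: add_Pair zero_prod_def)
qed

lemma lie_algebra_E: "lie_algebra sE Ecar brE"
  by unfold_locales (use E_subspace brE_closed brE_bilinear brE_alternating brE_jacobi in auto)

lemma BE_sym: "BE x y = BE y x"
proof -
  obtain c1 l1 d1 c2 l2 d2 where "x = (c1, l1, d1)" "y = (c2, l2, d2)" by (metis prod_cases3)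
  then show ?thesis using form_sym[of l1 l2] by (simp add: BE_apply)
qed

lemma BE_bilinear: "bilinear_on sE (*) Ecar BE"
proof -
  have add: "BE (x + y) z = BE x z + BE y z" if xyz: "x \<in> Ecar" "y \<in> Ecar" "z \<in> Ecar" for x y z
  proof -
    obtain c1 l1 d1 c2 l2 d2 c3 l3 d3 where e: "x = (c1, l1, d1)" "y = (c2, l2, d2)" "z = (c3, l3, d3)"
      by (metis prod_cases3)
    have m: "c3 \<in> C" "d1 \<in> D" "d2 \<in> D" using xyz e by auto
    show ?thesis unfolding e by (simp add: BE_apply C_add[OF m] form_add_left)
  qed
  moreover have sc: "BE (sE k x) y = k * BE x y" if xy: "x \<in> Ecar" "y \<in> Ecar" for k x y
  proof -
    obtain c1 l1 d1 c2 l2 d2 where e: "x = (c1, l1, d1)" "y = (c2, l2, d2)" by (metis prod_cases3)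
    have m: "c2 \<in> C" "d1 \<in> D" using xy e by auto
    show ?thesis unfolding e
      by (simp add: BE_apply sE_apply C_scale[OF m] form_scale_left fun_scale_def[of "(*)"] distrib_left)
  qed
  ultimately show ?thesis using BE_sym by (simp add: bilinear_on_def)
qed

lemma BE_invariant:
  assumes "x \<in> Ecar" "y \<in> Ecar" "z \<in> Ecar" shows "BE (brE x y) z = BE x (brE y z)"
proof -
  obtain c1 l1 d1 c2 l2 d2 c3 l3 d3 where e: "x = (c1, l1, d1)" "y = (c2, l2, d2)" "z = (c3, l3, d3)"
    by (metis prod_cases3)
  have m: "c1 \<in> C" "c2 \<in> C" "c3 \<in> C" "d1 \<in> D" "d2 \<in> D" "d3 \<in> D" using assms e by auto
  have n: "c2 (commutator d1 d3) = - c2 (commutator d3 d1)" "c3 (commutator d2 d1) = - c3 (commutator d1 d2)"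
    using C_minus[OF m(2)] C_minus[OF m(3)] m D_closed commutator_skew by metis+
  have "BL (d2 l1) l3 = - BL l1 (d2 l3)" "BL l1 (d3 l2) = - BL (d3 l1) l2"
    using D_skew m by auto
  then show ?thesis unfolding e
    using m n tau_cyclic[of d1 d2 d3]
    by (simp add: brE_apply BE_apply sigma_apply contra_apply form_add_left form_add_right form_diff_left
        form_diff_right form_invariant)
qed

text \<open>\<open>C\<close> separates the points of \<open>D\<close> because it contains the image of \<open>\<sigma>\<close>, and the form on \<open>L\<close> is nondegenerate.\<close>

lemma BE_nondegenerate: "nondegenerate_on Ecar BE"
  unfolding nondegenerate_on_def
proof (intro ballI impI)
  fix x assume x: "x \<in> Ecar" "\<forall>y\<in>Ecar. BE x y = 0"
  obtain c l d where e: "x = (c, l, d)" by (metis prod_cases3)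
  have m: "c \<in> C" "d \<in> D" using x e by auto
  have "BL l l' = 0" for l'
  proof -
    have "BE x (0, l', 0) = 0" using x(2) C_zero_in D_zero_in by blast
    then show ?thesis using C_zero[OF m(1)] by (simp add: e BE_apply)
  qed
  then have l: "l = 0" by (rule form_nondegenerate)
  have "c d' = 0" if "d' \<in> D" for d'
  proof -
    have "BE x (0, 0, d') = 0" using x(2) C_zero_in that by blast
    then show ?thesis using form_zero_right by (simp add: e BE_apply)
  qed
  then have c: "c = 0" using m C_zero_in by (intro C_eqI) auto
  have "d l' = 0" for l'
  proof (rule form_nondegenerate)
    fix l''
    have "BE x (sg l' l'', 0, 0) = 0" using x(2) sigma_C D_zero_in by blast
    then show "BL (d l') l'' = 0" using form_zero_right m C_zero[OF m(1)]
      by (simp add: e BE_apply sigma_apply)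
  qed
  then have "d = 0" by auto
  then show "x = 0" using l c e by (simp add: zero_prod_def)
qed

lemma TD_determined:
  assumes t: "t \<in> TD" and van: "\<And>\<xi> \<nu>. \<xi> \<in> S \<Longrightarrow> Lg \<xi> \<nu> \<noteq> {0} \<Longrightarrow> evt \<nu> t = 0" shows "t = 0"
proof
  fix x show "t x = 0 x"
  proof (induction x rule: L_induct)
    case (homogeneous q \<nu> x)
    show ?case
    proof (cases "x = 0")
      case False
      then have "evt \<nu> t = 0" using van[OF homogeneous(1)] homogeneous(2) by blast
      then show ?thesis using TD_acts[OF t Lg_degree_part[OF lattice_S homogeneous(2)]] homogeneous(1) by simp
    qed (use D_zero TD_D t in simp)
  qed (use D_zero[OF TD_D[OF t]] D_add[OF TD_D[OF t]] in auto)
qed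

lemma sigma_choice_TD:
  assumes "t \<in> TD" "\<xi> \<in> S" "Lg \<xi> \<nu> \<noteq> {0}"
  shows "sg (e \<xi> \<nu>) (f \<xi> \<nu>) t = evt \<nu> t * BL (e \<xi> \<nu>) (f \<xi> \<nu>)"
  using TD_acts[OF assms(1) Lg_degree_part[OF lattice_S choice_in(1)]] assms TD_D
  by (simp add: sigma_apply form_scale_left)

text \<open>The pairing of \<open>T\<^sub>C\<close> and \<open>T\<^sub>D\<close> is nondegenerate in \<open>T\<^sub>C\<close> by hypothesis. It is nondegenerate in \<open>T\<^sub>D\<close>
  because \<open>T\<^sub>C\<close> contains elements \<open>\<sigma>(e, f)\<close> that restrict to nonzero multiples of the evaluations at the
  degrees of \<open>L\<close>, and these evaluations determine a degree derivation.\<close>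

lemma BE_T_nondegenerate: "nondegenerate_on T BE"
  unfolding nondegenerate_on_def
proof (intro ballI impI)
  fix x assume x: "x \<in> T" "\<forall>y\<in>T. BE x y = 0"
  obtain c l d where e: "x = (c, l, d)" by (metis prod_cases3)
  have m: "c \<in> TC" "l \<in> cartan_subspace" "d \<in> TD" using x e by auto
  have z: "0 \<in> TC" "0 \<in> cartan_subspace" "0 \<in> TD"
    using C_space.subspace_0[OF TC_subspace] subspace_0[OF cartan_subspace_subspace] TD_zero_in by auto
  have "BL l l' = 0" if "l' \<in> cartan_subspace" for l'
  proof -
    have "BE x (0, l', 0) = 0" using x(2) z that by blast
    then show ?thesis using C_zero[OF TC_C[OF m(1)]] by (simp add: e BE_apply)
  qed
  then have l: "l = 0" using cartan_nondegenerate m(2) by (auto simp: nondegenerate_on_def)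
  have "c d' = 0" if "d' \<in> TD" for d'
  proof -
    have "BE x (0, 0, d') = 0" using x(2) z that by blast
    then show ?thesis using form_zero_right by (simp add: e BE_apply)
  qed
  then have "restrict c TD = restrict 0 TD" by (auto simp: restrict_def fun_eq_iff)
  then have c: "c = 0" using TC_injective m(1) z(1) by (auto dest: inj_onD)
  have "d = 0"
  proof (rule TD_determined[OF m(3)])
    fix \<xi> \<nu> assume \<xi>: "\<xi> \<in> S" "Lg \<xi> \<nu> \<noteq> {0}"
    have "BE x (sg (e \<xi> \<nu>) (f \<xi> \<nu>), 0, 0) = 0" using x(2) z TC_sigma[OF \<xi>] by blast
    then have "sg (e \<xi> \<nu>) (f \<xi> \<nu>) d = 0"
      using form_zero_right C_zero[OF TC_C[OF m(1)]] by (simp add: e BE_apply)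
    then show "evt \<nu> d = 0" using sigma_choice_TD[OF m(3) \<xi>] choice_form_nonzero[OF \<xi>] by simp
  qed
  then show "x = 0" using l c e by (simp add: zero_prod_def)
qed

subsection \<open>Weights\<close>

definition E_part :: "'y \<times> 'g \<Rightarrow> ((('l \<Rightarrow> 'l) \<Rightarrow> 'k) \<times> 'l \<times> ('l \<Rightarrow> 'l)) set" where
  "E_part = (\<lambda>(q, \<nu>). (if q = 0 then Cg \<nu> else {0}) \<times> Lg q \<nu> \<times> (if q = 0 then Dg \<nu> else {0}))"

text \<open>The functional through which \<open>T\<close> acts on the part of the extension with the given root and degree.\<close>

definition weight :: "'y \<times> 'g \<Rightarrow> (('l \<Rightarrow> 'l) \<Rightarrow> 'k) \<times> 'l \<times> ('l \<Rightarrow> 'l) \<Rightarrow> 'k" where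
  "weight = (\<lambda>(q, \<nu>) (c, x, t). if (c, x, t) \<in> T then cartan_weight x q + evt \<nu> t else 0)"

lemma weight_apply: "(c, x, t) \<in> T \<Longrightarrow> weight (q, \<nu>) (c, x, t) = cartan_weight x q + evt \<nu> t"
  by (simp add: weight_def)

lemma weight_dual: "weight i \<in> dual_on sE T"
proof -
  obtain q \<nu> where i: "i = (q, \<nu>)" by (cases i)
  have "weight (q, \<nu>) (x + y) = weight (q, \<nu>) x + weight (q, \<nu>) y" if xy: "x \<in> T" "y \<in> T" for x y
  proof -
    obtain c1 l1 d1 c2 l2 d2 where e: "x = (c1, l1, d1)" "y = (c2, l2, d2)" by (metis prod_cases3)
    have "x + y \<in> T" using xy T_subspace E_space.subspace_add by blast
    then show ?thesis unfolding e using xy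
      by (simp add: e weight_apply cartan_weight_add ev_add del: mem_Sigma_iff) (simp add: cartan_weight_add ev_add)
  qed
  moreover have "weight (q, \<nu>) (sE k x) = k * weight (q, \<nu>) x" if xT: "x \<in> T" for k x
  proof -
    obtain c1 l1 d1 where e: "x = (c1, l1, d1)" by (metis prod_cases3)
    have "sE k x \<in> T" using xT T_subspace E_space.subspace_scale by blast
    then show ?thesis unfolding e using xT
      by (simp add: e sE_apply weight_apply del: mem_Sigma_iff) (simp add: cartan_weight_scale ev_scale distrib_left)
  qed
  moreover have "weight (q, \<nu>) x = 0" if "x \<notin> T" for x
    using that by (cases x) (simp add: weight_def del: mem_Sigma_iff)
  ultimately show ?thesis unfolding i dual_on_def by (intro CollectI conjI ballI allI impI; simp only:)
qed

lemma zero_TC: "0 \<in> TC" by (rule C_space.subspace_0[OF TC_subspace])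

lemma zero_cartan: "0 \<in> cartan_subspace" by (rule subspace_0[OF cartan_subspace_subspace])

lemma cartan_weight_zero: "cartan_weight 0 q = 0"
  using cartan_weight_scale[OF zero_cartan, of 0 q] by simp

lemma ev_zero: "evt \<nu> 0 = 0"
  using ev_add[OF TD_zero_in TD_zero_in, of \<nu>] by simp

text \<open>\<open>T\<^sub>D\<close> separates degrees, and the Cartan subspace separates points of the root lattice.\<close>

lemma weight_inj: "inj_on weight (group_closure S \<times> UNIV)"
proof (rule inj_onI)
  fix i j assume i: "i \<in> group_closure S \<times> (UNIV :: 'g set)"
    and j: "j \<in> group_closure S \<times> (UNIV :: 'g set)"
    and eq: "weight i = weight j"
  obtain q \<nu> p \<mu> where e: "i = (q, \<nu>)" "j = (p, \<mu>)" by (metis surj_pair)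
  have "\<nu> = \<mu>"
  proof (rule ev_separates)
    fix t assume t: "t \<in> TD"
    have "weight i (0, 0, t) = weight j (0, 0, t)" using eq by simp
    then show "evt \<nu> t = evt \<mu> t"
      using t zero_TC zero_cartan by (simp add: e weight_apply cartan_weight_zero)
  qed
  moreover have "q - p = 0"
  proof (rule cartan_separates)
    show "q - p \<in> group_closure S" using i j e group_closure.diff by auto
    fix x assume x: "x \<in> cartan_subspace"
    have "weight i (0, x, 0) = weight j (0, x, 0)" using eq by simp
    then have "cartan_weight x q = cartan_weight x p"
      using x zero_TC TD_zero_in by (simp add: e weight_apply ev_zero)
    then show "cartan_weight x (q - p) = 0"
      using cartan_weight_add_root[OF x, of q "-p"] cartan_weight_minus_root[OF x, of p] by simp
  qed
  ultimately show "i = j" by (simp add: e)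
qed

lemma cartan_degree_0: "x \<in> cartan_subspace \<Longrightarrow> x \<in> Ldeg 0"
  using cartan_subspace_degree Lg_degree_part[of 0 x 0] by auto

lemma brE_T:
  assumes "(tc, x, t) \<in> T" "c \<in> C" "d \<in> D"
  shows "brE (tc, x, t) (c, l, d) = (contra t c, brL x l + t l, commutator t d)"
proof -
  have m: "tc \<in> TC" "x \<in> cartan_subspace" "t \<in> TD" using assms(1) by auto
  show ?thesis
    using assms(3) contra_TC[OF m(1) assms(3)] sigma_degree_0_left[OF cartan_degree_0[OF m(2)]] tau_toral[OF m(3) assms(3)]
      D_kills_degree_0[OF assms(3) cartan_degree_0[OF m(2)]] by (simp add: brE_apply)
qed

lemma T_acts:
  assumes "i \<in> group_closure S \<times> UNIV" "t \<in> T" "x \<in> E_part i"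
  shows "brE t x = sE (weight i t) x"
proof -
  obtain q \<nu> where i: "i = (q, \<nu>)" by (cases i)
  obtain tc y u where t: "t = (tc, y, u)" by (metis prod_cases3)
  obtain c l d where x: "x = (c, l, d)" by (metis prod_cases3)
  have q: "q \<in> group_closure S" and T: "(tc, y, u) \<in> T" and y: "y \<in> cartan_subspace"
    and u: "u \<in> TD"
    using assms i t by auto
  have m: "c \<in> (if q = 0 then Cg \<nu> else {0})" "l \<in> Lg q \<nu>" "d \<in> (if q = 0 then Dg \<nu> else {0})"
    using assms(3) by (auto simp: E_part_def i x)
  have cd: "c \<in> C" "d \<in> D" using m C_zero_in D_zero_in Cg_in Dg_in by (auto split: if_splits)
  have l: "brL y l + u l = sL (cartan_weight y q + evt \<nu> u) l"
    using cartan_acts[OF y q m(2)] TD_acts[OF u Lg_degree_part[OF q m(2)]] by (simp add: scale_left_distrib)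
  have c: "contra u c = sC (cartan_weight y q + evt \<nu> u) c"
  proof (cases "q = 0")
    case True
    then show ?thesis using TD_contra[OF u] m(1) cartan_weight_zero_root[OF y] by simp
  next
    case False
    then have "c = 0" using m by simp
    then show ?thesis by (auto simp: contragredient_def fun_scale_def)
  qed
  have d: "commutator u d = sF (cartan_weight y q + evt \<nu> u) d"
  proof (cases "q = 0")
    case True
    then show ?thesis using TD_commutator[OF u] m(3) cartan_weight_zero_root[OF y] by simp
  next
    case False
    then have "d = 0" using m by simp
    then show ?thesis using D_zero[OF TD_D[OF u]] by (auto simp: commutator_def fun_scale_def)
  qed
  show ?thesis unfolding i t x brE_T[OF T cd] weight_apply[OF T] sE_apply l c d by simp
qed

lemma E_part_subset: "i \<in> group_closure S \<times> UNIV \<Longrightarrow> E_part i \<subseteq> Ecar"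
  using Cg_in Dg_in C_zero_in D_zero_in by (auto simp: E_part_def split: if_splits)

lemma E_graded: "is_direct_sum sE Ecar (group_closure S \<times> UNIV) E_part"
proof -
  define p where "p = (\<lambda>(q, \<nu>) (c, l, d). (if q = 0 then C_space.pr \<nu> c else 0, bigrading.pr (q, \<nu>) l,
    if q = 0 then D_space.pr \<nu> d else 0))"
  show ?thesis
  proof (rule E_space.is_direct_sumI_projections[where p = p])
    fix i assume i: "i \<in> group_closure S \<times> (UNIV :: 'g set)"
    obtain q \<nu> where e: "i = (q, \<nu>)" by (cases i)
    show "E_space.subspace (E_part i)"
      unfolding e E_part_def prod.case
      by (rule subspace_product)
        (use i e C_space.part_subspace[of \<nu>] D_space.part_subspace[of \<nu>] Lg_subspace[of q \<nu>] in auto)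
    show "E_part i \<subseteq> Ecar" by (rule E_part_subset[OF i])
  next
    show "Ecar \<subseteq> E_space.span (\<Union>i\<in>group_closure S \<times> UNIV. E_part i)" (is "_ \<subseteq> E_space.span ?U")
    proof
      fix x assume x: "x \<in> Ecar"
      obtain c l d where e: "x = (c, l, d)" by (metis prod_cases3)
      have zero: "0 \<in> Cg \<nu>" "0 \<in> Dg \<nu>" for \<nu>
        using C_space.subspace_0[OF C_space.part_subspace] D_space.subspace_0[OF D_space.part_subspace]
          by auto
      have zL: "0 \<in> Lg q \<nu>" if "q \<in> group_closure S" for q \<nu>
        using subspace_0[OF Lg_subspace[OF that]] .
      have in_U: "y \<in> E_space.span ?U" if "i \<in> group_closure S \<times> UNIV" "y \<in> E_part i" for y i
        using that by (blast intro: E_space.span_base)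
      have "c \<in> C" "d \<in> D" using x e by auto
      have "(c, 0, 0) \<in> E_space.span ?U" using \<open>c \<in> C\<close>
      proof (induction rule: C_induct)
        case zero
        show ?case using E_space.span_zero[of ?U] unfolding zero_prod_def .
      next
        case (homogeneous \<nu> c)
        have "(c, 0, 0) \<in> E_part (0, \<nu>)" using homogeneous zero zL[of 0] by (simp add: E_part_def)
        then show ?case by (rule in_U[rotated]) simp
      next
        case (add c c')
        show ?case using E_space.span_add[OF add(3,4)] unfolding add_Pair add_0 .
      qed
      moreover have "(0, l, 0) \<in> E_space.span ?U"
      proof (induction l rule: L_induct)
        case zero
        show ?case using E_space.span_zero[of ?U] unfolding zero_prod_def .
      next
        case (homogeneous q \<nu> l)
        have "(0, l, 0) \<in> E_part (q, \<nu>)" using homogeneous zero by (simp add: E_part_def)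
        then show ?case by (rule in_U[rotated]) (use lattice_S[OF homogeneous(1)] in simp)
      next
        case (add c c')
        show ?case using E_space.span_add[OF add] unfolding add_Pair add_0 .
      qed
      moreover have "(0, 0, d) \<in> E_space.span ?U" using \<open>d \<in> D\<close>
      proof (induction rule: D_induct)
        case zero
        show ?case using E_space.span_zero[of ?U] unfolding zero_prod_def .
      next
        case (homogeneous \<nu> c)
        have "(0, 0, c) \<in> E_part (0, \<nu>)" using homogeneous zero zL[of 0] by (simp add: E_part_def)
        then show ?case by (rule in_U[rotated]) simp
      next
        case (add c c')
        show ?case using E_space.span_add[OF add(3,4)] unfolding add_Pair add_0 .
      qed
      ultimately have "(c, 0, 0) + ((0, l, 0) + (0, 0, d)) \<in> E_space.span ?U"
        using E_space.span_add by blast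
      then show "x \<in> E_space.span ?U" by (simp add: e)
    qed
  next
    fix i :: "'y \<times> 'g" and x y assume xy: "x \<in> Ecar" "y \<in> Ecar"
    obtain q \<nu> where i: "i = (q, \<nu>)" by (cases i)
    obtain c l d c' l' d' where e: "x = (c, l, d)" "y = (c', l', d')" by (metis prod_cases3)
    have "c \<in> C" "c' \<in> C" "d \<in> D" "d' \<in> D" using xy e by auto
    then show "p i (x + y) = p i x + p i y"
      by (simp add: p_def i e C_space.pr_add D_space.pr_add bigrading.pr_add)
  next
    fix i j x assume i: "i \<in> group_closure S \<times> (UNIV :: 'g set)"
      and j: "j \<in> group_closure S \<times> (UNIV :: 'g set)"
      and x: "x \<in> E_part j"
    obtain q \<nu> r \<mu> where ij: "i = (q, \<nu>)" "j = (r, \<mu>)" by (metis surj_pair)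
    obtain c l d where e: "x = (c, l, d)" by (metis prod_cases3)
    have m: "c \<in> (if r = 0 then Cg \<mu> else {0})" "l \<in> Lg r \<mu>" "d \<in> (if r = 0 then Dg \<mu> else {0})"
      using x by (auto simp: E_part_def ij e)
    have l: "bigrading.pr (q, \<nu>) l = (if j = i then l else 0)"
      using bigrading.pr_homogeneous[of j l "(q, \<nu>)"] j m(2) ij by auto
    have c: "(if q = 0 then C_space.pr \<nu> c else 0) = (if j = i then c else 0)"
      using C_space.pr_homogeneous[of \<mu> c \<nu>] C_space.pr_zero m(1) ij
        by (auto split: if_splits simp del: zero_fun_apply)
    have d: "(if q = 0 then D_space.pr \<nu> d else 0) = (if j = i then d else 0)"
      using D_space.pr_homogeneous[of \<mu> d \<nu>] D_space.pr_zero m(3) ij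
        by (auto split: if_splits simp del: zero_fun_apply)
    have "p i x = (if j = i then c else 0, if j = i then l else 0, if j = i then d else 0)"
      unfolding p_def e ij prod.case using l c d ij by simp
    then show "p i x = (if j = i then x else 0)" by (simp add: e zero_prod_def)
  qed (rule E_subspace)
qed

lemmas toral_E = toral_grading[OF lie_algebra_E T_subset E_graded weight_dual weight_inj T_acts]

end

sublocale affine_extension_data \<subseteq>
  EL: lie_algebra "E_scale sL" "C \<times> (UNIV :: 'l set) \<times> D" "E_bracket brL BL D \<tau>"
  by (rule lie_algebra_E)

section \<open>The extension as an invariant affine reflection algebra\<close>

context affine_extension_data begin

abbreviation rs where "rs \<equiv> root_space sE Ecar brE T"
abbreviation Rts where "Rts \<equiv> roots sE Ecar brE T"
abbreviation An where "An \<equiv> anisotropic_roots sE Ecar brE T BE"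
abbreviation supported where "supported \<xi> \<nu> \<equiv> \<xi> \<in> S \<and> Lg \<xi> \<nu> \<noteq> {0}"

lemma Lg_zero: "q \<in> group_closure S \<Longrightarrow> 0 \<in> Lg q \<nu>"
  by (rule subspace_0[OF Lg_subspace])

lemma supported_exists: assumes "\<xi> \<in> S - {0}" shows "\<exists>\<nu>. supported \<xi> \<nu>"
proof -
  obtain \<nu> e f where "invertible_with S co sL brL Lg \<xi> \<nu> e f"
    by (rule invertible_exists[OF assms])
  then show ?thesis using assms by (auto simp: invertible_with_def)
qed

text \<open>\<open>C\<close> and \<open>D\<close> contribute only in degrees where \<open>L\<^sub>0\<close> is nonzero.\<close>

lemma E_part_nonzero_iff:
  assumes q: "q \<in> group_closure S" shows "E_part (q, \<nu>) \<noteq> {0} \<longleftrightarrow> supported q \<nu>"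
proof
  assume nz: "E_part (q, \<nu>) \<noteq> {0}"
  have "Lg q \<nu> \<noteq> {0}"
  proof
    assume z: "Lg q \<nu> = {0}"
    have "E_part (q, \<nu>) = {0}"
    proof (cases "q = 0")
      case True
      then have "Cg \<nu> = {0}" "Dg \<nu> = {0}"
        using z C_nonzero_degree[of \<nu>] D_nonzero_degree[of \<nu>] by metis+
      then show ?thesis using z True by (simp add: E_part_def zero_prod_def)
    qed (simp add: E_part_def zero_prod_def z)
    then show False using nz by simp
  qed
  moreover have "q \<in> S"
  proof (rule ccontr)
    assume "q \<notin> S"
    then have "Lg q \<nu> = {0}" using Lg_eq_0[OF q] Lg_zero[OF q] by auto
    then show False using \<open>Lg q \<nu> \<noteq> {0}\<close> by simp
  qed
  ultimately show "supported q \<nu>" by simp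
next
  assume s: "supported q \<nu>"
  then obtain x where x: "x \<in> Lg q \<nu>" "x \<noteq> 0" using Lg_zero[OF q] by auto
  have "(0, x, 0) \<in> E_part (q, \<nu>)"
    using x C_space.subspace_0[OF C_space.part_subspace] D_space.subspace_0[OF D_space.part_subspace]
    by (simp add: E_part_def)
  then show "E_part (q, \<nu>) \<noteq> {0}" using x by (auto simp: zero_prod_def)
qed

lemma rs_weight: "q \<in> group_closure S \<Longrightarrow> rs (weight (q, \<nu>)) = E_part (q, \<nu>)"
  by (rule toral_E(2)) auto

lemma roots_eq: "Rts = {weight (\<xi>, \<nu>) | \<xi> \<nu>. supported \<xi> \<nu>}"
proof
  show "Rts \<subseteq> {weight (\<xi>, \<nu>) | \<xi> \<nu>. supported \<xi> \<nu>}"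
  proof
    fix \<alpha> assume \<alpha>: "\<alpha> \<in> Rts"
    then have d: "\<alpha> \<in> dual_on sE T" "rs \<alpha> \<noteq> {0}" by (auto simp: roots_def)
    then have "\<alpha> \<in> weight ` (group_closure S \<times> UNIV)" using toral_E(3) by blast
    then obtain q \<nu> where q: "q \<in> group_closure S" "\<alpha> = weight (q, \<nu>)" by auto
    then have "supported q \<nu>" using d rs_weight E_part_nonzero_iff by simp
    then show "\<alpha> \<in> {weight (\<xi>, \<nu>) | \<xi> \<nu>. supported \<xi> \<nu>}" using q by blast
  qed
  show "{weight (\<xi>, \<nu>) | \<xi> \<nu>. supported \<xi> \<nu>} \<subseteq> Rts"
  proof
    fix \<alpha> assume "\<alpha> \<in> {weight (\<xi>, \<nu>) | \<xi> \<nu>. supported \<xi> \<nu>}"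
    then obtain \<xi> \<nu> where s: "supported \<xi> \<nu>" and \<alpha>: "\<alpha> = weight (\<xi>, \<nu>)"
      by blast
    then have "\<xi> \<in> group_closure S" using lattice_S by blast
    then have "rs \<alpha> \<noteq> {0}" unfolding \<alpha> using s rs_weight E_part_nonzero_iff by metis
    then show "\<alpha> \<in> Rts" unfolding roots_def using weight_dual \<alpha> by blast
  qed
qed

lemma weight_add:
  "weight (p + q, \<nu> + \<mu>) = weight (p, \<nu>) + weight (q, \<mu>)"
proof
  fix x show "weight (p + q, \<nu> + \<mu>) x = (weight (p, \<nu>) + weight (q, \<mu>)) x"
    using cartan_weight_add_root additive.add[OF ev_additive]
    by (cases x) (auto simp: weight_def)
qed

lemma weight_zero: "weight (0, 0) = 0"
  using weight_add[of 0 0 0 0] by simp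

lemma weight_minus: "weight (- q, - \<nu>) = - weight (q, \<nu>)"
  using weight_add[of "- q" q "- \<nu>" \<nu>] weight_zero by (simp add: eq_neg_iff_add_eq_0)

lemma contra_zero_left: assumes "c \<in> C" shows "contra 0 c = 0"
proof -
  have "contra 0 c d = 0" for d
  proof (cases "d \<in> D")
    case True
    then show ?thesis
      using commutator_zero_left[OF True] C_zero[OF assms] by (simp add: contra_apply del: zero_fun_apply)
  qed (simp add: contragredient_def)
  then show ?thesis by (simp add: fun_eq_iff)
qed

lemma sigma_zero_left: "sg 0 x = 0"
  by (rule sigma_degree_0_left) (rule subspace_0[OF degree.part_subspace], simp)

lemma BE_add_left: "x \<in> Ecar \<Longrightarrow> y \<in> Ecar \<Longrightarrow> z \<in> Ecar \<Longrightarrow> BE (x + y) z = BE x z + BE y z"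
  and BE_add_right: "x \<in> Ecar \<Longrightarrow> y \<in> Ecar \<Longrightarrow> z \<in> Ecar \<Longrightarrow> BE z (x + y) = BE z x + BE z y"
  and BE_scale_left: "x \<in> Ecar \<Longrightarrow> y \<in> Ecar \<Longrightarrow> BE (sE k x) y = k * BE x y"
  and BE_scale_right: "x \<in> Ecar \<Longrightarrow> y \<in> Ecar \<Longrightarrow> BE x (sE k y) = k * BE x y"
  using BE_bilinear unfolding bilinear_on_def by metis+

lemma brE_CL:
  assumes "c1 \<in> C" "c2 \<in> C"
  shows "brE (c1, l1, 0) (c2, l2, 0) = (sg l1 l2, brL l1 l2, 0)"
proof -
  show ?thesis
    using assms tau_zero D_zero_in contra_zero_left by (simp add: brE_apply commutator_self)
qed

lemma choice_E:
  assumes "supported \<xi> \<nu>"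
  shows "(0, e \<xi> \<nu>, 0) \<in> E_part (\<xi>, \<nu>)" "(0, f \<xi> \<nu>, 0) \<in> E_part (- \<xi>, - \<nu>)"
    and "brE (0, e \<xi> \<nu>, 0) (0, f \<xi> \<nu>, 0) = (sg (e \<xi> \<nu>) (f \<xi> \<nu>), if \<xi> = 0 then 0 else - coroot_element \<xi>, 0)"
    and "brE (0, e \<xi> \<nu>, 0) (0, f \<xi> \<nu>, 0) \<in> T"
    and "BE (0, e \<xi> \<nu>, 0) (0, f \<xi> \<nu>, 0) = BL (e \<xi> \<nu>) (f \<xi> \<nu>)"
proof -
  have z: "0 \<in> Cg \<kappa>" "0 \<in> Dg \<kappa>" for \<kappa>
    using C_space.subspace_0[OF C_space.part_subspace] D_space.subspace_0[OF D_space.part_subspace] by auto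
  show "(0, e \<xi> \<nu>, 0) \<in> E_part (\<xi>, \<nu>)" "(0, f \<xi> \<nu>, 0) \<in> E_part (- \<xi>, - \<nu>)"
    using choice_in[of \<xi> \<nu>] assms z by (auto simp: E_part_def)
  show eq: "brE (0, e \<xi> \<nu>, 0) (0, f \<xi> \<nu>, 0) = (sg (e \<xi> \<nu>) (f \<xi> \<nu>), if \<xi> = 0 then 0 else - coroot_element \<xi>, 0)"
    using brE_CL[OF C_zero_in C_zero_in] choice_bracket[of \<xi> \<nu>] assms by simp
  show "brE (0, e \<xi> \<nu>, 0) (0, f \<xi> \<nu>, 0) \<in> T"
    unfolding eq using TC_sigma[of \<xi> \<nu>] assms zero_cartan TD_zero_in coroot_element_cartan[of \<xi>]
      subspace_neg[OF cartan_subspace_subspace] by auto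
  show "BE (0, e \<xi> \<nu>, 0) (0, f \<xi> \<nu>, 0) = BL (e \<xi> \<nu>) (f \<xi> \<nu>)"
    by (simp add: BE_apply)
qed

text \<open>The multiple of \<open>[e, f]\<close> that represents the weight on \<open>T\<close> with respect to the form.\<close>

definition weight_vector :: "'y \<Rightarrow> 'g \<Rightarrow> (('l \<Rightarrow> 'l) \<Rightarrow> 'k) \<times> 'l \<times> ('l \<Rightarrow> 'l)" where
  "weight_vector \<xi> \<nu> = sE (inverse (BL (e \<xi> \<nu>) (f \<xi> \<nu>))) (brE (0, e \<xi> \<nu>, 0) (0, f \<xi> \<nu>, 0))"

text \<open>Invariance of the form gives \<open>([e, f] | t) = \<alpha>(t) (e | f)\<close> for a root \<open>\<alpha>\<close>.\<close>

lemma weight_vector_represents: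
  assumes s: "supported \<xi> \<nu>"
  shows "weight_vector \<xi> \<nu> \<in> T"
    and "t \<in> T \<Longrightarrow> BE (weight_vector \<xi> \<nu>) t = weight (\<xi>, \<nu>) t"
proof -
  let ?e = "(0, e \<xi> \<nu>, 0)" and ?f = "(0, f \<xi> \<nu>, 0)"
    and ?B = "BL (e \<xi> \<nu>) (f \<xi> \<nu>)"
  show "weight_vector \<xi> \<nu> \<in> T" unfolding weight_vector_def
    by (rule EL.subspace_scale[OF T_subspace choice_E(4)[OF s]])
  assume t: "t \<in> T"
  have \<xi>: "(\<xi>, \<nu>) \<in> group_closure S \<times> UNIV" "(- \<xi>, - \<nu>) \<in> group_closure S \<times> UNIV" using s lattice_S by auto
  have E: "?e \<in> Ecar" "?f \<in> Ecar" using C_zero_in D_zero_in by auto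
  have tE: "t \<in> Ecar" using t T_subset by blast
  have "BE (brE ?e ?f) t = BE (brE t ?e) ?f" using BE_invariant[OF tE E] BE_sym by simp
  also have "\<dots> = BE (sE (weight (\<xi>, \<nu>) t) ?e) ?f" using T_acts[OF \<xi>(1) t choice_E(1)[OF s]]
    by simp
  also have "\<dots> = weight (\<xi>, \<nu>) t * ?B"
    using BE_scale_left[OF E] choice_E(5)[OF s] by simp
  finally have "BE (brE ?e ?f) t = weight (\<xi>, \<nu>) t * ?B" .
  moreover have "BE (weight_vector \<xi> \<nu>) t = inverse ?B * BE (brE ?e ?f) t"
    unfolding weight_vector_def by (rule BE_scale_left[OF EL.bracket_closed[OF E] tE])
  ultimately show "BE (weight_vector \<xi> \<nu>) t = weight (\<xi>, \<nu>) t"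
    using choice_form_nonzero[of \<xi> \<nu>] s by simp
qed

lemma root_representative_eq:
  assumes s: "supported \<xi> \<nu>"
  shows "root_representative T BE (weight (\<xi>, \<nu>)) = weight_vector \<xi> \<nu>"
  unfolding root_representative_def
proof (rule the_equality)
  show "weight_vector \<xi> \<nu> \<in> T \<and> (\<forall>t'\<in>T. BE (weight_vector \<xi> \<nu>) t' = weight (\<xi>, \<nu>) t')"
    using weight_vector_represents[OF s] by blast
next
  fix t assume t: "t \<in> T \<and> (\<forall>t'\<in>T. BE t t' = weight (\<xi>, \<nu>) t')"
  have w: "weight_vector \<xi> \<nu> \<in> T" by (rule weight_vector_represents(1)[OF s])
  have d: "t - weight_vector \<xi> \<nu> \<in> T" by (rule EL.subspace_diff[OF T_subspace]) (use t w in auto)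
  have "BE (t - weight_vector \<xi> \<nu>) t' = 0" if t': "t' \<in> T" for t'
  proof -
    have "BE t t' = BE ((t - weight_vector \<xi> \<nu>) + weight_vector \<xi> \<nu>) t'" by simp
    also have "\<dots> = BE (t - weight_vector \<xi> \<nu>) t' + BE (weight_vector \<xi> \<nu>) t'"
      by (rule BE_add_left[OF subsetD[OF T_subset d] subsetD[OF T_subset w] subsetD[OF T_subset t']])
    finally show ?thesis using t t' weight_vector_represents(2)[OF s t'] by simp
  qed
  then have "t - weight_vector \<xi> \<nu> = 0"
    using BE_T_nondegenerate d unfolding nondegenerate_on_def by metis
  then show "t = weight_vector \<xi> \<nu>" by simp
qed

text \<open>The square length of a representative is the value of its root there. For \<open>\<xi> = 0\<close> the representative lies in
  \<open>T\<^sub>C\<close>, where all weights vanish; for \<open>\<xi> \<noteq> 0\<close> the coroot takes the value \<open>2\<close> at \<open>\<xi>\<close>.\<close>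

lemma weight_vector_length:
  assumes s: "supported \<xi> \<nu>"
  shows "BE (weight_vector \<xi> \<nu>) (weight_vector \<xi> \<nu>) \<noteq> 0 \<longleftrightarrow> \<xi> \<noteq> 0"
proof -
  let ?k = "inverse (BL (e \<xi> \<nu>) (f \<xi> \<nu>))"
    and ?h = "if \<xi> = 0 then 0 else - coroot_element \<xi>"
  have k: "?k \<noteq> 0" using choice_form_nonzero[of \<xi> \<nu>] s by simp
  have w: "weight_vector \<xi> \<nu> = (sC ?k (sg (e \<xi> \<nu>) (f \<xi> \<nu>)), sL ?k ?h, sF ?k 0)"
    unfolding weight_vector_def choice_E(3)[OF s] by (simp add: sE_apply)
  have z: "sF ?k 0 = (0 :: 'l \<Rightarrow> 'l)" by (rule D_space.scale_zero_right)
  have hc: "?h \<in> cartan_subspace"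
    using zero_cartan coroot_element_cartan[of \<xi>] s subspace_neg[OF cartan_subspace_subspace] by auto
  have "BE (weight_vector \<xi> \<nu>) (weight_vector \<xi> \<nu>) = weight (\<xi>, \<nu>) (weight_vector \<xi> \<nu>)"
    by (rule weight_vector_represents(2)[OF s weight_vector_represents(1)[OF s]])
  also have "\<dots> = cartan_weight (sL ?k ?h) \<xi> + evt \<nu> 0"
    using weight_vector_represents(1)[OF s] unfolding w z by (rule weight_apply)
  also have "\<dots> = ?k * cartan_weight ?h \<xi>"
    using cartan_weight_scale[OF hc] ev_zero by simp
  also have "cartan_weight ?h \<xi> = (if \<xi> = 0 then 0 else - 2)"
  proof (cases "\<xi> = 0")
    case False
    then have \<xi>: "\<xi> \<in> S - {0}" using s by simp
    have "cartan_weight (sL (-1) (coroot_element \<xi>)) \<xi> = - 2"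
      using cartan_weight_scale[OF coroot_element_cartan[OF \<xi>], of "-1"] cartan_weight_coroot_element[OF \<xi>]
        root_system.coroot_two[OF \<xi>] by simp
    then show ?thesis using False by simp
  qed (simp add: cartan_weight_zero)
  finally show ?thesis using k by auto
qed

lemma anisotropic_eq: "An = {weight (\<xi>, \<nu>) | \<xi> \<nu>. supported \<xi> \<nu> \<and> \<xi> \<noteq> 0}"
proof (intro subset_antisym subsetI)
  fix \<alpha> assume \<alpha>: "\<alpha> \<in> An"
  then have "\<alpha> \<in> Rts" unfolding anisotropic_roots_def by blast
  then obtain \<xi> \<nu> where s: "supported \<xi> \<nu>" and w: "\<alpha> = weight (\<xi>, \<nu>)"
    unfolding roots_eq by blast
  have "BE (root_representative T BE \<alpha>) (root_representative T BE \<alpha>) \<noteq> 0"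
    using \<alpha> unfolding anisotropic_roots_def by blast
  then have "\<xi> \<noteq> 0" using weight_vector_length[OF s] unfolding w root_representative_eq[OF s]
    by blast
  then show "\<alpha> \<in> {weight (\<xi>, \<nu>) | \<xi> \<nu>. supported \<xi> \<nu> \<and> \<xi> \<noteq> 0}" using s w by blast
next
  fix \<alpha> assume "\<alpha> \<in> {weight (\<xi>, \<nu>) | \<xi> \<nu>. supported \<xi> \<nu> \<and> \<xi> \<noteq> 0}"
  then obtain \<xi> \<nu> where s: "supported \<xi> \<nu>" and \<xi>: "\<xi> \<noteq> 0"
    and w: "\<alpha> = weight (\<xi>, \<nu>)" by blast
  have "\<alpha> \<in> Rts" unfolding roots_eq using s w by blast
  moreover have "BE (root_representative T BE \<alpha>) (root_representative T BE \<alpha>) \<noteq> 0"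
    using weight_vector_length[OF s] \<xi> unfolding w root_representative_eq[OF s] by blast
  ultimately show "\<alpha> \<in> An" unfolding anisotropic_roots_def by blast
qed

lemma E_part_nonzero_root: "\<xi> \<noteq> 0 \<Longrightarrow> E_part (\<xi>, \<nu>) = {0} \<times> Lg \<xi> \<nu> \<times> {0}"
  by (simp add: E_part_def)

text \<open>The first application removes the component in \<open>D\<close>, finitely many more remove the component in \<open>L\<close>, and a
  last one removes the component in \<open>C\<close>.\<close>

lemma E_ad_locally_nilpotent:
  assumes \<xi>: "\<xi> \<in> S - {0}" and x: "x \<in> Lg \<xi> \<nu>" and y: "y \<in> Ecar"
  shows "\<exists>n. (brE (0, x, 0) ^^ n) y = 0"
proof -
  obtain c l d where e: "y = (c, l, d)" by (metis prod_cases3)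
  have m: "c \<in> C" "d \<in> D" using y e by auto
  have "contra d 0 = 0" by (auto simp: contragredient_def)
  moreover have "contra 0 c = 0" by (rule contra_zero_left[OF m(1)])
  ultimately have first: "brE (0, x, 0) y = (sg x l, brL x l - d x, 0)"
    unfolding e using m by (simp add: brE_apply tau_zero commutator_zero_left)
  have pow: "\<exists>c'\<in>C. (brE (0, x, 0) ^^ n) (c, l, 0) = (c', (brL x ^^ n) l, 0)" if "c \<in> C" for n c l
  proof (induction n)
    case (Suc n)
    then obtain c' where c': "c' \<in> C" "(brE (0, x, 0) ^^ n) (c, l, 0) = (c', (brL x ^^ n) l, 0)" by blast
    have "(brE (0, x, 0) ^^ Suc n) (c, l, 0) = (sg x ((brL x ^^ n) l), (brL x ^^ Suc n) l, 0)"
      using c'(2) brE_CL[OF C_zero_in c'(1)] by simp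
    then show ?case using sigma_C by blast
  qed (use that in simp)
  let ?l = "brL x l - d x"
  obtain n where n: "(brL x ^^ n) ?l = 0" using ad_locally_nilpotent[OF \<xi> x] by blast
  obtain c' where c': "c' \<in> C" "(brE (0, x, 0) ^^ n) (sg x l, ?l, 0) = (c', 0, 0)"
    using pow[OF sigma_C, of n x l ?l] n by auto
  have "sg x 0 = 0" by (auto simp: sigma_def form_zero_right)
  then have "brE (0, x, 0) (c', 0, 0) = 0" using brE_CL[OF C_zero_in c'(1)] br_zero_right
    by (simp add: zero_prod_def)
  then have "(brE (0, x, 0) ^^ Suc n) (brE (0, x, 0) y) = 0" using c' first by simp
  then have "(brE (0, x, 0) ^^ Suc (Suc n)) y = 0" by (simp only: funpow_Suc_right comp_apply)
  then show ?thesis by blast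
qed

lemma nonzero_supported_exists: "\<exists>\<xi> \<nu>. supported \<xi> \<nu> \<and> \<xi> \<noteq> 0"
  using nonzero_root_exists supported_exists by blast

lemma E_invariant_affine_reflection_algebra:
  "invariant_affine_reflection_algebra sE Ecar brE T BE"
  unfolding invariant_affine_reflection_algebra_def
proof (intro conjI ballI impI)
  have "Ecar \<noteq> {0}"
  proof -
    obtain \<xi> \<nu> where "supported \<xi> \<nu>" using nonzero_supported_exists by blast
    then obtain x where "x \<in> Lg \<xi> \<nu>" "x \<noteq> 0" using Lg_zero lattice_S by blast
    then have "(0, x, 0) \<in> Ecar" "(0, x, 0) \<noteq> (0 :: (('l \<Rightarrow> 'l) \<Rightarrow> 'k) \<times> 'l \<times> ('l \<Rightarrow> 'l))"
      using C_zero_in D_zero_in by (auto simp: zero_prod_def)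
    then show ?thesis by blast
  qed
  then show "toral_pair sE Ecar brE T"
    unfolding toral_pair_def using lie_algebra_E T_subspace T_subset toral_E(1) by blast
  show "invariant_form sE Ecar brE BE"
    unfolding invariant_form_def using BE_bilinear BE_sym BE_invariant BE_nondegenerate by blast
  show "nondegenerate_on T BE" by (rule BE_T_nondegenerate)
next
  fix \<alpha> assume "\<alpha> \<in> Rts"
  then obtain \<xi> \<nu> where "supported \<xi> \<nu>" "\<alpha> = weight (\<xi>, \<nu>)" unfolding roots_eq
    by blast
  then show "\<exists>t\<in>T. \<forall>t'\<in>T. BE t t' = \<alpha> t'" using weight_vector_represents
    by blast
next
  fix \<alpha> assume "\<alpha> \<in> Rts" and nz: "\<alpha> \<noteq> 0"
  then obtain \<xi> \<nu> where s: "supported \<xi> \<nu>" and \<alpha>: "\<alpha> = weight (\<xi>, \<nu>)"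
    unfolding roots_eq by blast
  have lat: "\<xi> \<in> group_closure S" "- \<xi> \<in> group_closure S" using s lattice_S by auto
  let ?e = "(0, e \<xi> \<nu>, 0)" and ?f = "(0, f \<xi> \<nu>, 0)"
  have mem: "?e \<in> rs \<alpha>" "?f \<in> rs (- \<alpha>)"
    using choice_E(1,2)[OF s] rs_weight lat by (auto simp: \<alpha> weight_minus[symmetric])
  have nz: "brE ?e ?f \<noteq> 0"
  proof
    assume "brE ?e ?f = 0"
    then have w: "weight_vector \<xi> \<nu> = 0" unfolding weight_vector_def
      by (simp only: EL.scale_zero_right)
    have "\<alpha> t = 0" for t
    proof (cases "t \<in> T")
      case True
      then have "\<alpha> t = BE 0 t" using weight_vector_represents(2)[OF s True] w \<alpha> by simp
      then show ?thesis using True by (cases t) (auto simp: zero_prod_def BE_apply form_zero_left C_zero TC_C)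
    next
      case False
      then show ?thesis using weight_dual[of "(\<xi>, \<nu>)"] \<alpha> unfolding dual_on_def by blast
    qed
    then show False using nz by auto
  qed
  show "\<exists>x\<in>rs \<alpha>. \<exists>y\<in>rs (- \<alpha>). brE x y \<noteq> 0 \<and> brE x y \<in> T"
    by (intro bexI[where x = ?e] bexI[where x = ?f] conjI nz mem choice_E(4)[OF s])
next
  fix \<alpha> x y assume "\<alpha> \<in> An" and x: "x \<in> rs \<alpha>" and y: "y \<in> Ecar"
  then obtain \<xi> \<nu> where s: "supported \<xi> \<nu>" "\<xi> \<noteq> 0"
    and \<alpha>: "\<alpha> = weight (\<xi>, \<nu>)" unfolding anisotropic_eq by blast
  then obtain z where "x = (0, z, 0)" "z \<in> Lg \<xi> \<nu>"
    using x rs_weight lattice_S by (auto simp: E_part_nonzero_root)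
  then show "\<exists>n. (brE x ^^ n) y = 0" using E_ad_locally_nilpotent y s by blast
qed

section \<open>The core\<close>

abbreviation Ec where "Ec \<equiv> lie_core sE Ecar brE T BE"

lemma generators_eq:
  "(\<Union>\<alpha>\<in>An. rs \<alpha>) = {(0, x, 0) | x \<xi> \<nu>. \<xi> \<in> S - {0} \<and> Lg \<xi> \<nu> \<noteq> {0} \<and> x \<in> Lg \<xi> \<nu>}" (is "_ = ?G")
proof
  show "(\<Union>\<alpha>\<in>An. rs \<alpha>) \<subseteq> ?G"
  proof
    fix y assume "y \<in> (\<Union>\<alpha>\<in>An. rs \<alpha>)"
    then obtain \<xi> \<nu> where s: "supported \<xi> \<nu>" "\<xi> \<noteq> 0"
      and y: "y \<in> rs (weight (\<xi>, \<nu>))" unfolding anisotropic_eq by blast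
    then have "y \<in> {0} \<times> Lg \<xi> \<nu> \<times> {0}" using rs_weight lattice_S E_part_nonzero_root
      by blast
    then show "y \<in> ?G" using s by blast
  qed
  show "?G \<subseteq> (\<Union>\<alpha>\<in>An. rs \<alpha>)"
  proof
    fix y assume "y \<in> ?G"
    then obtain x \<xi> \<nu> where y: "y = (0, x, 0)" "\<xi> \<in> S - {0}" "Lg \<xi> \<nu> \<noteq> {0}" "x \<in> Lg \<xi> \<nu>" by blast
    then have "y \<in> rs (weight (\<xi>, \<nu>))"
      using rs_weight[of \<xi> \<nu>] lattice_S[of \<xi>] E_part_nonzero_root[of \<xi> \<nu>] by simp
    moreover have "weight (\<xi>, \<nu>) \<in> An" unfolding anisotropic_eq using y by blast
    ultimately show "y \<in> (\<Union>\<alpha>\<in>An. rs \<alpha>)" by blast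
  qed
qed

lemma Ec_subalgebra: "lie_subalgebra sE Ecar brE Ec"
proof -
  let ?G = "\<Union>\<alpha>\<in>An. rs \<alpha>"
    and ?F = "{M. lie_subalgebra sE Ecar brE M \<and> (\<Union>\<alpha>\<in>An. rs \<alpha>) \<subseteq> M}"
  have E: "Ecar \<in> ?F"
    using E_subspace brE_closed by (auto simp: lie_subalgebra_def root_space_def)
  have eq: "Ec = \<Inter>?F" by (simp add: lie_core_def hull_def)
  have "EL.subspace (\<Inter>?F)" by (rule EL.subspace_Inter) (auto simp: lie_subalgebra_def)
  moreover have "\<Inter>?F \<subseteq> Ecar" using E by blast
  moreover have "brE x y \<in> \<Inter>?F" if "x \<in> \<Inter>?F" "y \<in> \<Inter>?F" for x y
    using that unfolding lie_subalgebra_def by blast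
  ultimately show ?thesis unfolding eq lie_subalgebra_def by blast
qed

lemma Ec_subspace: "EL.subspace Ec" and Ec_subset: "Ec \<subseteq> Ecar"
  and Ec_bracket: "x \<in> Ec \<Longrightarrow> y \<in> Ec \<Longrightarrow> brE x y \<in> Ec"
  using Ec_subalgebra by (auto simp only: lie_subalgebra_def)

lemma zero_core: "(0, 0, 0) \<in> Ec"
  using EL.subspace_0[OF Ec_subspace] unfolding zero_prod_def .

lemma Ec_minimal:
  assumes "lie_subalgebra sE Ecar brE M" "\<And>\<xi> \<nu> x. \<xi> \<in> S - {0} \<Longrightarrow> x \<in> Lg \<xi> \<nu> \<Longrightarrow> (0, x, 0) \<in> M"
  shows "Ec \<subseteq> M"
  unfolding lie_core_def generators_eq by (rule hull_minimal) (use assms in auto)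

lemma Ec_generator: assumes "\<xi> \<in> S - {0}" "x \<in> Lg \<xi> \<nu>" shows "(0, x, 0) \<in> Ec"
proof (cases "Lg \<xi> \<nu> = {0}")
  case True
  then show ?thesis using zero_core assms by simp
next
  case False
  then show ?thesis unfolding lie_core_def generators_eq by (intro hull_inc) (use assms in blast)
qed

lemma C_min_subset: "C_min D BL \<subseteq> C"
  unfolding C_min_def by (rule C_space.span_minimal) (use sigma_C C_subspace in auto)

lemma Ec_subset_C_min: "Ec \<subseteq> C_min D BL \<times> UNIV \<times> {0}"
proof (rule Ec_minimal)
  have zero: "0 \<in> C_min D BL" unfolding C_min_def by (rule C_space.span_zero)
  have sub: "C_space.subspace (C_min D BL)" unfolding C_min_def by simp
  have sg: "sg l1 l2 \<in> C_min D BL" for l1 l2 unfolding C_min_def by (rule C_space.span_base) auto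
  show "lie_subalgebra sE Ecar brE (C_min D BL \<times> UNIV \<times> {0})"
    unfolding lie_subalgebra_def
  proof (intro conjI ballI)
    show "C_min D BL \<times> UNIV \<times> {0} \<subseteq> Ecar" using C_min_subset D_zero_in by auto
    show "EL.subspace (C_min D BL \<times> UNIV \<times> {0})"
      by (rule subspace_product[OF sub]) (auto simp: D_space.subspace_def)
    fix x y assume "x \<in> C_min D BL \<times> (UNIV :: 'l set) \<times> {0 :: 'l \<Rightarrow> 'l}" "y \<in> C_min D BL \<times> (UNIV :: 'l set) \<times> {0 :: 'l \<Rightarrow> 'l}"
    then obtain c1 l1 c2 l2 where "x = (c1, l1, 0)" "y = (c2, l2, 0)" "c1 \<in> C" "c2 \<in> C"
      using C_min_subset by blast
    then show "brE x y \<in> C_min D BL \<times> UNIV \<times> {0}" using brE_CL sg by simp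
  qed
  show "(0, x, 0) \<in> C_min D BL \<times> UNIV \<times> {0}" for x :: 'l using zero by simp
qed

lemma Ec_form: assumes "x \<in> Ec" obtains c l where "x = (c, l, 0)" "c \<in> C"
  using assms Ec_subset_C_min C_min_subset by blast

lemma Ec_surjective: "\<exists>c. (c, l, 0) \<in> Ec"
proof (induction l rule: L_induct)
  case zero
  show ?case using zero_core by blast
next
  case (homogeneous q \<nu> x)
  show ?case
  proof (cases "q = 0")
    case True
    then have "x \<in> Lg 0 \<nu>" using homogeneous by simp
    then show ?thesis
    proof (induction rule: Lg_0_induct)
      case zero
      show ?case using zero_core by blast
    next
      case (bracket \<xi> \<mu> a b)
      then have "- \<xi> \<in> S - {0}" using root_system.uminus_in by auto
      then have "brE (0, a, 0) (0, b, 0) \<in> Ec" using bracket Ec_generator Ec_bracket by blast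
      then show ?case unfolding brE_CL[OF C_zero_in C_zero_in] by blast
    next
      case (add x y)
      then obtain c c' where "(c, x, 0) \<in> Ec" "(c', y, 0) \<in> Ec" by blast
      then have "(c, x, 0) + (c', y, 0) \<in> Ec" by (rule EL.subspace_add[OF Ec_subspace])
      then show ?case unfolding add_Pair add_0 by blast
    qed
  qed (use homogeneous Ec_generator in blast)
next
  case (add x y)
  then obtain c c' where "(c, x, 0) \<in> Ec" "(c', y, 0) \<in> Ec" by blast
  then have "(c, x, 0) + (c', y, 0) \<in> Ec" by (rule EL.subspace_add[OF Ec_subspace])
  then show ?case unfolding add_Pair add_0 by blast
qed

text \<open>The core acts on \<open>L\<close> through its surjection onto \<open>L\<close>, which has trivial centre, while \<open>C\<close> acts trivially.\<close>

lemma Ec_centre: "lie_centre Ec brE = {x \<in> Ec. fst (snd x) = 0}"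
proof
  show "lie_centre Ec brE \<subseteq> {x \<in> Ec. fst (snd x) = 0}"
  proof
    fix x assume x: "x \<in> lie_centre Ec brE"
    then have xE: "x \<in> Ec" and z: "\<And>y. y \<in> Ec \<Longrightarrow> brE x y = 0"
      by (auto simp: lie_centre_def lie_centralizer_def)
    obtain c l where e: "x = (c, l, 0)" "c \<in> C" by (rule Ec_form[OF xE])
    have "brL l l' = 0" for l'
    proof -
      obtain c' where c': "(c', l', 0) \<in> Ec" using Ec_surjective by blast
      then have "c' \<in> C" using Ec_subset by auto
      then have "(sg l l', brL l l', 0) = (0 :: (('l \<Rightarrow> 'l) \<Rightarrow> 'k) \<times> 'l \<times> ('l \<Rightarrow> 'l))"
        using z[OF c'] brE_CL[OF e(2)] e(1) by simp
      then show ?thesis by (simp add: zero_prod_def)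
    qed
    then have "l = 0" by (rule centre_trivial)
    then show "x \<in> {x \<in> Ec. fst (snd x) = 0}" using xE e by simp
  qed
  show "{x \<in> Ec. fst (snd x) = 0} \<subseteq> lie_centre Ec brE"
  proof
    fix x assume x: "x \<in> {x \<in> Ec. fst (snd x) = 0}"
    then have xE: "x \<in> Ec" by simp
    obtain c l where e: "x = (c, l, 0)" "c \<in> C" by (rule Ec_form[OF xE])
    have l: "l = 0" using x e by simp
    have "brE x y = 0" if y: "y \<in> Ec" for y
    proof -
      obtain c' l' where "y = (c', l', 0)" "c' \<in> C" by (rule Ec_form[OF y])
      moreover have "sg 0 l' = 0" by (rule sigma_zero_left)
      ultimately show ?thesis using e l brE_CL br_zero_left by (simp add: zero_prod_def)
    qed
    then show "x \<in> lie_centre Ec brE" using xE by (simp add: lie_centre_def lie_centralizer_def)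
  qed
qed

text \<open>All elements of a coset of the centre have the same component in \<open>L\<close>.\<close>

lemma centreless_core:
  "\<exists>\<phi>. lie_quotient_iso sE Ec brE (lie_centre Ec brE) sL UNIV brL \<phi> \<and>
    (\<forall>c l d. (c, l, d) \<in> Ec \<longrightarrow> \<phi> (lie_coset (lie_centre Ec brE) (c, l, d)) = l)"
proof -
  let ?Z = "lie_centre Ec brE"
  define \<phi> :: "((('l \<Rightarrow> 'l) \<Rightarrow> 'k) \<times> 'l \<times> ('l \<Rightarrow> 'l)) set \<Rightarrow> 'l" where "\<phi> A = fst (snd (SOME x. x \<in> A))" for A
  have val: "\<phi> (lie_coset ?Z x) = fst (snd x)" for x
  proof -
    have "0 \<in> ?Z" unfolding Ec_centre using EL.subspace_0[OF Ec_subspace] by simp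
    then have "x + 0 \<in> lie_coset ?Z x" unfolding lie_coset_def by blast
    then have "(SOME y. y \<in> lie_coset ?Z x) \<in> lie_coset ?Z x" by (rule someI)
    then obtain z where "(SOME y. y \<in> lie_coset ?Z x) = x + z" "z \<in> ?Z" unfolding lie_coset_def
      by blast
    then show ?thesis unfolding \<phi>_def Ec_centre by simp
  qed
  have "bij_betw \<phi> (lie_coset ?Z ` Ec) UNIV"
    unfolding bij_betw_def
  proof (intro conjI inj_onI)
    fix A B assume A: "A \<in> lie_coset ?Z ` Ec" and B: "B \<in> lie_coset ?Z ` Ec"
      and eq: "\<phi> A = \<phi> B"
    obtain x y where xy: "x \<in> Ec" "y \<in> Ec" and e: "A = lie_coset ?Z x" "B = lie_coset ?Z y" using A B
      by blast
    have "x - y \<in> ?Z" "y - x \<in> ?Z"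
      unfolding Ec_centre using xy eq e val EL.subspace_diff[OF Ec_subspace] by auto
    have sub: "lie_coset ?Z u \<subseteq> lie_coset ?Z v" if uv: "u - v \<in> ?Z" for u v
    proof
      fix w assume "w \<in> lie_coset ?Z u"
      then obtain z where z: "w = u + z" "z \<in> ?Z" unfolding lie_coset_def by blast
      have "(u - v) + z \<in> ?Z" using uv z EL.subspace_add[OF Ec_subspace] unfolding Ec_centre by simp
      moreover have "w = v + ((u - v) + z)" using z by simp
      ultimately show "w \<in> lie_coset ?Z v" unfolding lie_coset_def by blast
    qed
    show "A = B" unfolding e using sub \<open>x - y \<in> ?Z\<close> \<open>y - x \<in> ?Z\<close> by blast
  next
    show "\<phi> ` lie_coset ?Z ` Ec = UNIV"
    proof -
      have "l \<in> \<phi> ` lie_coset ?Z ` Ec" for l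
      proof -
        obtain c where "(c, l, 0) \<in> Ec" using Ec_surjective by blast
        moreover have "\<phi> (lie_coset ?Z (c, l, 0)) = l" by (simp add: val)
        ultimately show ?thesis by (metis image_eqI)
      qed
      then show ?thesis by blast
    qed
  qed
  moreover have "fst (snd (brE x y)) = brL (fst (snd x)) (fst (snd y))" if xy: "x \<in> Ec" "y \<in> Ec" for x y
  proof -
    obtain c l where x: "x = (c, l, 0)" "c \<in> C" by (rule Ec_form[OF xy(1)])
    obtain c' l' where y: "y = (c', l', 0)" "c' \<in> C" by (rule Ec_form[OF xy(2)])
    show ?thesis using x y brE_CL by simp
  qed
  moreover have "fst (snd (sE k x)) = sL k (fst (snd x))" for k x by (cases x) (simp add: sE_apply)
  ultimately have "lie_quotient_iso sE Ec brE ?Z sL UNIV brL \<phi>"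
    unfolding lie_quotient_iso_def by (simp add: val)
  then show ?thesis using val by auto
qed

text \<open>Every generator \<open>x\<close> of the core equals \<open>[h, x] / 2\<close> for a coroot element lifted to the core.\<close>

lemma Ec_perfect: "EL.span {brE x y | x y. x \<in> Ec \<and> y \<in> Ec} = Ec" (is "EL.span ?B = Ec")
proof
  show sub: "EL.span ?B \<subseteq> Ec" by (rule EL.span_minimal) (use Ec_bracket Ec_subspace in auto)
  show "Ec \<subseteq> EL.span ?B"
  proof (rule Ec_minimal)
    show "lie_subalgebra sE Ecar brE (EL.span ?B)"
      unfolding lie_subalgebra_def
    proof (intro conjI ballI)
      show "EL.span ?B \<subseteq> Ecar" using sub Ec_subset by blast
      fix x y assume "x \<in> EL.span ?B" "y \<in> EL.span ?B"
      then have "x \<in> Ec" "y \<in> Ec" using sub by auto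
      then show "brE x y \<in> EL.span ?B" by (intro EL.span_base) blast
    qed simp
  next
    fix \<xi> \<nu> x assume \<xi>: "\<xi> \<in> S - {0}" and x: "x \<in> Lg \<xi> \<nu>"
    show "(0, x, 0) \<in> EL.span ?B"
    proof -
      obtain c where c: "(c, coroot_element \<xi>, 0) \<in> Ec" using Ec_surjective by blast
      then have cC: "c \<in> C" using Ec_subset by auto
      have "brE (c, coroot_element \<xi>, 0) (0, x, 0) = (0, sL 2 x, 0)"
        using brE_CL[OF cC C_zero_in] coroot_element_acts[OF \<xi> lattice_S x] \<xi> root_system.coroot_two
          sigma_degree_0_left[OF cartan_degree_0[OF coroot_element_cartan[OF \<xi>]]] by simp
      then have "(0, sL 2 x, 0) \<in> EL.span ?B" using c Ec_generator[OF \<xi> x] EL.span_base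
        by (metis (mono_tags, lifting) mem_Collect_eq)
      then have "sE (1/2) (0, sL 2 x, 0) \<in> EL.span ?B" by (rule EL.span_scale)
      then show ?thesis by (simp add: sE_apply C_space.scale_zero_right D_space.scale_zero_right del: zero_fun_apply)
    qed
  qed
qed

lemma core_eq_if_contains_C:
  assumes "\<And>c. c \<in> C \<Longrightarrow> (c, 0, 0) \<in> Ec" shows "Ec = C \<times> UNIV \<times> {0}"
proof
  show "Ec \<subseteq> C \<times> UNIV \<times> {0}" using Ec_subset_C_min C_min_subset by blast
  show "C \<times> UNIV \<times> {0} \<subseteq> Ec"
  proof
    fix x assume "x \<in> C \<times> (UNIV :: 'l set) \<times> {0 :: 'l \<Rightarrow> 'l}"
    then obtain c l where x: "x = (c, l, 0)" "c \<in> C" by blast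
    obtain c' where c': "(c', l, 0) \<in> Ec" using Ec_surjective by blast
    then have "c - c' \<in> C" using Ec_subset x C_diff_in by auto
    then have "(c - c', 0, 0) + (c', l, 0) \<in> Ec" using assms c' EL.subspace_add[OF Ec_subspace] by blast
    moreover have "(c - c', 0, 0) + (c', l, 0) = x" unfolding x add_Pair by simp
    ultimately show "x \<in> Ec" by simp
  qed
qed

text \<open>As \<open>C\<close> centralizes the core, tameness forces \<open>C\<close> into the core. Conversely, by invariance of the form
  the centralizer of a perfect subalgebra is orthogonal to it, and only \<open>C\<close> is orthogonal to \<open>C \<oplus> L\<close>.\<close>

lemma tame_iff: "tame_pair sE Ecar brE T BE \<longleftrightarrow> Ec = C \<times> UNIV \<times> {0}"
proof
  assume tame: "tame_pair sE Ecar brE T BE"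
  show "Ec = C \<times> UNIV \<times> {0}"
  proof (rule core_eq_if_contains_C)
    fix c assume c: "c \<in> C"
    have "brE (c, 0, 0) y = 0" if y: "y \<in> Ec" for y
    proof -
      obtain c' l' where "y = (c', l', 0)" "c' \<in> C" by (rule Ec_form[OF y])
      moreover have "sg 0 l' = 0" by (rule sigma_zero_left)
      ultimately show ?thesis using c brE_CL br_zero_left by (simp add: zero_prod_def)
    qed
    then have "(c, 0, 0) \<in> lie_centralizer Ecar brE Ec" using c D_zero_in
      by (simp add: lie_centralizer_def)
    then show "(c, 0, 0) \<in> Ec" using tame unfolding tame_pair_def by blast
  qed
next
  assume eq: "Ec = C \<times> UNIV \<times> {0}"
  show "tame_pair sE Ecar brE T BE"
    unfolding tame_pair_def
  proof
    fix z assume "z \<in> lie_centralizer Ecar brE Ec"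
    then have zE: "z \<in> Ecar" and van: "\<And>m. m \<in> Ec \<Longrightarrow> brE z m = 0"
      unfolding lie_centralizer_def by blast+
    obtain c l d where z: "z = (c, l, d)" by (metis prod_cases3)
    have m: "c \<in> C" "d \<in> D" using zE z by auto
    have BE0: "BE z 0 = 0" "BE 0 w = 0" if "w \<in> Ecar" for w
      using that C_zero m by (cases w, auto simp: z zero_prod_def BE_apply form_zero_left form_zero_right)+
    have orth: "BE z w = 0" if "w \<in> Ec" for w
    proof -
      have "w \<in> EL.span {brE x y | x y. x \<in> Ec \<and> y \<in> Ec}" using that Ec_perfect by simp
      then have "w \<in> Ecar \<and> BE z w = 0"
      proof (induction rule: EL.span_induct_alt)
        case base
        then show ?case using BE0 zE EL.subspace_0[OF E_subspace] by blast
      next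
        case (step k u v)
        then obtain x y where u: "u = brE x y" and xy: "x \<in> Ec" "y \<in> Ec" by blast
        then have E: "x \<in> Ecar" "y \<in> Ecar" "u \<in> Ecar" using Ec_subset brE_closed by blast+
        have "BE z u = BE (brE z x) y" using BE_invariant[OF zE E(1,2)] u by simp
        then have "BE z u = 0" using van[OF xy(1)] BE0(2)[OF E(2)] by simp
        moreover have ku: "sE k u \<in> Ecar" by (rule EL.subspace_scale[OF E_subspace E(3)])
        moreover have v: "v \<in> Ecar" "BE z v = 0" using step by blast+
        moreover have "BE z (sE k u + v) = BE z (sE k u) + BE z v" by (rule BE_add_right[OF ku v(1) zE])
        moreover have "BE z (sE k u) = k * BE z u" by (rule BE_scale_right[OF zE E(3)])
        moreover have "sE k u + v \<in> Ecar" by (rule EL.subspace_add[OF E_subspace ku v(1)])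
        ultimately show ?case by (simp only: mult_zero_right add_0_right simp_thms)
      qed
      then show ?thesis by simp
    qed
    have "BL l l' = 0" for l'
    proof -
      have "BE z (0, l', 0) = 0" using orth eq C_zero_in by blast
      then show ?thesis using C_zero[OF m(1)] by (simp add: z BE_apply)
    qed
    then have l: "l = 0" by (rule form_nondegenerate)
    have "d l' = 0" for l'
    proof (rule form_nondegenerate)
      fix l''
      have "BE z (sg l' l'', 0, 0) = 0" using orth eq sigma_C by blast
      then show "BL (d l') l'' = 0" using form_zero_right m C_zero[OF m(1)]
        by (simp add: z BE_apply sigma_apply)
    qed
    then have "d = 0" by auto
    then show "z \<in> Ec" using eq z l m by simp
  qed
qed

text \<open>As \<open>C\<close> is central in \<open>C \<oplus> L\<close> and the core maps onto \<open>L\<close>, all brackets of \<open>C \<oplus> L\<close> are brackets of elements of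
  the core.\<close>

lemma core_eq_iff_perfect: "Ec = C \<times> UNIV \<times> {0} \<longleftrightarrow> perfect_lie sE (C \<times> UNIV \<times> {0}) brE"
proof
  assume "Ec = C \<times> UNIV \<times> {0}"
  then show "perfect_lie sE (C \<times> UNIV \<times> {0}) brE" using Ec_perfect unfolding perfect_lie_def
    by simp
next
  assume perfect: "perfect_lie sE (C \<times> UNIV \<times> {0}) brE"
  have "EL.span {brE x y | x y. x \<in> C \<times> UNIV \<times> {0} \<and> y \<in> C \<times> UNIV \<times> {0}} \<subseteq> Ec"
  proof (rule EL.span_minimal[OF _ Ec_subspace])
    show "{brE x y | x y. x \<in> C \<times> UNIV \<times> {0} \<and> y \<in> C \<times> UNIV \<times> {0}} \<subseteq> Ec"
    proof
      fix z assume "z \<in> {brE x y | x y. x \<in> C \<times> (UNIV :: 'l set) \<times> {0 :: 'l \<Rightarrow> 'l} \<and> y \<in> C \<times> (UNIV :: 'l set) \<times> {0 :: 'l \<Rightarrow> 'l}}"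
      then obtain c1 l1 c2 l2 where z: "z = brE (c1, l1, 0) (c2, l2, 0)" "c1 \<in> C" "c2 \<in> C" by blast
      obtain c1' c2' where c': "(c1', l1, 0) \<in> Ec" "(c2', l2, 0) \<in> Ec" using Ec_surjective by metis
      then have "c1' \<in> C" "c2' \<in> C" using Ec_subset by auto
      then have "z = brE (c1', l1, 0) (c2', l2, 0)" using z brE_CL by simp
      then show "z \<in> Ec" using c' Ec_bracket by simp
    qed
  qed
  then have "C \<times> UNIV \<times> {0} \<subseteq> Ec" using perfect unfolding perfect_lie_def by simp
  then show "Ec = C \<times> UNIV \<times> {0}" using Ec_subset_C_min C_min_subset by blast
qed

lemma Lg_0_bracket:
  assumes "Lg 0 \<nu> \<noteq> {0}"
  obtains \<xi> \<mu> where "\<xi> \<noteq> 0" "supported \<xi> \<mu>" "supported (- \<xi>) (\<nu> - \<mu>)"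
proof -
  have "\<exists>\<xi> \<mu>. \<xi> \<noteq> 0 \<and> supported \<xi> \<mu> \<and> supported (- \<xi>) (\<nu> - \<mu>)"
  proof (rule ccontr)
    assume no: "\<not> ?thesis"
    have "x = 0" if "x \<in> Lg 0 \<nu>" for x
      using that
    proof (induction rule: Lg_0_induct)
      case (bracket \<xi> \<mu> a b)
      then have "- \<xi> \<in> S" using root_system.uminus_in by auto
      then have "Lg \<xi> \<mu> = {0} \<or> Lg (- \<xi>) (\<nu> - \<mu>) = {0}" using no bracket(1) by blast
      then show ?case using bracket(2,3) br_zero_left br_zero_right by auto
    qed auto
    then show False using assms Lg_zero[of 0 \<nu>] by auto
  qed
  then show ?thesis using that by blast
qed

text \<open>An isotropic root comes from a nonzero \<open>L\<^sub>0\<^sup>\<nu>\<close>, which contains a nonzero bracket of elements of opposite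
  anisotropic root spaces.\<close>

lemma roots_tame: "tame_roots sE Ecar brE T BE"
  unfolding tame_roots_def
proof
  fix \<alpha> assume "\<alpha> \<in> Rts - An"
  then obtain \<nu> where \<nu>: "\<alpha> = weight (0, \<nu>)" "Lg 0 \<nu> \<noteq> {0}"
    unfolding roots_eq anisotropic_eq by blast
  obtain \<xi> \<mu> where s: "\<xi> \<noteq> 0" "supported \<xi> \<mu>" "supported (- \<xi>) (\<nu> - \<mu>)"
    by (rule Lg_0_bracket[OF \<nu>(2)])
  have "\<alpha> = weight (\<xi>, \<mu>) + weight (- \<xi>, \<nu> - \<mu>)"
    using weight_add[of \<xi> "- \<xi>" \<mu> "\<nu> - \<mu>"] \<nu> by simp
  moreover have "weight (\<xi>, \<mu>) \<in> An" "weight (- \<xi>, \<nu> - \<mu>) \<in> An"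
    unfolding anisotropic_eq using s neg_equal_0_iff_equal by blast+
  ultimately show "\<exists>\<beta>\<in>An. \<exists>\<gamma>\<in>An. \<alpha> = \<beta> + \<gamma>" by blast
qed

lemma cartan_in_core: assumes "x \<in> cartan_subspace" shows "(0, x, 0) \<in> Ec"
  using assms[unfolded cartan_subspace_def]
proof (induction rule: span_induct_alt)
  case base
  show ?case by (rule zero_core)
next
  case (step k x y)
  then obtain \<alpha> where \<alpha>: "\<alpha> \<in> indivisible sY S" "x = coroot_element \<alpha>"
    by blast
  obtain e f where inv: "invertible_with S co sL brL Lg \<alpha> 0 e f" using RG2[OF \<alpha>(1)] by blast
  then have ef: "e \<in> Lg \<alpha> 0" "f \<in> Lg (- \<alpha>) 0" by (auto simp: invertible_with_def)
  have S: "\<alpha> \<in> S - {0}" "- \<alpha> \<in> S - {0}"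
    using root_system.indivisible_in[OF \<alpha>(1)] root_system.uminus_in by auto
  have "brE (0, f, 0) (0, e, 0) \<in> Ec"
    using Ec_generator[OF S(1) ef(1)] Ec_generator[OF S(2) ef(2)] Ec_bracket by blast
  moreover have "sg f e = 0" using sigma_degree_0_left[OF Lg_degree_part[OF lattice_S ef(2)]] S by blast
  ultimately have "(0, x, 0) \<in> Ec" using brE_CL[OF C_zero_in C_zero_in] invertible_coroot_element[OF inv] \<alpha> by simp
  then have "sE k (0, x, 0) + (0, y, 0) \<in> Ec"
    using step EL.subspace_add[OF Ec_subspace] EL.subspace_scale[OF Ec_subspace] by blast
  then show ?case unfolding sE_apply add_Pair C_space.scale_zero_right D_space.scale_zero_right add_0 .
qed

definition degree_evaluation :: "'g \<Rightarrow> ('l \<Rightarrow> 'l) \<Rightarrow> 'k" where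
  "degree_evaluation \<nu> = (\<lambda>d. if d \<in> D then evt \<nu> d else 0)"

lemma sigma_degree_evaluation:
  assumes "D = TD" "x \<in> Ldeg \<nu>" shows "sg x y = sC (BL x y) (degree_evaluation \<nu>)"
proof
  fix d
  show "sg x y d = sC (BL x y) (degree_evaluation \<nu>) d"
  proof (cases "d \<in> D")
    case True
    then have "d \<in> TD" using assms(1) by blast
    then show ?thesis
      using True TD_acts[OF \<open>d \<in> TD\<close> assms(2)]
      by (simp add: sigma_def degree_evaluation_def fun_scale_def form_scale_left)
  qed (simp add: sigma_def degree_evaluation_def fun_scale_def)
qed

lemma degree_evaluation_add:
  assumes "D = TD" shows "degree_evaluation (\<nu> + \<mu>) = degree_evaluation \<nu> + degree_evaluation \<mu>"
proof
  fix d
  have "d \<in> TD" if "d \<in> D" using that assms by blast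
  then show "degree_evaluation (\<nu> + \<mu>) d = (degree_evaluation \<nu> + degree_evaluation \<mu>) d"
    using additive.add[OF ev_additive] by (simp add: degree_evaluation_def)
qed

text \<open>For \<open>\<xi> \<noteq> 0\<close> the evaluation is, up to a factor, what remains of \<open>[e, f]\<close> after the coroot element is
  removed, and the coroot element lies in the core by itself. The degrees of \<open>L\<^sub>0\<close> are sums of two
  degrees of nonzero root spaces.\<close>

lemma degree_evaluation_in_core:
  assumes TD: "D = TD" and s: "supported \<xi> \<nu>"
  shows "(degree_evaluation \<nu>, 0, 0) \<in> Ec"
proof -
  have nonzero: "(degree_evaluation \<mu>, 0, 0) \<in> Ec" if s: "supported \<eta> \<mu>"
    and \<eta>: "\<eta> \<noteq> 0" for \<eta> \<mu>
  proof -
    have S: "\<eta> \<in> S - {0}" "- \<eta> \<in> S - {0}" using s \<eta> root_system.uminus_in by auto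
    have "brE (0, e \<eta> \<mu>, 0) (0, f \<eta> \<mu>, 0) \<in> Ec"
      using Ec_generator[OF S(1) choice_in(1)] Ec_generator[OF S(2) choice_in(2)] s Ec_bracket by blast
    then have "(sg (e \<eta> \<mu>) (f \<eta> \<mu>), - coroot_element \<eta>, 0) \<in> Ec"
      using choice_E(3)[OF s] \<eta> by simp
    then have "(sg (e \<eta> \<mu>) (f \<eta> \<mu>), - coroot_element \<eta>, 0) + (0, coroot_element \<eta>, 0) \<in> Ec"
      using cartan_in_core[OF coroot_element_cartan[OF S(1)]] EL.subspace_add[OF Ec_subspace] by blast
    then have "(sg (e \<eta> \<mu>) (f \<eta> \<mu>), 0, 0) \<in> Ec"
      by (simp only: add_Pair add_0_right left_minus)
    then have "(sC (BL (e \<eta> \<mu>) (f \<eta> \<mu>)) (degree_evaluation \<mu>), 0, 0) \<in> Ec"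
      using sigma_degree_evaluation[OF TD Lg_degree_part[OF lattice_S choice_in(1)]] s by simp
    then have "sE (inverse (BL (e \<eta> \<mu>) (f \<eta> \<mu>))) (sC (BL (e \<eta> \<mu>) (f \<eta> \<mu>)) (degree_evaluation \<mu>), 0, 0) \<in> Ec"
      by (rule EL.subspace_scale[OF Ec_subspace])
    moreover have "BL (e \<eta> \<mu>) (f \<eta> \<mu>) \<noteq> 0" using choice_form_nonzero s by blast
    ultimately show ?thesis by (simp add: sE_apply D_space.scale_zero_right del: zero_fun_apply)
  qed
  show ?thesis
  proof (cases "\<xi> = 0")
    case True
    then have "Lg 0 \<nu> \<noteq> {0}" using s by simp
    then obtain \<eta> \<mu> where \<eta>: "\<eta> \<noteq> 0" "supported \<eta> \<mu>" "supported (- \<eta>) (\<nu> - \<mu>)" by (rule Lg_0_bracket)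
    then have "- \<eta> \<noteq> 0" by simp
    then have "(degree_evaluation \<mu>, 0, 0) + (degree_evaluation (\<nu> - \<mu>), 0, 0) \<in> Ec"
      by (rule EL.subspace_add[OF Ec_subspace nonzero[OF \<eta>(2,1)] nonzero[OF \<eta>(3)]])
    then show ?thesis using degree_evaluation_add[OF TD, of \<mu> "\<nu> - \<mu>"] unfolding add_Pair add_0
      by simp
  qed (use nonzero s in blast)
qed

text \<open>As \<open>D\<close> consists of degree derivations, \<open>\<sigma>(x, y)\<close> is a multiple of the evaluation at the degree of \<open>x\<close>.\<close>

lemma tame_if_degree_derivations:
  assumes TD: "D = TD" and C: "C = C_min D BL" shows "tame_pair sE Ecar brE T BE"
  unfolding tame_iff
proof (rule core_eq_if_contains_C)
  have sg: "(sg x y, 0, 0) \<in> Ec" for x y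
  proof (induction x rule: L_induct)
    case zero
    show ?case unfolding sigma_zero_left by (rule zero_core)
  next
    case (homogeneous q \<nu> x)
    show ?case
    proof (cases "x = 0")
      case True
      show ?thesis unfolding True sigma_zero_left by (rule zero_core)
    next
      case False
      then have "supported q \<nu>" using homogeneous by auto
      then have "sE (BL x y) (degree_evaluation \<nu>, 0, 0) \<in> Ec"
        using degree_evaluation_in_core[OF TD] EL.subspace_scale[OF Ec_subspace] by blast
      then show ?thesis
        using sigma_degree_evaluation[OF TD Lg_degree_part[OF lattice_S[OF homogeneous(1)] homogeneous(2)]]
        by (simp add: sE_apply D_space.scale_zero_right del: zero_fun_apply)
    qed
  next
    case (add x x')
    have "(sg x y, 0, 0) + (sg x' y, 0, 0) \<in> Ec" by (rule EL.subspace_add[OF Ec_subspace add])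
    then show ?case unfolding sigma_add_left add_Pair add_0 .
  qed
  fix c assume "c \<in> C"
  then have "c \<in> C_space.span {sg l1 l2 | l1 l2. True}" using C unfolding C_min_def by simp
  then show "(c, 0, 0) \<in> Ec"
  proof (induction rule: C_space.span_induct_alt)
    case base
    show ?case by (rule zero_core)
  next
    case (step k u v)
    then have "sE k (u, 0, 0) + (v, 0, 0) \<in> Ec"
      using sg EL.subspace_add[OF Ec_subspace] EL.subspace_scale[OF Ec_subspace] by blast
    then show ?case unfolding sE_apply add_Pair scale_zero_right D_space.scale_zero_right add_0 .
  qed
qed

section \<open>Lie tori\<close>

text \<open>In a Lie torus every bracket \<open>[L\<^sub>\<xi>, L\<^sub>-\<^sub>\<xi>]\<close> of opposite degrees is spanned by a coroot
  element. Conversely, if \<open>L\<^sub>0\<^sup>0\<close> is the Cartan subspace, then by nondegeneracy of the form \<open>[f, x]\<close> is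
  a multiple of the coroot element for every \<open>x\<close> of the degree of \<open>e\<close>, so \<open>x\<close> differs from a multiple
  of \<open>e\<close> by a vector killed by \<open>f\<close>.\<close>

lemma lie_torus_iff: "lie_torus sY S co sL brL Lg \<longleftrightarrow> Lg 0 0 = cartan_subspace"
proof
  assume torus: "lie_torus sY S co sL brL Lg"
  have "Lg 0 0 \<subseteq> cartan_subspace"
  proof
    fix x assume "x \<in> Lg 0 0"
    then show "x \<in> cartan_subspace"
    proof (induction rule: Lg_0_induct)
      case (bracket \<xi> \<mu> a b)
      then have \<xi>: "\<xi> \<in> S - {0}" and a: "a \<in> Lg \<xi> \<mu>"
        and b: "b \<in> Lg (- \<xi>) (- \<mu>)" by simp_all
      show ?case
    proof (cases "Lg \<xi> \<mu> = {0}")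
      case True
      then show ?thesis using a zero_cartan br_zero_left by simp
    next
      case False
      then have s: "supported \<xi> \<mu>" using \<xi> by simp
      have nz: "e \<xi> \<mu> \<noteq> 0" "f \<xi> \<mu> \<noteq> 0"
        using choice_form_nonzero[of \<xi> \<mu>] s form_zero_left form_zero_right by auto
      have line: "\<exists>k. y = sL k z" 
        if yz: "y \<in> Lg \<eta> \<kappa>" "z \<in> Lg \<eta> \<kappa>" "z \<noteq> 0" "\<eta> \<in> S - {0}" for y z \<eta> \<kappa>
      proof -
        obtain v where v: "Lg \<eta> \<kappa> \<subseteq> span {v}"
          using torus \<open>\<eta> \<in> S - {0}\<close> unfolding lie_torus_def by blast
        have "y \<in> span {v}" "z \<in> span {v}" using v yz(1,2) by blast+
        then obtain p q where "y = sL p v" "z = sL q v" unfolding span_singleton by blast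
        moreover from this have "q \<noteq> 0" using \<open>z \<noteq> 0\<close> by auto
        ultimately have "y = sL (p / q) z" by simp
        then show ?thesis by blast
      qed
      have "- \<xi> \<in> S - {0}" using \<xi> root_system.uminus_in by auto
      then obtain k k' where "a = sL k (e \<xi> \<mu>)" "b = sL k' (f \<xi> \<mu>)"
        using line[OF a choice_in(1) nz(1) \<xi>] line[OF b choice_in(2) nz(2)] s by blast
      then have "brL a b = sL (k * k') (- coroot_element \<xi>)"
        using choice_bracket[of \<xi> \<mu>] s \<xi> by (simp add: br_scale_left br_scale_right)
      then show ?thesis
        using coroot_element_cartan[OF \<xi>] subspace_scale[OF cartan_subspace_subspace] subspace_neg[OF cartan_subspace_subspace] by simp
    qed
    qed (auto intro: zero_cartan subspace_add[OF cartan_subspace_subspace])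
  qed
  then show "Lg 0 0 = cartan_subspace" using cartan_subspace_degree by blast
next
  assume eq: "Lg 0 0 = cartan_subspace"
  have "\<exists>v. Lg \<alpha> \<nu> \<subseteq> span {v}" if \<alpha>: "\<alpha> \<in> S - {0}" for \<alpha> \<nu>
  proof (cases "Lg \<alpha> \<nu> = {0}")
    case False
    let ?e = "e \<alpha> \<nu>" and ?f = "f \<alpha> \<nu>"
    have inv: "invertible_with S co sL brL Lg \<alpha> \<nu> ?e ?f" using choice_nonzero[OF \<alpha> False]
      by simp
    have ef: "?e \<in> Lg \<alpha> \<nu>" "?f \<in> Lg (- \<alpha>) (- \<nu>)" using inv
      by (auto simp: invertible_with_def)
    have lat: "\<alpha> \<in> group_closure S" "- \<alpha> \<in> group_closure S" using \<alpha> lattice_S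
      by auto
    have "x \<in> span {?e}" if x: "x \<in> Lg \<alpha> \<nu>" for x
    proof -
      \<comment> \<open>chosen such that \<open>x - k e\<close> is orthogonal to \<open>f\<close>\<close>
      define k where "k = BL x ?f / BL ?e ?f"
      let ?y = "x - sL k ?e"
      have y: "?y \<in> Lg \<alpha> \<nu>"
        using x ef subspace_diff subspace_scale Lg_subspace[OF lat(1)] by blast
      have "BL ?e ?f \<noteq> 0" by (rule invertible_pair_form_nonzero[OF \<alpha> inv])
      then have yf: "BL ?y ?f = 0" by (simp add: k_def form_diff_left form_scale_left)
      have "brL ?f ?y \<in> Lg (- \<alpha> + \<alpha>) (- \<nu> + \<nu>)"
        by (rule grading_bracket[OF lat(2,1) ef(2) y])
      then have cart: "brL ?f ?y \<in> cartan_subspace" using eq by simp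
      have "BL (brL ?f ?y) h' = 0" if h': "h' \<in> cartan_subspace" for h'
      proof -
        have "BL (brL ?f ?y) h' = BL ?f (brL ?y h')" by (rule form_invariant)
        also have "brL ?y h' = sL (- cartan_weight h' \<alpha>) ?y"
          using br_skew[of ?y h'] cartan_acts[OF h' lat(1) y] by simp
        finally show ?thesis using yf form_sym[of ?f ?y] by (simp add: form_scale_right form_minus_right)
      qed
      then have "brL ?f ?y = 0" using cartan_nondegenerate cart unfolding nondegenerate_on_def by blast
      then have "?y = 0" by (rule no_lowest_weight_vector[OF \<alpha> inv y])
      then show ?thesis by (auto simp: span_singleton)
    qed
    then show ?thesis by blast
  qed (auto simp: span_zero)
  then show "lie_torus sY S co sL brL Lg"
    unfolding lie_torus_def using predivision_graded_lie_algebra_axioms by blast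
qed

lemma root_space_zero_iff:
  "rs 0 = T \<longleftrightarrow> invariant_lie_torus sY S co sL brL Lg \<and> TD = Dg 0 \<and> TC = Cg 0"
proof -
  have "rs 0 = Cg 0 \<times> Lg 0 0 \<times> Dg 0"
    using rs_weight[of 0 0] weight_zero by (simp add: E_part_def)
  moreover have "Cg 0 \<times> Lg 0 0 \<times> Dg 0 = T \<longleftrightarrow> Cg 0 = TC \<and> Lg 0 0 = cartan_subspace \<and> Dg 0 = TD"
    using zero_TC zero_cartan TD_zero_in by (auto simp: times_eq_iff)
  moreover have "invariant_lie_torus sY S co sL brL Lg \<longleftrightarrow> Lg 0 0 = cartan_subspace"
    unfolding invariant_lie_torus_def lie_torus_iff using graded_form by blast
  ultimately show ?thesis by auto
qed

end

theorem theorem6p10: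
  fixes sY :: "'k::field_char_0 \<Rightarrow> 'y::ab_group_add \<Rightarrow> 'y"
    and S :: "'y set" and co :: "'y \<Rightarrow> 'y \<Rightarrow> 'k"
    and sL :: "'k \<Rightarrow> 'l::ab_group_add \<Rightarrow> 'l" and brL :: "'l \<Rightarrow> 'l \<Rightarrow> 'l"
    and Lg :: "'y \<Rightarrow> 'g::ab_group_add \<Rightarrow> 'l set"
    and BL :: "'l \<Rightarrow> 'l \<Rightarrow> 'k"
    and e h f :: "'y \<Rightarrow> 'g \<Rightarrow> 'l"
    and D TD :: "('l \<Rightarrow> 'l) set"
    and C TC :: "(('l \<Rightarrow> 'l) \<Rightarrow> 'k) set"
    and \<tau> :: "('l \<Rightarrow> 'l) \<Rightarrow> ('l \<Rightarrow> 'l) \<Rightarrow> (('l \<Rightarrow> 'l) \<Rightarrow> 'k)"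
  assumes data: "affine_extension_data sY S co sL brL Lg BL e h f D TD C TC \<tau>"
    and "sE = E_scale sL"
    and "E = C \<times> (UNIV :: 'l set) \<times> D"
    and "brE = E_bracket brL BL D \<tau>"
    and "T = TC \<times> cartan sY S sL h \<times> TD"
    and "BE = E_form BL"
    and "Ec = lie_core sE E brE T BE"
  shows
    "invariant_affine_reflection_algebra sE E brE T BE \<and>
     \<comment> \<open>the projection to \<open>L\<close> identifies the centreless core with \<open>L\<close>\<close>
     (\<exists>\<phi>. lie_quotient_iso sE Ec brE (lie_centre Ec brE) sL UNIV brL \<phi> \<and>
       (\<forall>c l d. (c, l, d) \<in> Ec \<longrightarrow> \<phi> (lie_coset (lie_centre Ec brE) (c, l, d)) = l)) \<and>
     \<comment> \<open>(a)\<close>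
     Ec \<subseteq> C_min D BL \<times> UNIV \<times> {0} \<and>
     (tame_pair sE E brE T BE \<longleftrightarrow> Ec = C \<times> UNIV \<times> {0}) \<and>
     (Ec = C \<times> UNIV \<times> {0} \<longleftrightarrow> perfect_lie sE (C \<times> UNIV \<times> {0}) brE) \<and>
     \<comment> \<open>(b)\<close>
     (D = TD \<and> TD = degree_derivations S sL Lg \<and> C = TC \<and> TC = C_min D BL \<longrightarrow>
       tame_pair sE E brE T BE) \<and>
     \<comment> \<open>(c)\<close>
     tame_roots sE E brE T BE \<and>
     \<comment> \<open>(d)\<close>
     (root_space sE E brE T 0 = T \<longleftrightarrow>
       invariant_lie_torus sY S co sL brL Lg \<and>
       TD = D_part S sL brL Lg D 0 \<and> TC = C_part S sL brL Lg D C 0)"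
proof -
  interpret affine_extension_data sY S co sL brL Lg BL e h f D TD C TC \<tau> by (rule data)
  have T: "T = TC \<times> cartan_subspace \<times> TD" using assms(5) cartan_eq by simp
  show ?thesis
    unfolding assms(7) unfolding assms(2,3,4,6) T
    by (intro conjI impI E_invariant_affine_reflection_algebra centreless_core Ec_subset_C_min tame_iff
        core_eq_iff_perfect roots_tame root_space_zero_iff tame_if_degree_derivations) auto
qed

end
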